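(* Let $X$ be a real or complex Banach space. (a) If $X$ has the $2$-dimensional $2$-summing property, then $X$ is finite dimensional. (b) If $X$ has the $k$-dimensional $2$-summing property for some positive integer $k$, then so does its dual $X^*$ (that is, $X^*$ has the $k$-dimensional $2$-summing property for the same $k$). (c) If $X$ has the $2$-summing property, then $X$ is a maximal distance space.
   Context: The scalar field is $\mathbb{R}$ or $\mathbb{C}$ (fixed for all spaces), and operators are bounded and linear. For an operator $T:X\to Y$ between Banach spaces, the $2$-summing norm is $\pi_2(T)=\sup\big(\sum_{i=1}^n\|TUe_i\|^2\big)^{1/2}\in[0,\infty]$, the supremum over all $n\ge 1$ and all operators $U:\ell_2^n\to X$ with $\|U\|\le 1$, where $(e_i)$ is the unit vector basis of $\ell_2^n$. $X$ has the $k$-dimensional $2$-summing property if $\pi_2(T)=\|T\|$ for every operator $T:X\to\ell_2^k$; $X$ has the $2$-summing property if $\pi_2(T)=\|T\|$ for every operator $T:X\to\ell_2$ (equivalently, $X$ has the $k$-dimensional $2$-summing property for every $k\ge1$). The Banach–Mazur distance is $d(X,Y)=\inf\|T\|\|T^{-1}\|$ over invertible operators $T$ from $X$ onto $Y$. For an $n$-dimensional $X$ one always has $d(X,\ell_2^n)\le\sqrt n$; a maximal distance space is a finite dimensional $X$, of dimension $n$ say, with $d(X,\ell_2^n)=\sqrt n$. *)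

theory Defs
  imports "HOL-Analysis.Analysis" "HOL-Library.Function_Algebras"
begin

text \<open>
  A common interface for the two scalar fields: up to isometric isomorphism, the members of this
  class are exactly the real and the complex numbers.
\<close>

class real_or_complex = real_normed_field +
  assumes real_or_complex:
    "(\<forall>x. \<exists>a. x = a *\<^sub>R 1) \<or>
     (\<exists>i. i * i = - 1 \<and> (\<forall>x. \<exists>a b. x = a *\<^sub>R 1 + b *\<^sub>R i) \<and>
          (\<forall>a b. norm (a *\<^sub>R 1 + b *\<^sub>R i) = sqrt (a\<^sup>2 + b\<^sup>2)))"

instance real :: real_or_complex
  by standard auto

instance complex :: real_or_complex
proof
  have "\<exists>a b. x = a *\<^sub>R 1 + b *\<^sub>R \<i>" for x
    by (intro exI[of _ "Re x"] exI[of _ "Im x"]) (simp add: complex_eq_iff)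
  moreover have "norm (a *\<^sub>R 1 + b *\<^sub>R \<i>) = sqrt (a\<^sup>2 + b\<^sup>2)" for a b
    by (simp add: cmod_def)
  ultimately show "(\<forall>x::complex. \<exists>a. x = a *\<^sub>R 1) \<or>
     (\<exists>i::complex. i * i = - 1 \<and> (\<forall>x. \<exists>a b. x = a *\<^sub>R 1 + b *\<^sub>R i) \<and>
          (\<forall>a b. norm (a *\<^sub>R 1 + b *\<^sub>R i) = sqrt (a\<^sup>2 + b\<^sup>2)))"
    by (intro disjI2 exI[of _ \<i>] conjI allI) auto
qed

text \<open>
  Spaces have explicit carriers because \<open>\<ell>\<^sub>2\<^sup>n\<close> is needed with \<open>n\<close> varying inside formulas, and because
  the dual of a complex space is a proper part of the space of real-linear maps. Addition and zero
  are those of the ambient type; the norm is only meaningful on the carrier.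
\<close>

record ('k, 'x) nspace =
  car :: "'x set"
  scl :: "'k \<Rightarrow> 'x \<Rightarrow> 'x"
  nrm :: "'x \<Rightarrow> real"

definition normed_space :: "('k::real_or_complex, 'x::ab_group_add) nspace \<Rightarrow> bool" where
  "normed_space X \<longleftrightarrow>
     vector_space (scl X) \<and> module.subspace (scl X) (car X) \<and>
     (\<forall>x\<in>car X. nrm X x = 0 \<longleftrightarrow> x = 0) \<and>
     (\<forall>x\<in>car X. \<forall>y\<in>car X. nrm X (x + y) \<le> nrm X x + nrm X y) \<and>
     (\<forall>c. \<forall>x\<in>car X. nrm X (scl X c x) = norm c * nrm X x)"

definition banach_space :: "('k::real_or_complex, 'x::ab_group_add) nspace \<Rightarrow> bool" where
  "banach_space X \<longleftrightarrow> normed_space X \<and>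
     (\<forall>s::nat \<Rightarrow> 'x. range s \<subseteq> car X \<and>
        (\<forall>e>0. \<exists>M. \<forall>m\<ge>M. \<forall>n\<ge>M. nrm X (s m - s n) < e) \<longrightarrow>
        (\<exists>x\<in>car X. (\<lambda>n. nrm X (s n - x)) \<longlonglongrightarrow> 0))"

lemma banach_space_UNIV:
  "banach_space \<lparr>car = UNIV :: 'x::banach set, scl = scaleR, nrm = norm\<rparr>"
proof -
  have "\<exists>x. (\<lambda>n. norm (s n - x)) \<longlonglongrightarrow> 0"
    if "\<forall>e>0. \<exists>M. \<forall>m\<ge>M. \<forall>n\<ge>M. norm (s m - s n) < e" for s :: "nat \<Rightarrow> 'x"
  proof -
    have "Cauchy s"
      using that by (simp add: Cauchy_def dist_norm)
    then obtain x where "s \<longlonglongrightarrow> x"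
      using Cauchy_convergent convergent_def by blast
    then show ?thesis
      using LIM_zero tendsto_norm_zero by blast
  qed
  moreover have "module.subspace scaleR (UNIV :: 'x set)"
    using subspace_UNIV unfolding subspace_raw_def .
  moreover have "vector_space (scaleR :: real \<Rightarrow> 'x \<Rightarrow> 'x)"
    by (rule real_vector.vector_space_axioms)
  ultimately show ?thesis
    by (auto simp: banach_space_def normed_space_def norm_triangle_ineq)
qed

definition finite_dimensional :: "('k::real_or_complex, 'x::ab_group_add) nspace \<Rightarrow> bool" where
  "finite_dimensional X \<longleftrightarrow> (\<exists>B. finite B \<and> module.span (scl X) B = car X)"

definition dimension :: "('k::real_or_complex, 'x::ab_group_add) nspace \<Rightarrow> nat" where
  "dimension X = vector_space.dim (scl X) (car X)"

definition bounded_op :: "('k::real_or_complex, 'x::ab_group_add) nspace \<Rightarrow>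
    ('k, 'y::ab_group_add) nspace \<Rightarrow> ('x \<Rightarrow> 'y) \<Rightarrow> bool" where
  "bounded_op X Y T \<longleftrightarrow>
     T ` car X \<subseteq> car Y \<and>
     (\<forall>x\<in>car X. \<forall>y\<in>car X. T (x + y) = T x + T y) \<and>
     (\<forall>c. \<forall>x\<in>car X. T (scl X c x) = scl Y c (T x)) \<and>
     (\<exists>C. \<forall>x\<in>car X. nrm Y (T x) \<le> C * nrm X x)"

definition op_norm :: "('k::real_or_complex, 'x::ab_group_add) nspace \<Rightarrow>
    ('k, 'y::ab_group_add) nspace \<Rightarrow> ('x \<Rightarrow> 'y) \<Rightarrow> real" where
  "op_norm X Y T = (SUP x\<in>{x \<in> car X. nrm X x \<le> 1}. nrm Y (T x))"

definition scalars :: "('k::real_or_complex, 'k) nspace" where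
  "scalars = \<lparr>car = UNIV, scl = (*), nrm = norm\<rparr>"

text \<open>
  Functionals are normalised to vanish off the carrier, so that each functional on \<open>X\<close> is
  represented by exactly one function.
\<close>

definition dual :: "('k::real_or_complex, 'x::ab_group_add) nspace \<Rightarrow> ('k, 'x \<Rightarrow> 'k) nspace" where
  "dual X = \<lparr>car = {f. bounded_op X scalars f \<and> (\<forall>x. x \<notin> car X \<longrightarrow> f x = 0)},
             scl = (\<lambda>c f x. c * f x),
             nrm = op_norm X scalars\<rparr>"

definition ell2_fin :: "nat \<Rightarrow> ('k::real_or_complex, nat \<Rightarrow> 'k) nspace" where
  "ell2_fin n = \<lparr>car = {a. \<forall>i\<ge>n. a i = 0},
                 scl = (\<lambda>c a i. c * a i),
                 nrm = (\<lambda>a. L2_set (\<lambda>i. norm (a i)) {..<n})\<rparr>"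

definition ell2 :: "('k::real_or_complex, nat \<Rightarrow> 'k) nspace" where
  "ell2 = \<lparr>car = {a. summable (\<lambda>i. (norm (a i))\<^sup>2)},
           scl = (\<lambda>c a i. c * a i),
           nrm = (\<lambda>a. sqrt (\<Sum>i. (norm (a i))\<^sup>2))\<rparr>"

definition unit_vec :: "nat \<Rightarrow> nat \<Rightarrow> 'k::real_or_complex" where
  "unit_vec i = (\<lambda>j. if j = i then 1 else 0)"

definition pi2 :: "('k::real_or_complex, 'x::ab_group_add) nspace \<Rightarrow>
    ('k, 'y::ab_group_add) nspace \<Rightarrow> ('x \<Rightarrow> 'y) \<Rightarrow> ennreal" where
  "pi2 X Y T =
     (SUP (n, U) \<in> {(n, U). 1 \<le> n \<and> bounded_op (ell2_fin n) X U \<and> op_norm (ell2_fin n) X U \<le> 1}.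
        ennreal (sqrt (\<Sum>i<n. (nrm Y (T (U (unit_vec i))))\<^sup>2)))"

definition summing_property_dim ::
    "nat \<Rightarrow> ('k::real_or_complex, 'x::ab_group_add) nspace \<Rightarrow> bool" where
  "summing_property_dim k X \<longleftrightarrow>
     (\<forall>T. bounded_op X (ell2_fin k) T \<longrightarrow>
        pi2 X (ell2_fin k) T = ennreal (op_norm X (ell2_fin k) T))"

definition summing_property :: "('k::real_or_complex, 'x::ab_group_add) nspace \<Rightarrow> bool" where
  "summing_property X \<longleftrightarrow>
     (\<forall>T. bounded_op X ell2 T \<longrightarrow> pi2 X ell2 T = ennreal (op_norm X ell2 T))"

text \<open>The infimum is taken in \<open>[0, \<infinity>]\<close>, so non-isomorphic spaces have distance \<open>\<infinity>\<close>.\<close>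

definition banach_mazur :: "('k::real_or_complex, 'x::ab_group_add) nspace \<Rightarrow>
    ('k, 'y::ab_group_add) nspace \<Rightarrow> ennreal" where
  "banach_mazur X Y =
     (INF (T, S) \<in> {(T, S). bounded_op X Y T \<and> bounded_op Y X S \<and>
                       (\<forall>x\<in>car X. S (T x) = x) \<and> (\<forall>y\<in>car Y. T (S y) = y)}.
        ennreal (op_norm X Y T * op_norm Y X S))"

definition maximal_distance_space ::
    "('k::real_or_complex, 'x::ab_group_add) nspace \<Rightarrow> bool" where
  "maximal_distance_space X \<longleftrightarrow> finite_dimensional X \<and>
     banach_mazur X (ell2_fin (dimension X)) = ennreal (sqrt (real (dimension X)))"

end

theory Submission
  imports Defs "Jordan_Normal_Form.Determinant"
begin

text \<open>
  All parts rest on the observation that the \<open>k\<close>-dimensional property of \<open>X\<close> says that the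
  Hilbert--Schmidt norm of \<open>T U\<close> is at most \<open>\<parallel>T\<parallel> \<parallel>U\<parallel>\<close> for all \<open>T : X \<rightarrow> \<ell>\<^sub>2\<^sup>k\<close> and \<open>U : \<ell>\<^sub>2\<^sup>n \<rightarrow> X\<close>, a condition
  which in finite dimensions is visibly self-dual. Applied to an isomorphism and its inverse it gives
  \<open>d(X, \<ell>\<^sub>2\<^sup>n) \<ge> \<surd>n\<close>; the reverse inequality is John's theorem.

  Finite dimensionality is proved without the full strength of Dvoretzky's theorem. If \<open>X\<close> is infinite
  dimensional, then by the lemma of Dvoretzky and Rogers there are arbitrarily long weakly \<open>\<ell>\<^sub>2\<close>-bounded
  families of vectors of norm at least \<open>1/3\<close>. Attach to them independent random functionals on \<open>K\<^sup>2\<close> whose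
  distribution is invariant under a finite group \<open>G\<close> of isometries. By the Efron--Stein inequality the norm
  of the resulting random map \<open>U : K\<^sup>2 \<rightarrow> X\<close> concentrates around its mean \<open>M\<close>, a \<open>G\<close>-invariant norm on
  \<open>K\<^sup>2\<close>. Let \<open>e\<close> be a unit vector at which \<open>M\<close> is nearly maximal, let \<open>\<phi>\<^sub>g\<close> norm \<open>U g e\<close>, and let \<open>T\<close> be the
  average of \<open>\<phi>\<^sub>g \<otimes> g e\<close> over \<open>g \<in> G\<close>. Then \<open>T U\<close> has trace about \<open>\<parallel>U\<parallel>\<close>, hence Hilbert--Schmidt norm at
  least about \<open>\<parallel>U\<parallel> / \<surd>2\<close>, while \<open>\<parallel>T\<parallel>\<close> is at most the maximal average of \<open>\<bar>\<langle>g e, v\<rangle>\<bar>\<close> over \<open>g\<close>, which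
  stays below \<open>1 / \<surd>2\<close> if \<open>G\<close> is large enough.
\<close>

section \<open>Scalars and normed spaces\<close>

text \<open>A random section is useful only if its mean dominates its fluctuation. The fluctuation
  is governed by the weak l2 norm of the family, whatever its length, so the mean must be made
  large: each vector is repeated \<open>m\<close> times with weight \<open>1 / sqrt m\<close>, which
  leaves the weak l2 norm alone, and in a long enough family some block of \<open>m\<close> equal
  random functionals is likely, which pushes the mean to the order of \<open>sqrt m\<close>. Hence
  the order of choices: design, net, \<open>m\<close>, length of the family, sample. Invariance of
  \<open>M\<close> takes the place of a nearly Euclidean section: at every point of the orbit of
  \<open>e\<close> the norm of \<open>U\<close> is nearly attained, so all terms of the trace are
  nearly maximal at once. The gain in the norm of \<open>T\<close> is the gap between the arithmetic
  and the quadratic mean of the overlaps.\<close>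

lemma real_or_complex_cases:
  obtains "\<And>x::'k::real_or_complex. \<exists>a. x = of_real a"
  | i :: "'k::real_or_complex" where "i * i = - 1" "\<And>x::'k::real_or_complex. \<exists>a b. x = of_real a + of_real b * i"
      "\<And>a b. norm (of_real a + of_real b * i) = sqrt (a\<^sup>2 + b\<^sup>2)"
proof -
  note d = real_or_complex[where 'a='k]
  from d show thesis
  proof
    assume "\<forall>x::'k. \<exists>a. x = a *\<^sub>R 1"
    then show thesis using that(1) by (metis of_real_def)
  next
    assume "\<exists>i::'k. i * i = - 1 \<and> (\<forall>x. \<exists>a b. x = a *\<^sub>R 1 + b *\<^sub>R i) \<and>
          (\<forall>a b. norm (a *\<^sub>R 1 + b *\<^sub>R i) = sqrt (a\<^sup>2 + b\<^sup>2))"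
    then show thesis using that(2) by (metis of_real_def scaleR_conv_of_real)
  qed
qed

text \<open>Conjugation, by a formula that needs no choice of an imaginary unit and makes sense for
  both scalar fields; it is visibly multiplicative, and division by zero gives the right value at
  0.\<close>

definition kcnj :: "'k::real_or_complex \<Rightarrow> 'k" where
  "kcnj x = of_real ((norm x)\<^sup>2) / x"

lemma mult_kcnj: "x * kcnj x = of_real ((norm x)\<^sup>2)"
  by (simp add: kcnj_def)

lemma norm_kcnj [simp]: "norm (kcnj x) = norm x"
  by (simp add: kcnj_def norm_divide norm_mult power2_eq_square)

lemma kcnj_0 [simp]: "kcnj 0 = 0"
  by (simp add: kcnj_def)

lemma kcnj_mult: "kcnj (x * y) = kcnj x * kcnj y"
  by (simp add: kcnj_def norm_mult power_mult_distrib)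

lemma kcnj_eqI: "x * y = of_real ((norm x)\<^sup>2) \<Longrightarrow> x \<noteq> 0 \<Longrightarrow> kcnj x = y"
  by (simp add: kcnj_def field_simps)

lemma kcnj_of_real [simp]: "kcnj (of_real r) = of_real r"
  by (cases "r = 0") (auto intro!: kcnj_eqI simp: power2_eq_square simp flip: of_real_mult)

lemma kcnj_complex_form:
  fixes i :: "'k::real_or_complex"
  assumes "i * i = - 1" "\<And>a b. norm (of_real a + of_real b * i) = sqrt (a\<^sup>2 + b\<^sup>2)"
  shows "kcnj (of_real a + of_real b * i) = of_real a - of_real b * i"
proof (cases "of_real a + of_real b * i = 0")
  case True
  then have "a\<^sup>2 + b\<^sup>2 = 0"
    using assms(2)[of a b] by simp
  then show ?thesis by (simp add: sum_power2_eq_zero_iff)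
next
  case False
  have "(of_real a + of_real b * i) * (of_real a - of_real b * i) = of_real a * of_real a - of_real b * of_real b * (i * i)"
    by (simp add: algebra_simps)
  also have "\<dots> = of_real (a\<^sup>2 + b\<^sup>2)"
    by (simp add: assms(1) power2_eq_square)
  finally show ?thesis
    using False by (intro kcnj_eqI) (simp_all add: assms(2))
qed

text \<open>Additivity cannot be read off from the quotient; it comes from the classification of the
  scalars, as \<open>a + b i\<close> is sent to \<open>a - b i\<close>.\<close>

lemma kcnj_add: "kcnj (x + y) = kcnj x + kcnj (y::'k::real_or_complex)"
proof (rule real_or_complex_cases[where 'k='k])
  assume r: "\<And>x::'k. \<exists>a. x = of_real a"
  obtain a b where "x = of_real a" "y = of_real b" using r by metis
  then show ?thesis by (metis kcnj_of_real of_real_add)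
next
  fix i :: 'k
  assume i: "i * i = - 1" "\<And>x::'k. \<exists>a b. x = of_real a + of_real b * i"
      "\<And>a b. norm (of_real a + of_real b * i) = sqrt (a\<^sup>2 + b\<^sup>2)"
  obtain a b c d where xy: "x = of_real a + of_real b * i" "y = of_real c + of_real d * i"
    using i(2) by metis
  have s: "x + y = of_real (a + c) + of_real (b + d) * i"
    by (simp add: xy algebra_simps)
  show ?thesis
    unfolding s kcnj_complex_form[OF i(1,3)] unfolding xy kcnj_complex_form[OF i(1,3)]
    by (simp add: algebra_simps)
qed

lemma kcnj_sum: "kcnj (\<Sum>i\<in>A. f i) = (\<Sum>i\<in>A. kcnj (f i))"
  by (induction A rule: infinite_finite_induct) (auto simp: kcnj_add)

lemma kcnj_kcnj [simp]: "kcnj (kcnj x) = x"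
proof (cases "x = 0")
  case False
  then have "kcnj x \<noteq> 0" by (metis norm_eq_zero norm_kcnj)
  then show ?thesis by (intro kcnj_eqI) (simp_all add: mult_kcnj mult.commute[of "kcnj x"])
qed simp

locale nspc =
  fixes X :: "('k::real_or_complex, 'x::ab_group_add) nspace"
  assumes ns: "normed_space X"
begin

sublocale vs: vector_space "scl X"
  using ns by (simp add: normed_space_def)

lemma subspace_car: "vs.subspace (car X)"
  using ns by (simp add: normed_space_def)

lemma car_add: "x \<in> car X \<Longrightarrow> y \<in> car X \<Longrightarrow> x + y \<in> car X"
  and car_0 [simp]: "0 \<in> car X"
  and car_scl: "x \<in> car X \<Longrightarrow> scl X c x \<in> car X"
  using subspace_car by (auto simp: vs.subspace_def)

lemma car_minus: "x \<in> car X \<Longrightarrow> - x \<in> car X"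
  and car_diff: "x \<in> car X \<Longrightarrow> y \<in> car X \<Longrightarrow> x - y \<in> car X"
  and car_sum: "(\<And>i. i \<in> A \<Longrightarrow> f i \<in> car X) \<Longrightarrow> (\<Sum>i\<in>A. f i) \<in> car X"
  using subspace_car by (auto intro: vs.subspace_neg vs.subspace_diff vs.subspace_sum)

lemma nrm_eq_0: "x \<in> car X \<Longrightarrow> nrm X x = 0 \<longleftrightarrow> x = 0"
  and nrm_add: "x \<in> car X \<Longrightarrow> y \<in> car X \<Longrightarrow> nrm X (x + y) \<le> nrm X x + nrm X y"
  and nrm_scl: "x \<in> car X \<Longrightarrow> nrm X (scl X c x) = norm c * nrm X x"
  using ns by (auto simp: normed_space_def)

lemma nrm_0 [simp]: "nrm X 0 = 0"
  by (simp add: nrm_eq_0)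

lemma nrm_minus: "x \<in> car X \<Longrightarrow> nrm X (- x) = nrm X x"
  using nrm_scl[of x "-1"] by simp

lemma nrm_nonneg: "x \<in> car X \<Longrightarrow> 0 \<le> nrm X x"
  using nrm_add[of x "- x"] by (simp add: nrm_minus car_minus)

lemma nrm_diff_ge: "x \<in> car X \<Longrightarrow> y \<in> car X \<Longrightarrow> nrm X x - nrm X y \<le> nrm X (x - y)"
  using nrm_add[of "x - y" y] by (simp add: car_diff)

lemma nrm_sum: "(\<And>i. i \<in> A \<Longrightarrow> f i \<in> car X) \<Longrightarrow> nrm X (\<Sum>i\<in>A. f i) \<le> (\<Sum>i\<in>A. nrm X (f i))"
proof (induction A rule: infinite_finite_induct)
  case (insert a A)
  then show ?case
    using nrm_add[of "f a" "\<Sum>i\<in>A. f i"] by (force simp: car_sum)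
qed auto

section \<open>The Hahn--Banach theorem\<close>

text \<open>Values off the carrier are fixed at 0, so that the pointwise order over the whole type
  compares functionals on the carrier only. Homogeneity is asked for as an inequality, which passes
  easily to infima.\<close>

definition sublinear :: "('x \<Rightarrow> real) \<Rightarrow> bool" where
  "sublinear q \<longleftrightarrow> (\<forall>x\<in>car X. \<forall>y\<in>car X. q (x + y) \<le> q x + q y) \<and>
     (\<forall>x\<in>car X. \<forall>t\<ge>0. q (scl X (of_real t) x) \<le> t * q x) \<and> (\<forall>x. x \<notin> car X \<longrightarrow> q x = 0)"

lemma sublinear_lower: "sublinear q \<Longrightarrow> x \<in> car X \<Longrightarrow> - q (- x) \<le> q x"
proof -
  assume q: "sublinear q" and x: "x \<in> car X"
  have "q (0 + 0) \<le> q 0 + q 0" using q car_0 unfolding sublinear_def by blast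
  moreover have "q (x + - x) \<le> q x + q (- x)"
    using q x car_minus unfolding sublinear_def by blast
  ultimately show ?thesis by simp
qed

text \<open>The infimum of \<open>q (x + t y) - t q y\<close> over t \<ge> 0 lies below
  \<open>q\<close> (take t = 0) and is at most \<open>- q y\<close> at \<open>- y\<close> (take t =
  1). Consequently a minimal sublinear functional is odd.\<close>

lemma sublinear_reduce:
  assumes q: "sublinear q" and y: "y \<in> car X"
  obtains r where "sublinear r" "\<And>x. r x \<le> q x" "r (- y) \<le> - q y"
proof -
  define F where "F x t = q (x + scl X (of_real t) y) - t * q y" for x t
  define r where "r x = (if x \<in> car X then (INF t\<in>{0..}. F x t) else 0)" for x
  have sub: "q (a + b) \<le> q a + q b" if "a \<in> car X" "b \<in> car X" for a b
    using q that by (simp add: sublinear_def)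
  have hom: "q (scl X (of_real t) a) \<le> t * q a" if "a \<in> car X" "t \<ge> 0" for a t
    using q that by (simp add: sublinear_def)
  have q0: "q 0 = 0"
    using hom[of 0 0] sub[of 0 0] by simp
  have homeq: "q (scl X (of_real t) a) = t * q a" if a: "a \<in> car X" and t: "t \<ge> 0" for a t
  proof (cases "t = 0")
    case False
    with t have "t > 0" by simp
    moreover have "q (scl X (of_real (1 / t)) (scl X (of_real t) a)) \<le> 1 / t * q (scl X (of_real t) a)"
      using t a by (intro hom car_scl) auto
    ultimately have "t * q a \<le> q (scl X (of_real t) a)"
      by (simp add: field_simps flip: of_real_mult)
    then show ?thesis using hom[OF a t] by simp
  qed (simp add: q0)
  have Fge: "- q (- x) \<le> F x t" if "x \<in> car X" "t \<ge> 0" for x t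
    using sub[of "x + scl X (of_real t) y" "- x"] homeq[OF y that(2)] that y
    by (simp add: F_def car_add car_minus car_scl)
  then have bdd: "bdd_below (F x ` {0..})" if "x \<in> car X" for x
    using that by (intro bdd_belowI[of _ "- q (- x)"]) auto
  have rle: "r x \<le> F x t" if "x \<in> car X" "t \<ge> 0" for x t
    using that bdd by (auto simp: r_def intro!: cINF_lower)
  have rge: "c \<le> r x" if "x \<in> car X" "\<And>t. t \<ge> 0 \<Longrightarrow> c \<le> F x t" for x c
    using that by (auto simp: r_def intro!: cINF_greatest)
  have "r (a + b) \<le> r a + r b" if a: "a \<in> car X" and b: "b \<in> car X" for a b
  proof -
    have *: "r (a + b) \<le> F a s + F b t" if "s \<ge> 0" "t \<ge> 0" for s t
    proof -
      have "r (a + b) \<le> F (a + b) (s + t)"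
        using a b that by (intro rle) (auto simp: car_add)
      also have "a + b + scl X (of_real (s + t)) y = (a + scl X (of_real s) y) + (b + scl X (of_real t) y)"
        by (simp add: vs.scale_left_distrib algebra_simps)
      then have "F (a + b) (s + t) \<le> F a s + F b t"
        using sub[of "a + scl X (of_real s) y" "b + scl X (of_real t) y"] a b y
        by (simp add: F_def car_add car_scl algebra_simps)
      finally show ?thesis .
    qed
    have "r (a + b) - F a s \<le> r b" if "s \<ge> 0" for s
      using *[OF that] b by (intro rge) (auto simp: algebra_simps)
    then have "r (a + b) - r b \<le> r a"
      using a by (intro rge) (auto simp: algebra_simps)
    then show ?thesis by simp
  qed
  moreover have "r (scl X (of_real s) a) \<le> s * r a" if a: "a \<in> car X" and s: "s \<ge> 0" for a s
  proof (cases "s = 0")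
    case True
    then show ?thesis using rle[of 0 0] by (simp add: F_def q0)
  next
    case False
    with s have s: "s > 0" by simp
    have "r (scl X (of_real s) a) / s \<le> F a t" if t: "t \<ge> 0" for t
    proof -
      have "r (scl X (of_real s) a) \<le> F (scl X (of_real s) a) (s * t)"
        using a s t by (intro rle) (auto simp: car_scl)
      also have "\<dots> = s * F a t"
        using homeq[of "a + scl X (of_real t) y" s] s a y
        by (simp add: F_def car_add car_scl vs.scale_right_distrib algebra_simps)
      finally show ?thesis using s by (simp add: field_simps)
    qed
    then have "r (scl X (of_real s) a) / s \<le> r a"
      using a by (intro rge)
    then show ?thesis using s by (simp add: field_simps)
  qed
  ultimately have "sublinear r"
    by (simp add: sublinear_def) (simp add: r_def)
  moreover have "r x \<le> q x" for x
    using rle[of x 0] q by (cases "x \<in> car X") (auto simp: F_def r_def sublinear_def)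
  moreover have "r (- y) \<le> - q y"
    using rle[of "- y" 1] y by (simp add: F_def car_minus q0)
  ultimately show ?thesis using that by blast
qed

text \<open>Zorn's lemma for the reversed order. A chain is bounded by its pointwise infimum, which
  is finite because on the carrier every sublinear \<open>q\<close> below \<open>p\<close> satisfies
  \<open>- p (- x) \<le> q x\<close>.\<close>

lemma sublinear_minimal:
  assumes p: "sublinear p"
  obtains m where "sublinear m" "\<And>x. m x \<le> p x" "\<And>q. sublinear q \<Longrightarrow> (\<And>x. q x \<le> m x) \<Longrightarrow> q = m"
proof -
  define A where "A = {q. sublinear q \<and> (\<forall>x. q x \<le> p x)}"
  define P :: "('x \<Rightarrow> real) \<Rightarrow> ('x \<Rightarrow> real) \<Rightarrow> bool" where "P a b \<longleftrightarrow> (\<forall>x. b x \<le> a x)" for a b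
  have "\<exists>m\<in>A. \<forall>a\<in>A. P m a \<longrightarrow> a = m"
  proof (rule predicate_Zorn)
    show "partial_order_on A (relation_of P A)"
      by (rule partial_order_on_relation_ofI) (auto simp: P_def fun_eq_iff intro: order_trans antisym)
  next
    fix C assume "C \<in> Chains (relation_of P A)"
    then have CA: "C \<subseteq> A" and ch: "\<And>a b. a \<in> C \<Longrightarrow> b \<in> C \<Longrightarrow> P a b \<or> P b a"
      unfolding Chains_def relation_of_def by auto
    show "\<exists>u\<in>A. \<forall>a\<in>C. P a u"
    proof (cases "C = {}")
      case True
      then show ?thesis using p by (auto simp: A_def)
    next
      case ne: False
      define u where "u x = (INF q\<in>C. q x)" for x
      have sC: "sublinear q" "q x \<le> p x" if "q \<in> C" for q x
        using CA that by (auto simp: A_def)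
      have "- p (- x) \<le> q x" if "q \<in> C" "x \<in> car X" for q x
        using sublinear_lower[OF sC(1)[OF that(1)] that(2)] sC(2)[OF that(1), of "- x"] by linarith
      moreover have z: "q x = 0" if "q \<in> C" "x \<notin> car X" for q x
        using sC(1)[OF that(1)] that(2) by (simp add: sublinear_def)
      ultimately have bdd: "bdd_below ((\<lambda>q. q x) ` C)" for x
        by (intro bdd_belowI[of _ "if x \<in> car X then - p (- x) else 0"]) (auto simp: z)
      have ule: "u x \<le> q x" if "q \<in> C" for q x
        unfolding u_def using that bdd by (intro cINF_lower)
      have uge: "c \<le> u x" if "\<And>q. q \<in> C \<Longrightarrow> c \<le> q x" for c x
        unfolding u_def using that ne by (intro cINF_greatest)
      have "u (x + y) \<le> u x + u y" if xy: "x \<in> car X" "y \<in> car X" for x y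
      proof -
        have *: "u (x + y) \<le> a x + b y" if ab: "a \<in> C" "b \<in> C" for a b
        proof -
          obtain c where c: "c \<in> C" "c x \<le> a x" "c y \<le> b y"
            using ch[OF ab] ab unfolding P_def by (metis order_refl)
          have "u (x + y) \<le> c (x + y)" using ule c by blast
          also have "\<dots> \<le> c x + c y" using sC(1)[OF c(1)] xy by (simp add: sublinear_def)
          finally show ?thesis using c by linarith
        qed
        have "u (x + y) - a x \<le> u y" if "a \<in> C" for a
          using *[OF that] by (intro uge) (auto simp: algebra_simps)
        then have "u (x + y) - u y \<le> u x"
          by (intro uge) (auto simp: algebra_simps)
        then show ?thesis by simp
      qed
      moreover have "u (scl X (of_real t) x) \<le> t * u x" if x: "x \<in> car X" and t: "t \<ge> 0" for x t
      proof -
        have *: "u (scl X (of_real t) x) \<le> t * q x" if "q \<in> C" for q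
          using ule[OF that, of "scl X (of_real t) x"] sC(1)[OF that] x t unfolding sublinear_def
          by (metis order_trans)
        show ?thesis
        proof (cases "t = 0")
          case True
          then show ?thesis using * ne by auto
        next
          case False
          with t have "t > 0" by simp
          then have "u (scl X (of_real t) x) / t \<le> u x"
            using * by (intro uge) (auto simp: field_simps)
          then show ?thesis using \<open>t > 0\<close> by (simp add: field_simps)
        qed
      qed
      moreover have "u x = 0" if "x \<notin> car X" for x
      proof -
        have "(\<lambda>q. q x) ` C = {0}" using z that ne by force
        then show ?thesis by (simp add: u_def)
      qed
      ultimately have "sublinear u" by (simp add: sublinear_def)
      moreover have "u x \<le> p x" for x
        using ne ule sC(2) by (metis all_not_in_conv order_trans)
      ultimately show ?thesis using ule by (auto simp: A_def P_def)
    qed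
  qed
  then obtain m where "m \<in> A" and m: "\<And>a. a \<in> A \<Longrightarrow> P m a \<Longrightarrow> a = m" by blast
  then show ?thesis
    using that[of m] by (auto simp: A_def P_def) (meson order_trans)
qed

text \<open>A minimal sublinear functional is odd by the reduction lemma, and subadditivity together
  with oddness is additivity. Reducing at \<open>x0\<close> before minimising forces the value
  \<open>p x0\<close> there, in place of an extension from a subspace.\<close>

lemma hahn_banach_real:
  assumes p: "sublinear p" and x0: "x0 \<in> car X"
  obtains f where "\<And>x y. x \<in> car X \<Longrightarrow> y \<in> car X \<Longrightarrow> f (x + y) = f x + f y"
    "\<And>t x. x \<in> car X \<Longrightarrow> f (scl X (of_real t) x) = t * f x"
    "\<And>x. f x \<le> p x" "f x0 = p x0"
proof -
  obtain p' where p': "sublinear p'" "\<And>x. p' x \<le> p x" "p' (- x0) \<le> - p x0"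
    using sublinear_reduce[OF p x0] by blast
  obtain m where m: "sublinear m" "\<And>x. m x \<le> p' x" "\<And>q. sublinear q \<Longrightarrow> (\<And>x. q x \<le> m x) \<Longrightarrow> q = m"
    using sublinear_minimal[OF p'(1)] by blast
  have odd: "m (- y) = - m y" if y: "y \<in> car X" for y
  proof -
    obtain r where "sublinear r" "\<And>x. r x \<le> m x" "r (- y) \<le> - m y"
      using sublinear_reduce[OF m(1) y] by blast
    then have "m (- y) \<le> - m y" using m(3) by metis
    then show ?thesis using sublinear_lower[OF m(1) y] by linarith
  qed
  have add: "m (x + y) = m x + m y" if "x \<in> car X" "y \<in> car X" for x y
  proof -
    have "m (x + y) \<le> m x + m y" "m (x + y + - y) \<le> m (x + y) + m (- y)"
      using m(1) that car_add car_minus unfolding sublinear_def by blast+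
    then show ?thesis using odd[OF that(2)] by simp
  qed
  have le: "m (scl X (of_real t) x) \<le> t * m x" if "x \<in> car X" "t \<ge> 0" for t x
    using m(1) that unfolding sublinear_def by blast
  have pos: "m (scl X (of_real t) x) = t * m x" if "x \<in> car X" "t \<ge> 0" for t x
    using le[OF that] le[of "- x" t] odd[of x] odd[of "scl X (of_real t) x"] that
    by (simp add: car_minus car_scl)
  have hom: "m (scl X (of_real t) x) = t * m x" if "x \<in> car X" for t x
  proof (cases "t \<ge> 0")
    case False
    then show ?thesis
      using pos[of x "- t"] odd[of "scl X (of_real t) x"] that by (simp add: car_scl)
  qed (use pos that in blast)
  have "m x \<le> p x" for x using m(2) p'(2) order_trans by blast
  moreover have "m x0 = p x0"
    using odd[OF x0] m(2)[of "- x0"] p'(3) \<open>m x0 \<le> p x0\<close> by linarith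
  ultimately show ?thesis using that add hom by blast
qed

definition lin :: "('x \<Rightarrow> 'k) \<Rightarrow> bool" where
  "lin f \<longleftrightarrow> (\<forall>x\<in>car X. \<forall>y\<in>car X. f (x + y) = f x + f y) \<and> (\<forall>c. \<forall>x\<in>car X. f (scl X c x) = c * f x)"

lemma norming_functional:
  assumes x0: "x0 \<in> car X"
  obtains f where "lin f" "\<And>x. x \<in> car X \<Longrightarrow> norm (f x) \<le> nrm X x" "f x0 = of_real (nrm X x0)"
proof -
  define p where "p x = (if x \<in> car X then nrm X x else 0)" for x
  have "sublinear p"
    by (auto simp: sublinear_def p_def car_add car_scl nrm_add nrm_scl)
  then obtain f where f: "\<And>x y. x \<in> car X \<Longrightarrow> y \<in> car X \<Longrightarrow> f (x + y) = f x + f y"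
    "\<And>t x. x \<in> car X \<Longrightarrow> f (scl X (of_real t) x) = t * f x"
    "\<And>x. f x \<le> p x" "f x0 = p x0"
    using hahn_banach_real[OF _ x0] by metis
  have fle: "f x \<le> nrm X x" if "x \<in> car X" for x
    using f(3)[of x] that by (simp add: p_def)
  have fx0: "f x0 = nrm X x0" using f(4) x0 by (simp add: p_def)
  show thesis
  proof (rule real_or_complex_cases[where 'k='k])
    assume r: "\<And>x::'k. \<exists>a. x = of_real a"
    have "lin (\<lambda>x. of_real (f x))"
      unfolding lin_def using f(1,2) r by (metis of_real_add of_real_mult)
    moreover have "norm (of_real (f x) :: 'k) \<le> nrm X x" if "x \<in> car X" for x
      using fle[OF that] fle[of "- x"] f(2)[of x "-1"] that
      by (simp add: car_minus nrm_minus abs_le_iff)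
    ultimately show thesis using that[of "\<lambda>x. of_real (f x)"] fx0 by simp
  next
    fix i :: 'k
    assume i: "i * i = - 1" "\<And>x::'k. \<exists>a b. x = of_real a + of_real b * i"
        "\<And>a b. norm (of_real a + of_real b * i) = sqrt (a\<^sup>2 + b\<^sup>2)"
    define g where "g x = of_real (f x) - of_real (f (scl X i x)) * i" for x
    have f_lin: "f (scl X (of_real a + of_real b * i) x) = a * f x + b * f (scl X i x)" if "x \<in> car X" for a b x
    proof -
      have "scl X (of_real a + of_real b * i) x = scl X (of_real a) x + scl X (of_real b) (scl X i x)"
        by (simp add: vs.scale_left_distrib)
      then show ?thesis using that by (simp add: f(1,2) car_scl del: vs.scale_scale)
    qed
    have ii: "i * (i * z) = - z" for z
      by (simp add: i(1) flip: mult.assoc)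
    have g_lin: "lin g"
      unfolding lin_def
    proof (intro conjI ballI allI)
      fix x y assume xy: "x \<in> car X" "y \<in> car X"
      then show "g (x + y) = g x + g y"
        by (simp add: g_def f(1) car_scl vs.scale_right_distrib algebra_simps)
    next
      fix c x assume x: "x \<in> car X"
      obtain a b where c: "c = of_real a + of_real b * i" using i(2) by blast
      have ic: "i * c = of_real (- b) + of_real a * i"
        unfolding c distrib_left mult.left_commute[of i] i(1) by (simp add: mult.commute)
      have "g (scl X c x) = of_real (f (scl X c x)) - of_real (f (scl X (i * c) x)) * i"
        by (simp add: g_def)
      also have "\<dots> = of_real (a * f x + b * f (scl X i x)) - of_real (- b * f x + a * f (scl X i x)) * i"
        unfolding ic f_lin[OF x] by (simp add: c f_lin[OF x])
      also have "\<dots> = (of_real a + of_real b * i) * g x"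
        by (simp add: g_def algebra_simps ii)
      finally show "g (scl X c x) = c * g x" by (simp add: c)
    qed
    have g_le: "norm (g x) \<le> nrm X x" if x: "x \<in> car X" for x
    proof (cases "g x = 0")
      case False
      \<comment> \<open>A scalar of modulus 1 that turns \<open>g x\<close> into a nonnegative real
        number, where \<open>g\<close> and its real part \<open>f\<close> agree.\<close>
      define c where "c = of_real (norm (g x)) / g x"
      have nc: "norm c = 1" using False by (simp add: c_def norm_divide)
      have "g (scl X c x) = c * g x" using g_lin x by (simp add: lin_def)
      then have "g (scl X c x) = of_real (norm (g x))" using False by (simp add: c_def)
      then have *: "of_real (f (scl X c x) - norm (g x)) + of_real (- f (scl X i (scl X c x))) * i = 0"
        by (simp add: g_def algebra_simps)
      have "(f (scl X c x) - norm (g x))\<^sup>2 + (- f (scl X i (scl X c x)))\<^sup>2 = 0"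
        using i(3)[of "f (scl X c x) - norm (g x)" "- f (scl X i (scl X c x))"] unfolding * by simp
      then have "norm (g x) = f (scl X c x)"
        by (simp add: sum_power2_eq_zero_iff)
      also have "\<dots> \<le> nrm X x"
        using fle[of "scl X c x"] x nc by (simp add: car_scl nrm_scl)
      finally show ?thesis .
    qed (simp add: nrm_nonneg x)
    moreover have "g x0 = of_real (nrm X x0)"
    proof -
      \<comment> \<open>The modulus of \<open>g x0\<close> is at most the norm of \<open>x0\<close>,
        which is already its real part; hence the imaginary part vanishes.\<close>
      have "norm (g x0) = sqrt ((nrm X x0)\<^sup>2 + (- f (scl X i x0))\<^sup>2)"
        using i(3)[of "f x0" "- f (scl X i x0)"] by (simp add: g_def fx0)
      then have "sqrt ((nrm X x0)\<^sup>2 + (- f (scl X i x0))\<^sup>2) \<le> nrm X x0"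
        using g_le[OF x0] by simp
      then have "(nrm X x0)\<^sup>2 + (f (scl X i x0))\<^sup>2 \<le> (nrm X x0)\<^sup>2"
        using nrm_nonneg[OF x0] by (simp add: real_sqrt_le_iff' sqrt_le_D)
      then have "f (scl X i x0) = 0" by simp
      then show ?thesis by (simp add: g_def fx0)
    qed
    ultimately show thesis using that g_lin by blast
  qed
qed

end

section \<open>Finite-dimensional Hilbert space\<close>

abbreviation l2 :: "nat \<Rightarrow> (nat \<Rightarrow> 'k::real_normed_vector) \<Rightarrow> real" where
  "l2 n a \<equiv> L2_set (\<lambda>i. norm (a i)) {..<n}"

lemma l2_unit_vec: "i < n \<Longrightarrow> l2 n (Defs.unit_vec i :: nat \<Rightarrow> 'k::real_or_complex) = 1"
proof -
  assume i: "i < n"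
  have "(\<Sum>j<n. (norm (Defs.unit_vec i j :: 'k))\<^sup>2) = (\<Sum>j<n. if j = i then 1 else 0)"
    by (intro sum.cong) (auto simp: Defs.unit_vec_def)
  then show ?thesis using i by (simp add: L2_set_def)
qed

definition ip :: "nat \<Rightarrow> (nat \<Rightarrow> 'k::real_or_complex) \<Rightarrow> (nat \<Rightarrow> 'k) \<Rightarrow> 'k" where
  "ip n a b = (\<Sum>i<n. a i * kcnj (b i))"

lemma l2_sq: "(l2 n a)\<^sup>2 = (\<Sum>i<n. (norm (a i))\<^sup>2)"
  by (simp add: L2_set_def sum_nonneg)

lemma l2_cong: "(\<And>i. i < n \<Longrightarrow> a i = b i) \<Longrightarrow> l2 n a = l2 n b"
  by (rule L2_set_cong) auto

lemma l2_eq_0: "l2 n a = 0 \<longleftrightarrow> (\<forall>i<n. a i = 0)"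
  by (auto simp: L2_set_eq_0_iff)

lemma l2_scale: "l2 n (\<lambda>i. c * a i) = norm c * l2 n (a :: nat \<Rightarrow> 'k::real_normed_field)"
  by (simp add: norm_mult L2_set_right_distrib)

lemma l2_triangle: "l2 n (\<lambda>i. a i + b i) \<le> l2 n a + l2 n b"
proof -
  have "l2 n (\<lambda>i. a i + b i) \<le> L2_set (\<lambda>i. norm (a i) + norm (b i)) {..<n}"
    by (intro L2_set_mono) (auto simp: norm_triangle_ineq)
  also have "\<dots> \<le> l2 n a + l2 n b" by (rule L2_set_triangle_ineq)
  finally show ?thesis .
qed

lemma ip_self: "ip n a a = of_real ((l2 n a)\<^sup>2)"
  by (simp add: ip_def mult_kcnj l2_sq)

lemma ip_add_left: "ip n (\<lambda>i. a i + b i) c = ip n a c + ip n b c"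
  and ip_diff_left: "ip n (\<lambda>i. a i - b i) c = ip n a c - ip n b c"
  and ip_scale_left: "ip n (\<lambda>i. s * a i) c = s * ip n a c"
  and ip_scale_right: "ip n a (\<lambda>i. s * c i) = kcnj s * ip n a c"
  by (simp_all add: ip_def algebra_simps sum.distrib sum_subtractf sum_distrib_left kcnj_mult)

lemma ip_sum_left: "ip n (\<lambda>i. \<Sum>l\<in>A. f l i) c = (\<Sum>l\<in>A. ip n (f l) c)"
  unfolding ip_def by (simp add: sum_distrib_right) (rule sum.swap)

lemma ip_cnj: "ip n b a = kcnj (ip n a b)"
  by (simp add: ip_def kcnj_sum kcnj_mult mult.commute)

lemma ip_cong: "(\<And>i. i < n \<Longrightarrow> a i = a' i) \<Longrightarrow> (\<And>i. i < n \<Longrightarrow> b i = b' i) \<Longrightarrow> ip n a b = ip n a' b'"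
  by (auto simp: ip_def)

lemma ip_le: "norm (ip n a b) \<le> l2 n a * l2 n b"
proof -
  have "norm (ip n a b) \<le> (\<Sum>i<n. norm (a i) * norm (b i))"
    unfolding ip_def by (rule order_trans[OF norm_sum]) (simp add: norm_mult)
  also have "\<dots> = (\<Sum>i<n. \<bar>norm (a i)\<bar> * \<bar>norm (b i)\<bar>)" by simp
  also have "\<dots> \<le> l2 n a * l2 n b" by (rule L2_set_mult_ineq)
  finally show ?thesis .
qed

lemma pythagoras:
  assumes "ip n a b = 0"
  shows "(l2 n (\<lambda>i. a i + b i))\<^sup>2 = (l2 n a)\<^sup>2 + (l2 n b)\<^sup>2"
proof -
  have r: "ip n a (\<lambda>i. a i + b i) = ip n a a + ip n a b" "ip n b (\<lambda>i. a i + b i) = ip n b a + ip n b b"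
    by (simp_all add: ip_def kcnj_add algebra_simps sum.distrib)
  have "ip n b a = 0" using assms by (simp add: ip_cnj[of n b a])
  then have "ip n (\<lambda>i. a i + b i) (\<lambda>i. a i + b i) = ip n a a + ip n b b"
    using assms by (simp add: ip_add_left r)
  then have "(of_real ((l2 n (\<lambda>i. a i + b i))\<^sup>2) :: 'a) = of_real ((l2 n a)\<^sup>2 + (l2 n b)\<^sup>2)"
    by (simp only: ip_self of_real_add)
  then show ?thesis by (simp only: of_real_eq_iff)
qed

text \<open>Orthonormal up to zero vectors, so that Gram--Schmidt need not reindex.\<close>

definition osys :: "nat \<Rightarrow> nat \<Rightarrow> (nat \<Rightarrow> nat \<Rightarrow> 'k::real_or_complex) \<Rightarrow> bool" where
  "osys n k q \<longleftrightarrow> (\<forall>i<k. \<forall>j<k. i \<noteq> j \<longrightarrow> ip n (q i) (q j) = 0) \<and> (\<forall>i<k. l2 n (q i) \<in> {0, 1})"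

definition proj :: "nat \<Rightarrow> nat \<Rightarrow> (nat \<Rightarrow> nat \<Rightarrow> 'k::real_or_complex) \<Rightarrow> (nat \<Rightarrow> 'k) \<Rightarrow> nat \<Rightarrow> 'k" where
  "proj n k q y i = (\<Sum>l<k. ip n y (q l) * q l i)"

lemma ip_proj_left: "ip n (proj n k q y) w = (\<Sum>l<k. ip n y (q l) * ip n (q l) w)"
  unfolding proj_def by (simp add: ip_sum_left ip_scale_left)

lemma ip_proj:
  assumes "osys n k q" "j < k"
  shows "ip n (proj n k q y) (q j) = ip n y (q j)"
proof -
  have "ip n (proj n k q y) (q j) = (\<Sum>l<k. ip n y (q l) * ip n (q l) (q j))"
    by (rule ip_proj_left)
  also have "\<dots> = (\<Sum>l<k. if l = j then ip n y (q j) * ip n (q j) (q j) else 0)"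
    using assms by (intro sum.cong) (auto simp: osys_def)
  also have "\<dots> = ip n y (q j) * ip n (q j) (q j)"
    using assms(2) by simp
  also have "\<dots> = ip n y (q j)"
  proof -
    \<comment> \<open>If \<open>q j\<close> has norm 0, both sides vanish by
      Cauchy--Schwarz.\<close>
    have "l2 n (q j) = 0 \<or> l2 n (q j) = 1" using assms by (auto simp: osys_def)
    moreover have "norm (ip n y (q j)) \<le> l2 n y * l2 n (q j)" by (rule ip_le)
    ultimately show ?thesis by (auto simp: ip_self)
  qed
  finally show ?thesis .
qed

lemma ip_diff_proj:
  assumes "osys n k q" "j < k"
  shows "ip n (\<lambda>i. y i - proj n k q y i) (q j) = 0"
  using ip_proj[OF assms, of y] by (simp add: ip_diff_left)

lemma ip_right_0I: "(\<And>l. l < k \<Longrightarrow> ip n z (q l) = 0) \<Longrightarrow> ip n z (proj n k q y) = 0"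
proof -
  assume z: "\<And>l. l < k \<Longrightarrow> ip n z (q l) = 0"
  have "ip n (proj n k q y) z = (\<Sum>l<k. ip n y (q l) * ip n (q l) z)"
    by (rule ip_proj_left)
  also have "\<dots> = 0"
    using z ip_cnj[of n _ z] by (intro sum.neutral) auto
  finally show ?thesis by (simp add: ip_cnj[of n z])
qed

lemma l2_proj_decomp:
  assumes "osys n k q"
  shows "(l2 n y)\<^sup>2 = (l2 n (proj n k q y))\<^sup>2 + (l2 n (\<lambda>i. y i - proj n k q y i))\<^sup>2"
proof -
  have "ip n (\<lambda>i. y i - proj n k q y i) (proj n k q y) = 0"
    by (intro ip_right_0I ip_diff_proj assms)
  from pythagoras[OF this] show ?thesis by simp
qed

lemma l2_proj:
  assumes "osys n k q"
  shows "(l2 n (proj n k q y))\<^sup>2 = (\<Sum>l<k. (norm (ip n y (q l)))\<^sup>2)"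
proof -
  have "(of_real ((l2 n (proj n k q y))\<^sup>2) :: 'a) = ip n (proj n k q y) (proj n k q y)"
    by (simp add: ip_self)
  also have "\<dots> = (\<Sum>l<k. ip n y (q l) * ip n (q l) (proj n k q y))"
    by (rule ip_proj_left)
  also have "\<dots> = (\<Sum>l<k. ip n y (q l) * kcnj (ip n y (q l)))"
    by (intro sum.cong refl) (simp add: ip_cnj[of n _ "proj n k q y"] ip_proj[OF assms])
  also have "\<dots> = of_real (\<Sum>l<k. (norm (ip n y (q l)))\<^sup>2)"
    by (simp add: mult_kcnj)
  finally show ?thesis by (simp only: of_real_eq_iff)
qed

lemma bessel: "osys n k q \<Longrightarrow> (\<Sum>l<k. (norm (ip n y (q l)))\<^sup>2) \<le> (l2 n y)\<^sup>2"
  using l2_proj_decomp[of n k q y] by (simp add: l2_proj)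

lemma osys_extend:
  assumes q: "osys n k q" and z: "\<And>l. l < k \<Longrightarrow> ip n z (q l) = 0" "l2 n z \<in> {0, 1}"
  shows "osys n (Suc k) (q(k := z))"
proof -
  have "ip n (q l) z = 0" if "l < k" for l
    using z(1)[OF that] by (simp add: ip_cnj[of n "q l"])
  then show ?thesis using q z unfolding osys_def by (auto simp: less_Suc_eq)
qed

lemma gram_schmidt:
  fixes y :: "nat \<Rightarrow> nat \<Rightarrow> 'k::real_or_complex"
  shows "\<exists>q. osys n k q \<and> (\<forall>j<k. \<forall>i<n. y j i = proj n k q (y j) i)"
proof (induction k)
  case 0
  then show ?case by (simp add: osys_def)
next
  case (Suc k)
  then obtain q where q: "osys n k q" "\<And>j i. j < k \<Longrightarrow> i < n \<Longrightarrow> y j i = proj n k q (y j) i" by blast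
  define z where "z i = y k i - proj n k q (y k) i" for i
  have zq: "ip n z (q l) = 0" if "l < k" for l
    unfolding z_def by (rule ip_diff_proj[OF q(1) that])
  define r where "r = l2 n z"
  \<comment> \<open>When \<open>y k\<close> already lies in the span, \<open>r = 0\<close>; then
    \<open>1 / r = 0\<close> and the new vector is zero, as \<open>osys\<close> permits.\<close>
  define e where "e i = of_real (1 / r) * z i" for i
  have eq: "ip n e (q l) = 0" if "l < k" for l
    unfolding e_def ip_scale_left by (simp add: zq that)
  have ze: "z i = of_real r * e i" if "i < n" for i
  proof (cases "r = 0")
    case True
    then show ?thesis using that by (simp add: r_def l2_eq_0)
  qed (simp add: e_def)
  have le: "l2 n e \<in> {0, 1}"
    unfolding e_def l2_scale by (auto simp: r_def norm_divide)
  have os: "osys n (Suc k) (q(k := e))"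
    by (rule osys_extend[OF q(1) eq le])
  have pr: "proj n (Suc k) (q(k := e)) w i = proj n k q w i + ip n w e * e i" for w i
    by (simp add: proj_def)
  have "y j i = proj n (Suc k) (q(k := e)) (y j) i" if "j < Suc k" "i < n" for j i
  proof (cases "j = k")
    case True
    have "ip n (y k) e = ip n (\<lambda>i. proj n k q (y k) i + z i) e"
      by (simp add: z_def)
    also have "\<dots> = ip n (proj n k q (y k)) e + ip n z e"
      by (rule ip_add_left)
    also have "ip n (proj n k q (y k)) e = 0"
      using ip_right_0I[of k n e q "y k"] eq by (simp add: ip_cnj[of n _ e])
    also have "ip n z e = ip n (\<lambda>i. of_real r * e i) e"
      using ze by (intro ip_cong) auto
    finally have "ip n (y k) e = of_real (r * (l2 n e)\<^sup>2)"
      by (simp add: ip_scale_left ip_self)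
    then have "ip n (y k) e * e i = z i"
      using ze[OF that(2)] le that(2) by (auto simp: l2_eq_0)
    then show ?thesis by (simp add: True pr z_def)
  next
    case False
    then have j: "j < k" using that by simp
    have "ip n (y j) e = ip n (proj n k q (y j)) e"
      using q(2)[OF j] by (intro ip_cong) auto
    also have "\<dots> = 0"
      using ip_right_0I[of k n e q "y j"] eq by (simp add: ip_cnj[of n _ e])
    finally show ?thesis using q(2)[OF j that(2)] by (simp add: pr)
  qed
  with os show ?case by blast
qed

section \<open>Finite families of vectors\<close>

lemma compact_cball_real_or_complex: "compact (cball (0::'k::real_or_complex) r)"
proof (rule real_or_complex_cases[where 'k='k])
  assume *: "\<And>x::'k. \<exists>a. x = of_real a"
  have "cball (0::'k) r = of_real ` cball 0 r"
    using * by (fastforce simp: image_iff)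
  moreover have "compact (of_real ` cball (0::real) r :: 'k set)"
    by (intro compact_continuous_image continuous_intros compact_cball)
  ultimately show ?thesis by simp
next
  fix i :: 'k
  assume i: "i * i = - 1" "\<And>x::'k. \<exists>a b. x = of_real a + of_real b * i"
      "\<And>a b. norm (of_real a + of_real b * i) = sqrt (a\<^sup>2 + b\<^sup>2)"
  let ?h = "\<lambda>p::real \<times> real. of_real (fst p) + of_real (snd p) * i"
  have n: "norm (?h p) = norm p" for p
    by (cases p) (simp add: i(3) norm_Pair)
  have "cball (0::'k) r = ?h ` cball 0 r"
  proof (intro equalityI subsetI)
    fix x :: 'k assume x: "x \<in> cball 0 r"
    obtain a b where ab: "x = of_real a + of_real b * i" using i(2) by blast
    then have "x = ?h (a, b)" by simp
    moreover have "(a, b) \<in> cball 0 r" using x n[of "(a, b)"] ab by simp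
    ultimately show "x \<in> ?h ` cball 0 r" by (rule image_eqI)
  next
    fix x assume "x \<in> ?h ` cball 0 r"
    then show "x \<in> cball 0 r" using n by auto
  qed
  moreover have "compact (?h ` cball 0 r)"
    by (intro compact_continuous_image continuous_intros compact_cball)
  ultimately show ?thesis by simp
qed

context nspc
begin

definition comb :: "nat \<Rightarrow> (nat \<Rightarrow> 'x) \<Rightarrow> (nat \<Rightarrow> 'k) \<Rightarrow> 'x" where
  "comb n x a = (\<Sum>i<n. scl X (a i) (x i))"

definition fam :: "nat \<Rightarrow> (nat \<Rightarrow> 'x) \<Rightarrow> bool" where
  "fam n x \<longleftrightarrow> (\<forall>i<n. x i \<in> car X)"

text \<open>The operator from \<open>\<ell>\<^sub>2\<^sup>n\<close> that takes the unit vectors to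
  the \<open>x i\<close> has norm at most 1; equivalently, the family has weak l2 norm at most 1.
  Operators on Hilbert space are handled in this form until they have to be matched with
  \<open>bounded_op\<close>.\<close>

definition contr :: "nat \<Rightarrow> (nat \<Rightarrow> 'x) \<Rightarrow> bool" where
  "contr n x \<longleftrightarrow> fam n x \<and> (\<forall>a. nrm X (comb n x a) \<le> l2 n a)"

definition indep :: "nat \<Rightarrow> (nat \<Rightarrow> 'x) \<Rightarrow> bool" where
  "indep n x \<longleftrightarrow> fam n x \<and> (\<forall>a. comb n x a = 0 \<longrightarrow> (\<forall>i<n. a i = 0))"

lemma contr_fam: "contr n x \<Longrightarrow> fam n x" and indep_fam: "indep n x \<Longrightarrow> fam n x"
  by (auto simp: contr_def indep_def)

lemma comb_in [intro]: "fam n x \<Longrightarrow> comb n x a \<in> car X"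
  by (auto simp: comb_def fam_def intro!: car_sum car_scl)

lemma comb_add: "comb n x (\<lambda>i. a i + b i) = comb n x a + comb n x b"
  by (simp add: comb_def vs.scale_left_distrib sum.distrib)

lemma comb_scale: "comb n x (\<lambda>i. c * a i) = scl X c (comb n x a)"
  by (simp add: comb_def vs.scale_sum_right)

lemma comb_diff: "comb n x (\<lambda>i. a i - b i) = comb n x a - comb n x b"
  by (simp add: comb_def vs.scale_left_diff_distrib sum_subtractf)

lemma comb_cong: "(\<And>i. i < n \<Longrightarrow> x i = y i) \<Longrightarrow> (\<And>i. i < n \<Longrightarrow> a i = b i) \<Longrightarrow> comb n x a = comb n y b"
  by (simp add: comb_def)

lemma comb_comb: "comb m (\<lambda>j. comb n x (A j)) a = comb n x (\<lambda>i. \<Sum>j<m. a j * A j i)"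
  unfolding comb_def by (simp add: vs.scale_sum_right vs.scale_sum_left) (rule sum.swap)

lemma comb_unit: "i < n \<Longrightarrow> comb n x (Defs.unit_vec i) = x i"
  by (simp add: comb_def Defs.unit_vec_def if_distrib[of "\<lambda>c. scl X c _"] cong: if_cong)

lemma nrm_comb_le: "fam n x \<Longrightarrow> nrm X (comb n x a) \<le> (\<Sum>i<n. norm (a i) * nrm X (x i))"
  unfolding comb_def using nrm_sum[of "{..<n}" "\<lambda>i. scl X (a i) (x i)"]
  by (auto simp: fam_def nrm_scl car_scl)

lemma contr_elem: "contr n x \<Longrightarrow> i < n \<Longrightarrow> nrm X (x i) \<le> 1"
  using comb_unit[of i n x] l2_unit_vec[of i n, where 'k = 'k] unfolding contr_def by metis

text \<open>On the unit sphere of the coefficients, a compact set, the norm of the combination is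
  continuous, and its minimum is positive by independence.\<close>

lemma indep_norm_lower:
  assumes b: "indep n b"
  obtains c where "c > 0" "\<And>a. c * l2 n a \<le> nrm X (comb n b a)"
proof -
  have fb: "fam n b" using b by (rule indep_fam)
  define g where "g a = nrm X (comb n b a)" for a
  \<comment> \<open>Coefficients beyond \<open>n\<close> are frozen at 0, which makes this a product
    of compact sets; \<open>red\<close> brings a general \<open>a\<close> into it by truncating and
    normalising.\<close>
  define B where "B = Pi UNIV (\<lambda>i. if i < n then cball (0::'k) 1 else {0})"
  have coord: "((\<lambda>a'::nat \<Rightarrow> 'k. a' i) \<longlongrightarrow> a i) (at a)" for a i
  proof -
    have "continuous_on UNIV (\<lambda>a'::nat \<Rightarrow> 'k. a' i)"
      by (rule continuous_on_product_coordinates)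
    then show ?thesis by (simp add: continuous_on_def)
  qed
  have "compactin (product_topology (\<lambda>i. euclidean) UNIV) (PiE UNIV (\<lambda>i. if i < n then cball (0::'k) 1 else {0}))"
    unfolding compactin_PiE by (auto simp: compact_cball_real_or_complex)
  then have "compact B"
    unfolding euclidean_product_topology compactin_euclidean_iff B_def by (simp add: PiE_UNIV_domain Pi_def)
  moreover have "continuous_on UNIV (\<lambda>a::nat \<Rightarrow> 'k. l2 n a)"
    unfolding L2_set_def continuous_on_def by (intro ballI tendsto_intros coord)
  then have "closed {a::nat \<Rightarrow> 'k. l2 n a = 1}"
    using continuous_closed_preimage_constant[of UNIV "\<lambda>a::nat \<Rightarrow> 'k. l2 n a" 1] by simp
  ultimately have comp: "compact (B \<inter> {a. l2 n a = 1})"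
    by (rule compact_Int_closed)
  have gd: "\<bar>g a' - g a\<bar> \<le> (\<Sum>i<n. norm (a' i - a i) * nrm X (b i))" for a a'
  proof -
    have "g a' - g a \<le> nrm X (comb n b (\<lambda>i. a' i - a i))" for a a'
      using nrm_diff_ge[of "comb n b a'" "comb n b a"] fb by (auto simp: g_def comb_diff)
    then have "g a' - g a \<le> (\<Sum>i<n. norm (a' i - a i) * nrm X (b i))" for a a'
      using nrm_comb_le[OF fb] order_trans by blast
    from this[of a a'] this[of a' a] show ?thesis by (simp add: norm_minus_commute)
  qed
  have "(g \<longlongrightarrow> g a) (at a)" for a
  proof -
    have "((\<lambda>a'. \<Sum>i<n. norm (a' i - a i) * nrm X (b i)) \<longlongrightarrow> (\<Sum>i<n. norm (a i - a i) * nrm X (b i))) (at a)"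
      by (intro tendsto_intros coord)
    then have "((\<lambda>a'. \<Sum>i<n. norm (a' i - a i) * nrm X (b i)) \<longlongrightarrow> 0) (at a)" by simp
    then have "((\<lambda>a'. g a' - g a) \<longlongrightarrow> 0) (at a)"
      by (rule Lim_null_comparison[rotated]) (auto intro!: always_eventually gd)
    then show ?thesis by (simp add: LIM_zero_iff)
  qed
  then have "continuous_on UNIV g"
    by (simp add: continuous_on_def)
  then have cont: "continuous_on (B \<inter> {a. l2 n a = 1}) g"
    by (rule continuous_on_subset) simp
  have red: "c * l2 n a \<le> g a" if c: "\<And>a. a \<in> B \<inter> {a. l2 n a = 1} \<Longrightarrow> c \<le> g a" for a c
  proof (cases "l2 n a = 0")
    case True
    then show ?thesis using nrm_nonneg fb by (auto simp: g_def)
  next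
    case False
    define r where "r = l2 n a"
    have r: "r > 0" using False L2_set_nonneg[of "\<lambda>i. norm (a i)" "{..<n}"] unfolding r_def by linarith
    define a' where "a' i = (if i < n then of_real (1 / r) * a i else 0)" for i
    have l: "l2 n a' = l2 n (\<lambda>i. of_real (1 / r) * a i)" by (intro l2_cong) (simp add: a'_def)
    then have "l2 n a' = 1" unfolding l2_scale using r by (simp add: r_def norm_divide)
    moreover have "norm (a i) \<le> r" if "i < n" for i
      unfolding r_def using that by (intro member_le_L2_set) auto
    then have "a' \<in> B" using r by (auto simp: B_def a'_def norm_mult norm_divide)
    ultimately have "c \<le> g a'" using c by simp
    also have "comb n b a' = comb n b (\<lambda>i. of_real (1 / r) * a i)"
      by (intro comb_cong) (auto simp: a'_def)
    then have "g a' = g a / r"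
      unfolding comb_scale g_def using r fb by (simp add: nrm_scl comb_in norm_divide)
    finally show ?thesis using r by (simp add: r_def field_simps)
  qed
  show thesis
  proof (cases "B \<inter> {a. l2 n a = 1} = {}")
    case True
    then show thesis using that[of 1] red[of 1] by (auto simp: g_def)
  next
    case False
    obtain a where a: "a \<in> B \<inter> {a. l2 n a = 1}" "\<And>a'. a' \<in> B \<inter> {a. l2 n a = 1} \<Longrightarrow> g a \<le> g a'"
      using continuous_attains_inf[OF comp False cont] by blast
    have "g a \<noteq> 0"
    proof
      assume "g a = 0"
      then have "comb n b a = 0" using nrm_eq_0 fb by (auto simp: g_def)
      then have "l2 n a = 0" using b by (auto simp: indep_def l2_eq_0)
      then show False using a(1) by simp
    qed
    then have "g a > 0" using nrm_nonneg fb by (auto simp: g_def less_le)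
    then show thesis using that red[OF a(2)] by (auto simp: g_def)
  qed
qed

end

section \<open>Determinants of functions on index pairs\<close>

definition fdet :: "nat \<Rightarrow> (nat \<Rightarrow> nat \<Rightarrow> 'a::field) \<Rightarrow> 'a" where
  "fdet n A = Determinant.det (Matrix.mat n n (\<lambda>(i, j). A i j))"

lemma fdet_cong: "(\<And>i j. i < n \<Longrightarrow> j < n \<Longrightarrow> A i j = B i j) \<Longrightarrow> fdet n A = fdet n B"
  unfolding fdet_def by (rule arg_cong[where f = Determinant.det]) (auto intro!: eq_matI)

lemma fdet_one: "fdet n (\<lambda>i j. if i = j then 1 else 0) = 1"
proof -
  have "Matrix.mat n n (\<lambda>(i, j). if i = j then 1 else 0) = (1\<^sub>m n :: 'a mat)"
    by (auto intro!: eq_matI)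
  then show ?thesis by (simp add: fdet_def)
qed

lemma fdet_scale: "fdet n (\<lambda>i j. c * A i j) = c ^ n * fdet n A"
proof -
  have "Matrix.mat n n (\<lambda>(i, j). c * A i j) = c \<cdot>\<^sub>m Matrix.mat n n (\<lambda>(i, j). A i j)"
    by (auto intro!: eq_matI)
  then show ?thesis by (simp add: fdet_def)
qed

lemma mat_mult_fun:
  "Matrix.mat n n (\<lambda>(i, j). A i j) * Matrix.mat n n (\<lambda>(i, j). B i j)
    = Matrix.mat n n (\<lambda>(i, j). \<Sum>l<n. A i l * (B l j :: 'a::field))"
  by (auto intro!: eq_matI sum.cong simp: scalar_prod_def atLeast0LessThan)

lemma fdet_mult: "fdet n (\<lambda>i j. \<Sum>l<n. A i l * B l j) = fdet n A * fdet n B"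
  unfolding fdet_def mat_mult_fun[symmetric] by (rule Determinant.det_mult) auto

text \<open>Each of the \<open>fact n\<close> terms of the Leibniz expansion is at most
  \<open>C ^ n\<close>; this crude bound serves to make a supremum of determinants finite.\<close>

lemma fdet_bound:
  fixes A :: "nat \<Rightarrow> nat \<Rightarrow> 'a::real_normed_field"
  assumes "\<And>i j. i < n \<Longrightarrow> j < n \<Longrightarrow> norm (A i j) \<le> C"
  shows "norm (fdet n A) \<le> fact n * C ^ n"
proof -
  have "fdet n A = (\<Sum>p\<in>{p. p permutes {0..<n}}.
      signof p * (\<Prod>i = 0..<n. Matrix.mat n n (\<lambda>(i, j). A i j) $$ (i, p i)))"
    unfolding fdet_def by (rule det_def') simp
  also have "norm \<dots> \<le> (\<Sum>p\<in>{p. p permutes {0..<n}}. C ^ n)"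
  proof (rule sum_norm_le)
    fix p assume "p \<in> {p. p permutes {0..<n}}"
    then have p: "p permutes {0..<n}" by simp
    have pi: "p i < n" if "i < n" for i
      using permutes_in_image[OF p, of i] that by simp
    have "norm (signof p :: 'a) = 1"
      by (simp add: sign_def)
    then have "norm (signof p * (\<Prod>i = 0..<n. Matrix.mat n n (\<lambda>(i, j). A i j) $$ (i, p i)))
        = (\<Prod>i = 0..<n. norm (A i (p i)))"
      using pi by (simp add: norm_mult prod_norm[symmetric])
    also have "\<dots> \<le> (\<Prod>i = 0..<n. C)"
      using assms pi by (intro prod_mono) auto
    finally show "norm (signof p * (\<Prod>i = 0..<n. Matrix.mat n n (\<lambda>(i, j). A i j) $$ (i, p i))) \<le> C ^ n"
      by simp
  qed
  also have "\<dots> = fact n * C ^ n"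
    by (simp add: card_permutations)
  finally show ?thesis .
qed

lemma fdet_inverse:
  assumes "fdet n A \<noteq> (0::'a::field)"
  obtains B where "\<And>i j. i < n \<Longrightarrow> j < n \<Longrightarrow> (\<Sum>l<n. A i l * B l j) = (if i = j then 1 else 0)"
    "\<And>i j. i < n \<Longrightarrow> j < n \<Longrightarrow> (\<Sum>l<n. B i l * A l j) = (if i = j then 1 else 0)"
proof -
  define M where "M = Matrix.mat n n (\<lambda>(i, j). A i j)"
  have M: "M \<in> carrier_mat n n" by (simp add: M_def)
  define d where "d = Determinant.det M"
  have d: "d \<noteq> 0" using assms by (simp add: fdet_def d_def M_def)
  note a = adj_mat[OF M]
  define B where "B i j = adj_mat M $$ (i, j) / d" for i j
  have adj: "adj_mat M = Matrix.mat n n (\<lambda>(i, j). d * B i j)"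
    using a(1) d by (auto simp: B_def intro!: eq_matI)
  show thesis
  proof (rule that)
    fix i j assume ij: "i < n" "j < n"
    have "M * adj_mat M = Matrix.mat n n (\<lambda>(i, j). \<Sum>l<n. A i l * (d * B l j))"
      by (simp only: adj) (simp only: M_def mat_mult_fun)
    then have "(M * adj_mat M) $$ (i, j) = d * (\<Sum>l<n. A i l * B l j)"
      using ij by (simp add: sum_distrib_left algebra_simps)
    then show "(\<Sum>l<n. A i l * B l j) = (if i = j then 1 else 0)"
      using a(2) ij d by (auto simp: d_def split: if_splits)
    have "adj_mat M * M = Matrix.mat n n (\<lambda>(i, j). \<Sum>l<n. d * B i l * A l j)"
      by (simp only: adj) (simp only: M_def mat_mult_fun)
    then have "(adj_mat M * M) $$ (i, j) = d * (\<Sum>l<n. B i l * A l j)"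
      using ij by (simp add: sum_distrib_left algebra_simps)
    then show "(\<Sum>l<n. B i l * A l j) = (if i = j then 1 else 0)"
      using a(3) ij d by (auto simp: d_def split: if_splits)
  qed
qed

text \<open>Compare the two factorisations of the block matrix
  \<open>((1 + u w, u), (w + (w u) w, 1 + w u))\<close>.\<close>

lemma fdet_rank_one:
  "fdet n (\<lambda>i j. (if i = j then 1 else 0) + u i * w j) = 1 + (\<Sum>i<n. w i * u i :: 'a::field)"
proof -
  define U where "U = Matrix.mat n 1 (\<lambda>(i, j). u i)"
  define W where "W = Matrix.mat 1 n (\<lambda>(i, j). w j)"
  define A where "A = Matrix.mat n n (\<lambda>(i, j). (if i = j then 1 else 0) + u i * w j)"
  define s where "s = (\<Sum>i<n. w i * u i)"
  define S where "S = Matrix.mat 1 1 (\<lambda>(i, j). 1 + s)"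
  note defs = U_def W_def A_def S_def
  let ?L = "four_block_mat (1\<^sub>m n) (0\<^sub>m n 1) W (1\<^sub>m 1)"
  let ?M = "four_block_mat A U (0\<^sub>m 1 n) (1\<^sub>m 1)"
  let ?N = "four_block_mat (1\<^sub>m n) U (0\<^sub>m 1 n) S"
  have carr: "U \<in> carrier_mat n 1" "W \<in> carrier_mat 1 n" "A \<in> carrier_mat n n" "S \<in> carrier_mat 1 1"
    by (auto simp: defs)
  have UW: "1\<^sub>m n + U * W = A"
    by (auto intro!: eq_matI simp: defs scalar_prod_def)
  have WU: "W * U + 1\<^sub>m 1 = S"
    by (auto intro!: eq_matI simp: defs scalar_prod_def s_def atLeast0LessThan)
  have WA: "W * A = S * W"
  proof (rule eq_matI)
    fix i j assume "i < dim_row (S * W)" "j < dim_col (S * W)"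
    then have ij: "i = 0" "j < n" using carr by auto
    have "(W * A) $$ (i, j) = (\<Sum>l<n. (if l = j then w l else 0) + w l * u l * w j)"
      using ij by (auto simp: defs scalar_prod_def atLeast0LessThan algebra_simps intro!: sum.cong)
    also have "\<dots> = w j + s * w j"
      using ij by (simp add: sum.distrib s_def sum_distrib_right)
    also have "\<dots> = (S * W) $$ (i, j)"
      using ij by (simp add: defs scalar_prod_def algebra_simps)
    finally show "(W * A) $$ (i, j) = (S * W) $$ (i, j)" .
  qed (use carr in auto)
  have LM: "?L * ?M = four_block_mat A U (W * A) S"
    using carr WU by (subst mult_four_block_mat[OF one_carrier_mat zero_carrier_mat carr(2) one_carrier_mat
          carr(3,1) zero_carrier_mat one_carrier_mat]) auto
  have NL: "?N * ?L = four_block_mat A U (S * W) S"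
    using carr UW by (subst mult_four_block_mat[OF one_carrier_mat carr(1) zero_carrier_mat carr(4)
          one_carrier_mat zero_carrier_mat carr(2) one_carrier_mat]) auto
  have carr': "?L \<in> carrier_mat (n + 1) (n + 1)" "?M \<in> carrier_mat (n + 1) (n + 1)" "?N \<in> carrier_mat (n + 1) (n + 1)"
    using carr by auto
  have dL: "Determinant.det ?L = 1"
    using carr by (subst det_four_block_mat_upper_right_zero[where n = n and m = 1]) auto
  have dM: "Determinant.det ?M = Determinant.det A"
    using carr by (subst det_four_block_mat_lower_left_zero[where n = n and m = 1]) auto
  have "Determinant.det S = 1 + s"
    by (subst det_single) (auto simp: S_def)
  then have dN: "Determinant.det ?N = 1 + s"
    using carr by (subst det_four_block_mat_lower_left_zero[where n = n and m = 1]) auto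
  have "Determinant.det ?L * Determinant.det ?M = Determinant.det ?N * Determinant.det ?L"
    using LM NL WA carr' by (metis Determinant.det_mult)
  then have "Determinant.det A = 1 + s"
    unfolding dL dM dN by simp
  then show ?thesis by (simp add: fdet_def A_def s_def)
qed

section \<open>The Efron--Stein inequality on finite product spaces\<close>

text \<open>Conditional expectation given all coordinates except \<open>p\<close>, for the uniform
  distribution on \<open>W\<close>.\<close>

definition cavg :: "'w set \<Rightarrow> 'p \<Rightarrow> (('p \<Rightarrow> 'w) \<Rightarrow> real) \<Rightarrow> ('p \<Rightarrow> 'w) \<Rightarrow> real" where
  "cavg W p F w = (\<Sum>v\<in>W. F (w(p := v))) / real (card W)"

text \<open>Averaging is self-adjoint: exchanging the coordinate \<open>p\<close> of
  \<open>w\<close> with the independent value \<open>v\<close> is an involution of the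
  pairs.\<close>

lemma sum_cavg_mult:
  fixes F H :: "('p \<Rightarrow> 'w) \<Rightarrow> real"
  assumes "finite W" "p \<in> I"
  shows "(\<Sum>w\<in>PiE I (\<lambda>_. W). cavg W p F w * H w) = (\<Sum>w\<in>PiE I (\<lambda>_. W). F w * cavg W p H w)"
proof -
  let ?S = "PiE I (\<lambda>_. W) \<times> W"
  have "(\<Sum>(w, v)\<in>?S. F (w(p := v)) * H w) = (\<Sum>(w, v)\<in>?S. F w * H (w(p := v)))"
    by (rule sum.reindex_bij_witness[of _ "\<lambda>(w, v). (w(p := v), w p)" "\<lambda>(w, v). (w(p := v), w p)"])
      (use assms in \<open>auto simp: PiE_def Pi_def extensional_def\<close>)
  then have "(\<Sum>w\<in>PiE I (\<lambda>_. W). \<Sum>v\<in>W. F (w(p := v)) * H w) = (\<Sum>w\<in>PiE I (\<lambda>_. W). \<Sum>v\<in>W. F w * H (w(p := v)))"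
    by (simp add: sum.cartesian_product)
  moreover have "(\<Sum>w\<in>PiE I (\<lambda>_. W). cavg W p F w * H w)
      = (\<Sum>w\<in>PiE I (\<lambda>_. W). \<Sum>v\<in>W. F (w(p := v)) * H w) / real (card W)"
    by (simp add: cavg_def sum_distrib_right sum_divide_distrib)
  moreover have "(\<Sum>w\<in>PiE I (\<lambda>_. W). F w * cavg W p H w)
      = (\<Sum>w\<in>PiE I (\<lambda>_. W). \<Sum>v\<in>W. F w * H (w(p := v))) / real (card W)"
    by (simp add: cavg_def sum_distrib_left sum_divide_distrib)
  ultimately show ?thesis by simp
qed

lemma cavg_cavg: "finite W \<Longrightarrow> cavg W p (cavg W p F) = cavg W p F"
  by (cases "W = {}") (auto simp: cavg_def fun_eq_iff)

lemma cavg_diff: "cavg W p (\<lambda>w. F w - H w) w = cavg W p F w - cavg W p H w"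
  by (simp add: cavg_def sum_subtractf diff_divide_distrib)

text \<open>\<open>cavg W p\<close> is an orthogonal projection for the inner product of functions
  on the sample space, so \<open>F - cavg W p F\<close> is orthogonal to its range.\<close>

lemma cavg_pythagoras:
  fixes F H :: "('a \<Rightarrow> 'b) \<Rightarrow> real"
  assumes "finite W" "p \<in> I"
  shows "(\<Sum>w\<in>PiE I (\<lambda>_. W). (F w - cavg W p F w + cavg W p H w)\<^sup>2)
    = (\<Sum>w\<in>PiE I (\<lambda>_. W). (F w - cavg W p F w)\<^sup>2) + (\<Sum>w\<in>PiE I (\<lambda>_. W). (cavg W p H w)\<^sup>2)"
proof -
  have "(\<Sum>w\<in>PiE I (\<lambda>_. W). (F w - cavg W p F w) * cavg W p H w)
      = (\<Sum>w\<in>PiE I (\<lambda>_. W). F w * cavg W p H w) - (\<Sum>w\<in>PiE I (\<lambda>_. W). cavg W p F w * cavg W p H w)"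
    by (simp add: left_diff_distrib sum_subtractf)
  also have "(\<Sum>w\<in>PiE I (\<lambda>_. W). cavg W p F w * cavg W p H w) = (\<Sum>w\<in>PiE I (\<lambda>_. W). F w * cavg W p H w)"
    by (simp add: sum_cavg_mult[OF assms] cavg_cavg assms)
  finally have 0: "(\<Sum>w\<in>PiE I (\<lambda>_. W). (F w - cavg W p F w) * cavg W p H w) = 0"
    by simp
  have "(\<Sum>w\<in>A. (a w + b w)\<^sup>2) = (\<Sum>w\<in>A. (a w)\<^sup>2) + (\<Sum>w\<in>A. (b w)\<^sup>2) + 2 * (\<Sum>w\<in>A. a w * b w)"
    for A and a b :: "('a \<Rightarrow> 'b) \<Rightarrow> real"
    by (simp add: power2_sum sum.distrib sum_distrib_left mult.assoc)
  from this[of "\<lambda>w. F w - cavg W p F w" "cavg W p H" "PiE I (\<lambda>_. W)"] show ?thesis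
    unfolding 0 by simp
qed

lemma sum_sq_diff_cavg_le:
  assumes "finite W" "p \<in> I"
  shows "(\<Sum>w\<in>PiE I (\<lambda>_. W). (F w - cavg W p F w)\<^sup>2) \<le> (\<Sum>w\<in>PiE I (\<lambda>_. W). (F w)\<^sup>2)"
    and "(\<Sum>w\<in>PiE I (\<lambda>_. W). (cavg W p F w)\<^sup>2) \<le> (\<Sum>w\<in>PiE I (\<lambda>_. W). (F w)\<^sup>2)"
  using cavg_pythagoras[OF assms, of F F] by (simp_all add: sum_nonneg)

text \<open>\<open>H\<close> arises from \<open>F\<close> by averaging over all coordinates in
  \<open>J\<close>. For a new coordinate, \<open>F - cavg W p H\<close> splits into the orthogonal
  parts \<open>F - cavg W p F\<close> and \<open>cavg W p (F - H)\<close>, and the latter is no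
  longer than \<open>F - H\<close>.\<close>

lemma efron_stein_cavg:
  assumes W: "finite W" and J: "finite J" "J \<subseteq> I"
  shows "\<exists>H. (\<forall>p\<in>J. \<forall>w v. H (w(p := v)) = (H w :: real)) \<and>
    (\<Sum>w\<in>PiE I (\<lambda>_. W). (F w - H w)\<^sup>2) \<le> (\<Sum>p\<in>J. \<Sum>w\<in>PiE I (\<lambda>_. W). (F w - cavg W p F w)\<^sup>2)"
  using J
proof (induction J rule: finite_induct)
  case empty
  show ?case by (intro exI[of _ F]) simp
next
  case (insert p J)
  then have "J \<subseteq> I" by simp
  from insert.IH[OF this] obtain H where H': "\<forall>p\<in>J. \<forall>w v. H (w(p := v)) = H w"
    and H2: "(\<Sum>w\<in>PiE I (\<lambda>_. W). (F w - H w)\<^sup>2) \<le> (\<Sum>p\<in>J. \<Sum>w\<in>PiE I (\<lambda>_. W). (F w - cavg W p F w)\<^sup>2)"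
    by blast
  have H: "H (w(q := v)) = H w" if "q \<in> J" for q w v using H' that by blast
  have p: "p \<in> I" using insert by simp
  have "cavg W p H (w(q := v)) = cavg W p H w" if q: "q \<in> insert p J" for q w v
  proof (cases "q = p")
    case False
    then have "H (w(q := v, p := u)) = H (w(p := u))" for u
      using H[of q "w(p := u)" v] q by (simp add: fun_upd_twist)
    then show ?thesis by (simp add: cavg_def)
  qed (simp add: cavg_def)
  moreover have "(\<Sum>w\<in>PiE I (\<lambda>_. W). (F w - cavg W p H w)\<^sup>2)
      = (\<Sum>w\<in>PiE I (\<lambda>_. W). (F w - cavg W p F w + cavg W p (\<lambda>w. F w - H w) w)\<^sup>2)"
    by (simp add: cavg_diff)
  then have "(\<Sum>w\<in>PiE I (\<lambda>_. W). (F w - cavg W p H w)\<^sup>2)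
      \<le> (\<Sum>q\<in>insert p J. \<Sum>w\<in>PiE I (\<lambda>_. W). (F w - cavg W q F w)\<^sup>2)"
    using insert.hyps H2 sum_sq_diff_cavg_le(2)[OF W p, of "\<lambda>w. F w - H w"]
    by (simp add: cavg_pythagoras[OF W p])
  ultimately show ?case by blast
qed

text \<open>If \<open>D p w\<close> bounds every decrease of \<open>F\<close> caused by a change of the coordinate \<open>p\<close>, then the
  oscillation of \<open>F\<close> around its minimum in that coordinate is at most \<open>D p w\<close>; this minimum does
  not depend on the coordinate, so the average in the coordinate is an even better approximation.\<close>

lemma efron_stein:
  fixes F :: "('p \<Rightarrow> 'w) \<Rightarrow> real"
  assumes W: "finite W" "W \<noteq> {}" and I: "finite I"
    and D: "\<And>p w v. p \<in> I \<Longrightarrow> w \<in> PiE I (\<lambda>_. W) \<Longrightarrow> v \<in> W \<Longrightarrow> F w - F (w(p := v)) \<le> D p w"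
  obtains c :: real where "(\<Sum>w\<in>PiE I (\<lambda>_. W). (F w - c)\<^sup>2) \<le> (\<Sum>w\<in>PiE I (\<lambda>_. W). \<Sum>p\<in>I. (D p w)\<^sup>2)"
proof -
  let ?O = "PiE I (\<lambda>_. W)"
  have le: "(\<Sum>w\<in>?O. (F w - cavg W p F w)\<^sup>2) \<le> (\<Sum>w\<in>?O. (D p w)\<^sup>2)" if p: "p \<in> I" for p
  proof -
    define C where "C w = Min ((\<lambda>v. F (w(p := v))) ` W)" for w
    have "C (w(p := v)) = C w" for w v by (simp add: C_def)
    then have cC: "cavg W p C w = C w" for w
      using W by (simp add: cavg_def)
    have "(\<Sum>w\<in>?O. (F w - cavg W p F w)\<^sup>2) = (\<Sum>w\<in>?O. (F w - C w - cavg W p (\<lambda>w. F w - C w) w)\<^sup>2)"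
      by (simp add: cavg_diff cC)
    also have "\<dots> \<le> (\<Sum>w\<in>?O. (F w - C w)\<^sup>2)"
      by (rule sum_sq_diff_cavg_le(1)[OF W(1) p])
    also have "\<dots> \<le> (\<Sum>w\<in>?O. (D p w)\<^sup>2)"
    proof (intro sum_mono power_mono)
      fix w assume w: "w \<in> ?O"
      have "w p \<in> W" using w p by (auto simp: PiE_def Pi_def)
      then have "C w \<le> F (w(p := w p))" unfolding C_def using W by (intro Min_le finite_imageI imageI)
      then show "0 \<le> F w - C w" by simp
      have "C w \<in> (\<lambda>v. F (w(p := v))) ` W"
        unfolding C_def using W by (intro Min_in) auto
      then show "F w - C w \<le> D p w" using D[OF p w] by auto
    qed
    finally show ?thesis .
  qed
  obtain H where H: "\<And>p w v. p \<in> I \<Longrightarrow> H (w(p := v)) = H w"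
    "(\<Sum>w\<in>?O. (F w - H w)\<^sup>2) \<le> (\<Sum>p\<in>I. \<Sum>w\<in>?O. (F w - cavg W p F w)\<^sup>2)"
    using efron_stein_cavg[OF W(1) I, of I F] by blast
  \<comment> \<open>The value \<open>undefined\<close> is the one that members of \<open>PiE\<close>
    take off \<open>I\<close>; changing coordinates one at a time leads from \<open>w0\<close> to
    \<open>w\<close> without altering \<open>H\<close>.\<close>
  define w0 :: "'p \<Rightarrow> 'w" where "w0 p = undefined" for p
  have "H w = H w0" if w: "w \<in> ?O" for w
  proof -
    have "H (\<lambda>p. if p \<in> J then w p else w0 p) = H w0" if "J \<subseteq> I" for J
      using finite_subset[OF that I] that
    proof (induction J rule: finite_induct)
      case (insert q J)
      have "(\<lambda>p. if p \<in> insert q J then w p else w0 p) = (\<lambda>p. if p \<in> J then w p else w0 p)(q := w q)"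
        by auto
      then show ?case using insert H(1) by simp
    qed simp
    from this[of I] have "H (\<lambda>p. if p \<in> I then w p else w0 p) = H w0" by simp
    also have "(\<lambda>p. if p \<in> I then w p else w0 p) = w"
      using w by (auto simp: PiE_def extensional_def w0_def)
    finally show ?thesis .
  qed
  then have "(\<Sum>w\<in>?O. (F w - H w0)\<^sup>2) = (\<Sum>w\<in>?O. (F w - H w)\<^sup>2)" by simp
  also have "\<dots> \<le> (\<Sum>p\<in>I. \<Sum>w\<in>?O. (D p w)\<^sup>2)"
    using H(2) le by (meson order_trans sum_mono)
  also have "\<dots> = (\<Sum>w\<in>?O. \<Sum>p\<in>I. (D p w)\<^sup>2)" by (rule sum.swap)
  finally show ?thesis by (rule that)
qed

section \<open>Ellipsoids of nearly maximal volume\<close>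

text \<open>The matrix is the identity plus \<open>c\<close> times the projection onto a
  \<open>j\<close>-dimensional space. Orthogonality of a new vector to the earlier ones lets its
  contribution split off as a rank one perturbation, so each vector yields a factor
  \<open>1 + c\<close>.\<close>

lemma fdet_proj:
  fixes u :: "nat \<Rightarrow> nat \<Rightarrow> 'k::real_or_complex"
  assumes "osys n j u" "\<And>l. l < j \<Longrightarrow> l2 n (u l) = 1"
  shows "fdet n (\<lambda>i m. (if i = m then 1 else 0) + c * (\<Sum>l<j. u l i * kcnj (u l m))) = (1 + c) ^ j"
  using assms
proof (induction j)
  case 0
  then show ?case by (simp add: fdet_one)
next
  case (Suc j)
  define P where "P i m = (\<Sum>l<j. u l i * kcnj (u l m))" for i m
  let ?A = "\<lambda>i m. (if i = m then 1 else 0) + c * P i m"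
  let ?B = "\<lambda>i m. (if i = m then 1 else 0) + c * u j i * kcnj (u j m)"
  have "(\<Sum>r<n. ?A i r * ?B r m) = (if i = m then 1 else 0) + c * (\<Sum>l<Suc j. u l i * kcnj (u l m))"
    if im: "i < n" "m < n" for i m
  proof -
    have z: "(\<Sum>r<n. kcnj (u l r) * u j r) = 0" if "l < j" for l
    proof -
      have "ip n (u j) (u l) = 0" using Suc.prems(1) that by (simp add: osys_def)
      then show ?thesis by (simp add: ip_def mult.commute)
    qed
    have s0: "(\<Sum>r<n. P i r * u j r) = 0"
    proof -
      have "(\<Sum>r<n. P i r * u j r)
          = (\<Sum>r<n. \<Sum>l<j. u l i * (kcnj (u l r) * u j r))"
        by (simp add: P_def sum_distrib_right mult.assoc)
      also have "\<dots> = (\<Sum>l<j. \<Sum>r<n. u l i * (kcnj (u l r) * u j r))"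
        by (rule sum.swap)
      also have "\<dots> = (\<Sum>l<j. u l i * (\<Sum>r<n. kcnj (u l r) * u j r))"
        by (simp add: sum_distrib_left)
      finally show ?thesis using z by simp
    qed
    have "(\<Sum>r<n. ?A i r * ?B r m) = (\<Sum>r<n. if r = m then ?A i r else 0)
        + (\<Sum>r<n. if r = i then c * u j r * kcnj (u j m) else 0)
        + c * c * kcnj (u j m) * (\<Sum>r<n. P i r * u j r)"
      unfolding sum_distrib_left sum.distrib[symmetric]
      by (intro sum.cong) (auto simp: algebra_simps)
    also have "\<dots> = (if i = m then 1 else 0) + c * (\<Sum>l<Suc j. u l i * kcnj (u l m))"
      unfolding s0 using im by (simp add: P_def algebra_simps)
    finally show ?thesis .
  qed
  then have "fdet n (\<lambda>i m. (if i = m then 1 else 0) + c * (\<Sum>l<Suc j. u l i * kcnj (u l m)))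
      = fdet n (\<lambda>i m. \<Sum>r<n. ?A i r * ?B r m)"
    by (intro fdet_cong) simp
  also have "\<dots> = fdet n ?A * fdet n ?B"
    by (rule fdet_mult)
  also have "fdet n ?A = (1 + c) ^ j"
    unfolding P_def using Suc by (simp add: osys_def)
  also have "fdet n ?B = 1 + (\<Sum>i<n. kcnj (u j i) * (c * u j i))"
    by (rule fdet_rank_one)
  also have "(\<Sum>i<n. kcnj (u j i) * (c * u j i)) = c * ip n (u j) (u j)"
    by (simp add: ip_def sum_distrib_left algebra_simps)
  also have "\<dots> = c"
    using Suc.prems(2)[of j] by (simp add: ip_self)
  finally show ?case by (simp add: mult.commute)
qed

context nspc
begin

text \<open>The determinants of all contractive coefficient matrices relative to \<open>b\<close>
  have a finite supremum, since \<open>b\<close> is bounded below, and a positive one, since a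
  multiple of \<open>b\<close> is contractive. Passing from \<open>x\<close> to combinations with
  coefficients \<open>A\<close> multiplies the determinant by \<open>fdet n A\<close>, so a choice
  within the factor 1 + \<eta> of the supremum bounds that factor.\<close>

lemma max_volume:
  assumes b: "indep n b" and \<eta>: "\<eta> > (0::real)"
  obtains x where "contr n x" "\<And>k. k < n \<Longrightarrow> \<exists>a. b k = comb n x a"
    "\<And>A. contr n (\<lambda>j. comb n x (\<lambda>i. A i j)) \<Longrightarrow> norm (fdet n A) \<le> 1 + \<eta>"
proof -
  have fb: "fam n b" using b by (rule indep_fam)
  define f :: "(nat \<Rightarrow> nat \<Rightarrow> 'k) \<Rightarrow> nat \<Rightarrow> 'x" where "f B j = comb n b (\<lambda>i. B i j)" for B j
  define S where "S = {norm (fdet n B) | B. contr n (f B)}"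
  obtain c where c: "c > 0" "\<And>a. c * l2 n a \<le> nrm X (comb n b a)"
    using indep_norm_lower[OF b] by blast
  have "norm (fdet n B) \<le> fact n * (1 / c) ^ n" if B: "contr n (f B)" for B
  proof (rule fdet_bound)
    fix i j assume ij: "i < n" "j < n"
    have "norm (B i j) \<le> l2 n (\<lambda>i. B i j)"
      using ij by (intro member_le_L2_set) auto
    moreover have "c * l2 n (\<lambda>i. B i j) \<le> 1"
      using c(2) contr_elem[OF B ij(2)] unfolding f_def by (meson order_trans)
    ultimately have "c * norm (B i j) \<le> 1"
      using c(1) by (meson mult_left_mono order_less_imp_le order_trans)
    then show "norm (B i j) \<le> 1 / c"
      using c(1) by (simp add: field_simps)
  qed
  then have bdd: "bdd_above S" by (intro bdd_aboveI) (auto simp: S_def)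
  define s where "s = 1 / (1 + l2 n (\<lambda>i. nrm X (b i)))"
  have s: "s > 0" "s * l2 n (\<lambda>i. nrm X (b i)) \<le> 1"
    using L2_set_nonneg[of "\<lambda>i. norm (nrm X (b i))" "{..<n}"] by (simp_all add: s_def field_simps add_pos_nonneg)
  have con: "contr n (f (\<lambda>i j. of_real s * (if i = j then 1 else 0)))"
    unfolding contr_def
  proof (intro conjI allI)
    show "fam n (f (\<lambda>i j. of_real s * (if i = j then 1 else 0)))"
      using fb by (auto simp: fam_def f_def intro!: comb_in)
    fix a
    have "comb n (f (\<lambda>i j. of_real s * (if i = j then 1 else 0))) a = comb n b (\<lambda>i. of_real s * a i)"
      unfolding f_def comb_comb
      by (intro comb_cong refl) (simp add: if_distrib[of "\<lambda>c. _ * c"] mult.commute cong: if_cong)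
    then have "nrm X (comb n (f (\<lambda>i j. of_real s * (if i = j then 1 else 0))) a) = s * nrm X (comb n b a)"
      using s(1) fb by (simp add: comb_scale nrm_scl comb_in)
    also have "\<dots> \<le> s * (l2 n a * l2 n (\<lambda>i. nrm X (b i)))"
    proof (rule mult_left_mono)
      have "nrm X (comb n b a) \<le> (\<Sum>i<n. \<bar>norm (a i)\<bar> * \<bar>norm (nrm X (b i))\<bar>)"
        using nrm_comb_le[OF fb, of a] fb nrm_nonneg by (simp add: fam_def)
      also have "\<dots> \<le> l2 n a * l2 n (\<lambda>i. nrm X (b i))" by (rule L2_set_mult_ineq)
      finally show "nrm X (comb n b a) \<le> l2 n a * l2 n (\<lambda>i. nrm X (b i))" .
    qed (use s in simp)
    also have "\<dots> = l2 n a * (s * l2 n (\<lambda>i. nrm X (b i)))" by simp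
    also have "\<dots> \<le> l2 n a * 1"
      by (intro mult_left_mono s(2) L2_set_nonneg)
    finally show "nrm X (comb n (f (\<lambda>i j. of_real s * (if i = j then 1 else 0))) a) \<le> l2 n a" by simp
  qed
  have "norm (fdet n (\<lambda>i j. of_real s * (if i = j then 1 else 0 :: 'k))) = s ^ n"
    unfolding fdet_scale fdet_one using s(1) by (simp add: norm_power)
  then have sS: "s ^ n \<in> S" using con by (force simp: S_def)
  define M where "M = Sup S"
  have M: "M > 0"
    using cSup_upper[OF sS bdd] zero_less_power[OF s(1), of n] by (simp add: M_def)
  then have "M / (1 + \<eta>) < M" using \<eta> by (simp add: field_simps)
  then obtain B where B: "contr n (f B)" "M / (1 + \<eta>) < norm (fdet n B)"
    using less_cSup_iff[of S "M / (1 + \<eta>)"] sS bdd by (auto simp: M_def S_def)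
  have dB: "norm (fdet n B) > 0" using B(2) M \<eta> by (smt (verit) divide_pos_pos)
  have comp: "comb n (f B) a = comb n b (\<lambda>i. \<Sum>j<n. a j * B i j)" for a
    unfolding f_def by (rule comb_comb)
  show thesis
  proof (rule that)
    show "contr n (f B)" by fact
  next
    fix k assume k: "k < n"
    obtain B' where B': "\<And>i j. i < n \<Longrightarrow> j < n \<Longrightarrow> (\<Sum>l<n. B i l * B' l j) = (if i = j then 1 else 0)"
      using fdet_inverse[of n B] dB by (metis norm_zero order_less_irrefl)
    have "comb n (f B) (\<lambda>l. B' l k) = comb n b (Defs.unit_vec k)"
      unfolding comp using B' k by (intro comb_cong) (auto simp: Defs.unit_vec_def mult.commute)
    then show "\<exists>a. b k = comb n (f B) a" using comb_unit[OF k, of b] by metis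
  next
    fix A assume "contr n (\<lambda>j. comb n (f B) (\<lambda>i. A i j))"
    also have "(\<lambda>j. comb n (f B) (\<lambda>i. A i j)) = f (\<lambda>i j. \<Sum>l<n. B i l * A l j)"
      unfolding comp by (simp add: f_def fun_eq_iff mult.commute)
    finally have "norm (fdet n (\<lambda>i j. \<Sum>l<n. B i l * A l j)) \<in> S" by (auto simp: S_def)
    then have "norm (fdet n B) * norm (fdet n A) \<le> M"
      unfolding fdet_mult M_def norm_mult[symmetric] using bdd by (rule cSup_upper)
    also have "M \<le> norm (fdet n B) * (1 + \<eta>)"
      using B(2) \<eta> by (simp add: field_simps)
    finally show "norm (fdet n A) \<le> 1 + \<eta>" using dB by simp
  qed
qed

text \<open>If \<open>u\<^sub>0, \<dots>, u\<^sub>j\<close> cannot be continued, then shrinking the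
  span of the \<open>u\<^sub>i\<close> by \<open>3/5\<close> and stretching its complement by \<open>12/5\<close> increases the volume.\<close>

lemma dvoretzky_rogers:
  assumes b: "indep (2 * N) b"
  obtains y where "contr N y" "\<And>i. i < N \<Longrightarrow> 1 / 3 \<le> nrm X (y i)"
proof -
  \<comment> \<open>Twice the wanted length, so that the complement of the vectors already found has
    larger dimension than their span.\<close>
  define n where "n = 2 * N"
  obtain x where x: "contr n x" "\<And>A. contr n (\<lambda>j. comb n x (\<lambda>i. A i j)) \<Longrightarrow> norm (fdet n A) \<le> 1 + 1"
  proof (rule max_volume[of n b 1])
    show "indep n b" using b by (simp add: n_def)
  next
    fix x
    assume "contr n x" "\<And>A. contr n (\<lambda>j. comb n x (\<lambda>i. A i j)) \<Longrightarrow> norm (fdet n A) \<le> 1 + 1"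
    then show thesis by (rule that)
  qed simp
  have fx: "fam n x" using x(1) by (rule contr_fam)
  have "\<exists>u. osys n j u \<and> (\<forall>l<j. l2 n (u l) = 1 \<and> 1 / 3 \<le> nrm X (comb n x (u l)))" if "j \<le> N" for j
    using that
  proof (induction j)
    case 0
    then show ?case by (simp add: osys_def)
  next
    case (Suc j)
    then obtain u where u: "osys n j u" "\<And>l. l < j \<Longrightarrow> l2 n (u l) = 1"
        "\<And>l. l < j \<Longrightarrow> 1 / 3 \<le> nrm X (comb n x (u l))"
      by auto
    have "\<exists>z. l2 n z = 1 \<and> (\<forall>l<j. ip n z (u l) = 0) \<and> 1 / 3 \<le> nrm X (comb n x z)"
    proof (rule ccontr)
      assume neg: "\<not> ?thesis"
      have small: "nrm X (comb n x z) \<le> l2 n z / 3" if z: "\<And>l. l < j \<Longrightarrow> ip n z (u l) = 0" for z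
      proof (cases "l2 n z = 0")
        case True
        moreover have "nrm X (comb n x z) \<le> l2 n z" using x(1) by (simp add: contr_def)
        ultimately show ?thesis by simp
      next
        case False
        define r where "r = l2 n z"
        have r: "r > 0" using False L2_set_nonneg[of "\<lambda>i. norm (z i)" "{..<n}"] unfolding r_def by linarith
        have "l2 n (\<lambda>i. of_real (1 / r) * z i) = 1"
          unfolding l2_scale using r by (simp add: norm_divide flip: r_def)
        moreover have "\<forall>l<j. ip n (\<lambda>i. of_real (1 / r) * z i) (u l) = 0"
          unfolding ip_scale_left using z by simp
        ultimately have "nrm X (comb n x (\<lambda>i. of_real (1 / r) * z i)) < 1 / 3"
          using neg by force
        then show ?thesis
          unfolding comb_scale using r fx by (simp add: nrm_scl comb_in norm_divide field_simps flip: r_def)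
      qed
      define Q where "Q i m = (\<Sum>l<j. u l i * kcnj (u l m))" for i m
      \<comment> \<open>\<open>Q\<close> is the projection onto the span of the \<open>u l\<close>,
        so \<open>A\<close> is 3/5 on the span and 12/5 on the complement. As
        \<open>comb n x\<close> shortens the complement by 1/3, the image of \<open>y\<close> has
        norm at most 3/5 of one component plus 4/5 of the other, and (3/5, 4/5) is a unit
        vector.\<close>
      define A where "A i m = of_real (12/5) * ((if i = m then 1 else 0) + of_real (-3/4) * Q i m)" for i m
      have "contr n (\<lambda>m. comb n x (\<lambda>i. A i m))"
        unfolding contr_def
      proof (intro conjI allI)
        show "fam n (\<lambda>m. comb n x (\<lambda>i. A i m))" using fx by (auto simp: fam_def intro!: comb_in)
        fix y
        let ?p = "proj n j u y"
        let ?z = "\<lambda>i. y i - ?p i"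
        have "comb n (\<lambda>m. comb n x (\<lambda>i. A i m)) y = comb n x (\<lambda>i. \<Sum>m<n. y m * A i m)"
          by (rule comb_comb)
        also have "\<dots> = comb n x (\<lambda>i. of_real (3/5) * ?p i + of_real (12/5) * ?z i)"
        proof (intro comb_cong refl)
          fix i assume i: "i < n"
          have pe: "(\<Sum>m<n. y m * Q i m) = ?p i"
          proof -
            have "(\<Sum>m<n. y m * Q i m) = (\<Sum>m<n. \<Sum>l<j. y m * kcnj (u l m) * u l i)"
              by (simp add: Q_def sum_distrib_left algebra_simps)
            also have "\<dots> = (\<Sum>l<j. \<Sum>m<n. y m * kcnj (u l m) * u l i)" by (rule sum.swap)
            finally show ?thesis by (simp add: proj_def ip_def sum_distrib_right)
          qed
          have "(\<Sum>m<n. y m * A i m) = of_real (12/5) * ((\<Sum>m<n. if i = m then y m else 0)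
              + of_real (-3/4) * (\<Sum>m<n. y m * Q i m))"
            unfolding sum_distrib_left sum.distrib[symmetric]
            by (intro sum.cong) (auto simp: A_def algebra_simps)
          also have "\<dots> = of_real (12/5) * (y i + of_real (-3/4) * ?p i)"
            unfolding pe using i by simp
          also have "\<dots> = of_real (3/5) * ?p i + of_real (12/5) * ?z i"
            by (simp add: field_simps)
          finally show "(\<Sum>m<n. y m * A i m) = of_real (3/5) * ?p i + of_real (12/5) * ?z i" .
        qed
        finally have eq: "comb n (\<lambda>m. comb n x (\<lambda>i. A i m)) y
            = scl X (of_real (3/5)) (comb n x ?p) + scl X (of_real (12/5)) (comb n x ?z)"
          by (simp only: comb_add comb_scale)
        have "nrm X (comb n (\<lambda>m. comb n x (\<lambda>i. A i m)) y)
            \<le> nrm X (scl X (of_real (3/5)) (comb n x ?p)) + nrm X (scl X (of_real (12/5)) (comb n x ?z))"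
          unfolding eq by (intro nrm_add car_scl comb_in fx)
        also have "\<dots> = 3/5 * nrm X (comb n x ?p) + 12/5 * nrm X (comb n x ?z)"
          unfolding nrm_scl[OF comb_in[OF fx]] norm_of_real by simp
        also have "\<dots> \<le> 3/5 * l2 n ?p + 12/5 * (l2 n ?z / 3)"
          using x(1) small[of ?z] ip_diff_proj[OF u(1)]
          by (intro add_mono mult_left_mono) (auto simp: contr_def)
        also have "\<dots> \<le> l2 n y"
        proof (rule power2_le_imp_le)
          have "(3/5 * l2 n ?p + 12/5 * (l2 n ?z / 3))\<^sup>2
              = (l2 n ?p)\<^sup>2 + (l2 n ?z)\<^sup>2 - (4/5 * l2 n ?p - 3/5 * l2 n ?z)\<^sup>2"
            by (simp add: power2_eq_square algebra_simps)
          then show "(3/5 * l2 n ?p + 12/5 * (l2 n ?z / 3))\<^sup>2 \<le> (l2 n y)\<^sup>2"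
            by (simp add: l2_proj_decomp[OF u(1), of y])
        qed (rule L2_set_nonneg)
        finally show "nrm X (comb n (\<lambda>m. comb n x (\<lambda>i. A i m)) y) \<le> l2 n y" .
      qed
      then have le2: "norm (fdet n A) \<le> 2" using x(2)[of A] by simp
      have "fdet n A = of_real (12/5) ^ n * fdet n (\<lambda>i m. (if i = m then 1 else 0) + of_real (-3/4) * Q i m)"
        unfolding A_def by (rule fdet_scale)
      also have "fdet n (\<lambda>i m. (if i = m then 1 else 0) + of_real (-3/4) * Q i m) = (1 + of_real (-3/4)) ^ j"
        unfolding Q_def by (rule fdet_proj[OF u(1) u(2)])
      finally have "fdet n A = of_real ((12/5) ^ n * (1/4) ^ j)" by simp
      then have "norm (fdet n A) = (12/5) ^ n * (1/4) ^ j" by (simp add: norm_mult norm_power norm_divide)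
      moreover have "(2::real) < (12/5) ^ n * (1/4) ^ j"
      proof -
        \<comment> \<open>As \<open>j < N\<close>, the dimension is at least \<open>2 j + 1\<close>.
          Each of the \<open>j\<close> vectors, taken with two dimensions, contributes the square of
          12/5 divided by 4, that is 36/25 > 1, and the spare factor 12/5 already exceeds 2.\<close>
        have "n = 2 * j + Suc (2 * N - 2 * j - 1)" using Suc.prems unfolding n_def by arith
        then obtain m where m: "n = j + j + Suc m" unfolding mult_2 by blast
        have "q ^ n * r ^ j = ((q\<^sup>2 * r) ^ j * q ^ m) * q" for q r :: real
          by (simp add: m power_add power_mult_distrib power2_eq_square)
        then have "(12/5::real) ^ n * (1/4) ^ j = (((12/5)\<^sup>2 * (1/4)) ^ j * (12/5) ^ m) * (12/5)" .
        also have "\<dots> \<ge> (1 * 1) * (12/5)"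
          by (intro mult_right_mono mult_mono one_le_power) (auto simp: power2_eq_square)
        finally show ?thesis by simp
      qed
      ultimately show False using le2 by linarith
    qed
    then obtain z where z: "l2 n z = 1" "\<And>l. l < j \<Longrightarrow> ip n z (u l) = 0" "1 / 3 \<le> nrm X (comb n x z)"
      by blast
    have "osys n (Suc j) (u(j := z))"
      using u(1) z by (intro osys_extend) auto
    moreover have "\<forall>l<Suc j. l2 n ((u(j := z)) l) = 1 \<and> 1 / 3 \<le> nrm X (comb n x ((u(j := z)) l))"
      using u(2,3) z by (auto simp: less_Suc_eq)
    ultimately show ?case by blast
  qed
  then obtain u where u: "osys n N u" "\<And>l. l < N \<Longrightarrow> l2 n (u l) = 1"
      "\<And>l. l < N \<Longrightarrow> 1 / 3 \<le> nrm X (comb n x (u l))"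
    by blast
  have "contr N (\<lambda>l. comb n x (u l))"
    unfolding contr_def
  proof (intro conjI allI)
    show "fam N (\<lambda>l. comb n x (u l))" using fx by (auto simp: fam_def intro!: comb_in)
    fix a
    define w where "w i = (\<Sum>l<N. a l * u l i)" for i
    have ipw: "ip n w (u m) = a m" if m: "m < N" for m
    proof -
      have "ip n w (u m) = (\<Sum>l<N. a l * ip n (u l) (u m))"
        unfolding w_def by (simp add: ip_sum_left ip_scale_left)
      also have "\<dots> = (\<Sum>l<N. if l = m then a m else 0)"
        using m u(1) u(2)[OF m] by (intro sum.cong) (auto simp: osys_def ip_self)
      finally show ?thesis using m by simp
    qed
    have pw: "proj n N u w = w" by (simp add: fun_eq_iff proj_def ipw) (simp add: w_def)
    have "(l2 n w)\<^sup>2 = (l2 N a)\<^sup>2"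
      using l2_proj[OF u(1), of w] unfolding pw l2_sq[of a N] by (simp add: ipw)
    then have lw: "l2 n w = l2 N a"
      by (simp add: power2_eq_iff_nonneg L2_set_nonneg)
    have "comb N (\<lambda>l. comb n x (u l)) a = comb n x w"
      unfolding comb_comb w_def by simp
    then show "nrm X (comb N (\<lambda>l. comb n x (u l)) a) \<le> l2 N a"
      using x(1) by (simp add: contr_def flip: lw)
  qed
  then show thesis using u(3) that by blast
qed

end

text \<open>The ellipse with semi-axes \<open>a\<close>, \<open>b\<close> lies in the convex hull of
  the unit disc and the two points at distance \<open>t\<close> on the long axis; \<open>ab\<close>
  is the condition of tangency to the sides of this hull. For the image \<open>(a s, b z)\<close> of
  a vector of length \<open>Y\<close>, the number \<open>l\<close> is the weight given to such a
  point, and the rest of the decomposition has length at most \<open>Y - l\<close>.\<close>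

lemma john_plane:
  fixes a b s t z Y :: real
  assumes ab: "a\<^sup>2 + b\<^sup>2 * (t\<^sup>2 - 1) = t\<^sup>2" and b: "0 \<le> b" "b \<le> 1" and a: "1 \<le> a" "a \<le> t" and t: "1 < t"
    and sz: "0 \<le> s" "0 \<le> z" "0 \<le> Y" "Y\<^sup>2 = s\<^sup>2 + z\<^sup>2"
  obtains l where "0 \<le> l" "l \<le> Y" "(a * s - l * t)\<^sup>2 + b\<^sup>2 * z\<^sup>2 \<le> (Y - l)\<^sup>2"
proof -
  have t2: "t\<^sup>2 - 1 > 0" using t by (simp add: power2_eq_square) (metis less_1_mult)
  have "s\<^sup>2 \<le> Y\<^sup>2" unfolding sz(4) by simp
  then have sY: "s \<le> Y" using sz(3) by (rule power2_le_imp_le)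
  have b2: "b\<^sup>2 * (t\<^sup>2 - 1) = t\<^sup>2 - a\<^sup>2" using ab by linarith
  show thesis
  proof (cases "a * s * t \<ge> Y")
    case True
    \<comment> \<open>Minimiser of the quadratic polynomial in \<open>l\<close> that has to become
      nonpositive. It is negative exactly in the other case, where the point already lies in the
      disc of radius \<open>Y\<close> and \<open>l = 0\<close> works.\<close>
    define l where "l = (a * s * t - Y) / (t\<^sup>2 - 1)"
    have l: "l * (t\<^sup>2 - 1) = a * s * t - Y" using t2 by (simp add: l_def)
    have "0 \<le> l" using True t2 by (simp add: l_def)
    moreover have "l \<le> Y"
    proof -
      have "a * s * t \<le> t * Y * t" using a t sY sz by (intro mult_right_mono mult_mono) auto
      then have "a * s * t - Y \<le> Y * (t\<^sup>2 - 1)" by (simp add: power2_eq_square algebra_simps)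
      then show ?thesis using t2 by (simp add: l_def field_simps)
    qed
    moreover have "(t\<^sup>2 - 1) * ((a * s - l * t)\<^sup>2 + b\<^sup>2 * z\<^sup>2 - (Y - l)\<^sup>2) = - (a * Y - t * s)\<^sup>2"
    proof -
      have "(t\<^sup>2 - 1) * ((a * s - l * t)\<^sup>2 + b\<^sup>2 * z\<^sup>2 - (Y - l)\<^sup>2)
        = (t\<^sup>2 - 1) * (a * s)\<^sup>2 + b\<^sup>2 * (t\<^sup>2 - 1) * z\<^sup>2 - (t\<^sup>2 - 1) * Y\<^sup>2
          + (l * (t\<^sup>2 - 1))\<^sup>2 - 2 * (l * (t\<^sup>2 - 1)) * (a * s * t - Y)"
        by (simp add: power2_eq_square algebra_simps)
      also have "\<dots> = (t\<^sup>2 - 1) * (a * s)\<^sup>2 + (t\<^sup>2 - a\<^sup>2) * (Y\<^sup>2 - s\<^sup>2) - (t\<^sup>2 - 1) * Y\<^sup>2 - (a * s * t - Y)\<^sup>2"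
        unfolding l b2 sz(4) by (simp add: power2_eq_square algebra_simps)
      also have "\<dots> = - (a * Y - t * s)\<^sup>2"
        by (simp add: power2_eq_square algebra_simps)
      finally show ?thesis .
    qed
    then have "(t\<^sup>2 - 1) * ((a * s - l * t)\<^sup>2 + b\<^sup>2 * z\<^sup>2 - (Y - l)\<^sup>2) \<le> 0"
      by simp
    then have "(a * s - l * t)\<^sup>2 + b\<^sup>2 * z\<^sup>2 - (Y - l)\<^sup>2 \<le> 0"
      using t2 by (simp add: mult_le_0_iff)
    ultimately show ?thesis using that by auto
  next
    case False
    have "s * t \<le> a * s * t" using a(1) sz(1) t mult_right_mono[of 1 a "s * t"] by (simp add: mult.assoc)
    then have "s * t \<le> Y" using False by simp
    then have "(s * t)\<^sup>2 \<le> Y\<^sup>2" using sz(1) t by (intro power_mono) auto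
    then have st: "s\<^sup>2 * (t\<^sup>2 - 1) \<le> z\<^sup>2" unfolding sz(4) by (simp add: power_mult_distrib algebra_simps)
    have "1 - b\<^sup>2 \<ge> 0" using b by (simp add: power_le_one)
    from mult_left_mono[OF st this] have "(1 - b\<^sup>2) * (t\<^sup>2 - 1) * s\<^sup>2 \<le> (1 - b\<^sup>2) * z\<^sup>2"
      by (simp add: mult_ac)
    moreover have "(1 - b\<^sup>2) * (t\<^sup>2 - 1) = a\<^sup>2 - 1" using b2 by (simp add: algebra_simps)
    ultimately have "(a\<^sup>2 - 1) * s\<^sup>2 \<le> (1 - b\<^sup>2) * z\<^sup>2" by simp
    then have "(a * s)\<^sup>2 + b\<^sup>2 * z\<^sup>2 \<le> Y\<^sup>2" unfolding sz(4) by (simp add: power_mult_distrib algebra_simps)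
    then show ?thesis using that[of 0] sz(3) by simp
  qed
qed

context nspc
begin

text \<open>If \<open>v\<close> is a unit vector whose image is shorter than \<open>1/t\<close>, then stretching by \<open>\<alpha>\<close> in
  direction \<open>v\<close> and shrinking by \<open>\<beta>\<close> on its complement stays within the unit ball and, for small
  \<open>\<epsilon>\<close>, increases the volume.\<close>

lemma john:
  assumes b: "indep n b" and t: "0 < t" "real n < t\<^sup>2"
  obtains x where "contr n x" "\<And>k. k < n \<Longrightarrow> \<exists>a. b k = comb n x a"
    "\<And>a. l2 n a \<le> t * nrm X (comb n x a)"
proof (cases "n = 0")
  case True
  obtain x where x: "contr n x" "\<And>k. k < n \<Longrightarrow> \<exists>a. b k = comb n x a"
    by (rule max_volume[OF b, of 1]) simp_all
  moreover have "l2 n a \<le> t * nrm X (comb n x a)" for a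
    using True t nrm_nonneg comb_in[OF contr_fam[OF x(1)]] by simp
  ultimately show thesis by (rule that)
next
  case False
  define \<delta> where "\<delta> = t\<^sup>2 - real n"
  have \<delta>: "\<delta> > 0" using t by (simp add: \<delta>_def)
  have n1: "real n \<ge> 1" using False by simp
  have t2: "t\<^sup>2 - 1 > 0" using n1 t(2) by linarith
  then have "1\<^sup>2 < t\<^sup>2" by simp
  then have t1: "1 < t" using less_imp_le[OF t(1)] by (rule power2_less_imp_less)
  \<comment> \<open>The squared volume factor
    \<open>(1 + \<epsilon> (t^2 - 1)) (1 - \<epsilon>)^(n - 1)\<close> is
    \<open>1 + \<epsilon> \<delta>\<close> to first order; this \<epsilon> keeps the second order
    loss below half of the gain.\<close>
  define \<epsilon> where "\<epsilon> = \<delta> / (2 * t\<^sup>2 * real n)"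
  have \<epsilon>0: "\<epsilon> > 0" using \<delta> t n1 by (simp add: \<epsilon>_def)
  have "\<epsilon> * (2 * t\<^sup>2 * real n) = \<delta>" using t n1 by (simp add: \<epsilon>_def)
  then have e1: "\<epsilon> * (t\<^sup>2 * real n) = \<delta> / 2" by simp
  have "t\<^sup>2 \<le> t\<^sup>2 * real n" using n1 by (simp add: mult_le_cancel_left1)
  then have "\<epsilon> * t\<^sup>2 \<le> \<epsilon> * (t\<^sup>2 * real n)" using \<epsilon>0 by (intro mult_left_mono) auto
  also have "\<dots> = \<delta> / 2" by (rule e1)
  also have "\<dots> < t\<^sup>2 * 1" using \<delta> n1 t by (simp add: \<delta>_def)
  finally have \<epsilon>1: "\<epsilon> < 1" using t by (simp add: mult.commute[of \<epsilon>] mult_less_cancel_left_pos)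
  define \<alpha> where "\<alpha> = sqrt (1 + \<epsilon> * (t\<^sup>2 - 1))"
  define \<beta> where "\<beta> = sqrt (1 - \<epsilon>)"
  have \<alpha>2: "\<alpha>\<^sup>2 = 1 + \<epsilon> * (t\<^sup>2 - 1)" using \<epsilon>0 t2 by (simp add: \<alpha>_def)
  have \<beta>2: "\<beta>\<^sup>2 = 1 - \<epsilon>" using \<epsilon>1 by (simp add: \<beta>_def)
  have ab: "\<alpha>\<^sup>2 + \<beta>\<^sup>2 * (t\<^sup>2 - 1) = t\<^sup>2" unfolding \<alpha>2 \<beta>2 by (simp add: algebra_simps)
  have \<beta>: "0 < \<beta>" "\<beta> \<le> 1" using \<epsilon>0 \<epsilon>1 by (auto simp: \<beta>_def)
  have \<alpha>1: "1 \<le> \<alpha>" using \<epsilon>0 t2 by (simp add: \<alpha>_def)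
  have "\<epsilon> * (t\<^sup>2 - 1) \<le> 1 * (t\<^sup>2 - 1)" using \<epsilon>1 t2 by (intro mult_right_mono) auto
  then have "\<alpha>\<^sup>2 \<le> t\<^sup>2" unfolding \<alpha>2 by simp
  then have \<alpha>t: "\<alpha> \<le> t" using less_imp_le[OF t(1)] by (rule power2_le_imp_le)
  obtain m where m: "n = Suc m" using False by (cases n) auto
  have gain: "1 + \<epsilon> * \<delta> / 2 \<le> (\<alpha> * \<beta> ^ m)\<^sup>2"
  proof -
    have "(\<alpha> * \<beta> ^ m)\<^sup>2 = \<alpha>\<^sup>2 * (\<beta>\<^sup>2) ^ m"
      by (simp add: power_mult_distrib mult.commute flip: power_mult)
    also have "\<dots> = (1 + \<epsilon> * (t\<^sup>2 - 1)) * (1 - \<epsilon>) ^ m" unfolding \<alpha>2 \<beta>2 ..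
    also have "\<dots> \<ge> (1 + \<epsilon> * (t\<^sup>2 - 1)) * (1 - real m * \<epsilon>)"
    proof (rule mult_left_mono)
      show "1 - real m * \<epsilon> \<le> (1 - \<epsilon>) ^ m"
        using Bernoulli_inequality[of "- \<epsilon>" m] \<epsilon>1 by (simp add: algebra_simps)
    qed (use \<epsilon>0 t2 in simp)
    also have "(1 + \<epsilon> * (t\<^sup>2 - 1)) * (1 - real m * \<epsilon>) = 1 + \<epsilon> * \<delta> - \<epsilon> * (\<epsilon> * ((t\<^sup>2 - 1) * real m))"
      by (simp add: \<delta>_def m algebra_simps)
    also have "\<epsilon> * (\<epsilon> * ((t\<^sup>2 - 1) * real m)) \<le> \<epsilon> * (\<delta> / 2)"
      unfolding e1[symmetric] using \<epsilon>0 t2 t by (intro mult_left_mono mult_mono) (auto simp: m)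
    ultimately show ?thesis by simp
  qed
  \<comment> \<open>Small enough for the square of 1 + \<eta>, at most 1 + 3 \<eta>, to stay below
    the gain 1 + \<epsilon> \<delta> / 2.\<close>
  define \<eta> where "\<eta> = min 1 (\<epsilon> * \<delta> / 8)"
  have \<eta>: "\<eta> > 0" "\<eta> \<le> 1" "\<eta> \<le> \<epsilon> * \<delta> / 8" using \<epsilon>0 \<delta> by (auto simp: \<eta>_def)
  obtain x where x: "contr n x" "\<And>k. k < n \<Longrightarrow> \<exists>a. b k = comb n x a"
      "\<And>A. contr n (\<lambda>j. comb n x (\<lambda>i. A i j)) \<Longrightarrow> norm (fdet n A) \<le> 1 + \<eta>"
  proof (rule max_volume[OF b \<eta>(1)])
    fix x
    assume x: "contr n x" "\<And>k. k < n \<Longrightarrow> \<exists>a. b k = comb n x a"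
      "\<And>A. contr n (\<lambda>j. comb n x (\<lambda>i. A i j)) \<Longrightarrow> norm (fdet n A) \<le> 1 + \<eta>"
    show thesis by (rule that[OF x])
  qed
  have fx: "fam n x" using x(1) by (rule contr_fam)
  have unit: "1 / t < nrm X (comb n x v)" if v: "l2 n v = 1" for v
  proof (rule ccontr)
    assume "\<not> 1 / t < nrm X (comb n x v)"
    then have vt: "t * nrm X (comb n x v) \<le> 1" using t(1) by (simp add: field_simps not_less)
    \<comment> \<open>The map is \<alpha> on \<open>v\<close> and \<beta> on its orthogonal
      complement, written so that \<open>fdet_proj\<close> with a single vector gives its
      determinant.\<close>
    define A where "A i j = of_real \<beta> * ((if i = j then 1 else 0) + of_real (\<alpha> / \<beta> - 1) * (\<Sum>l<Suc 0. v i * kcnj (v j)))"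
      for i j
    have "contr n (\<lambda>j. comb n x (\<lambda>i. A i j))"
      unfolding contr_def
    proof (intro conjI allI)
      show "fam n (\<lambda>m. comb n x (\<lambda>i. A i m))" using fx by (auto simp: fam_def intro!: comb_in)
      fix y
      define s where "s = ip n y v"
      define z where "z i = y i - s * v i" for i
      have zv: "ip n z v = 0"
        unfolding z_def ip_diff_left ip_scale_left by (simp add: ip_self v flip: s_def)
      have pyth: "(l2 n (\<lambda>i. p * v i + q * z i))\<^sup>2 = (norm p)\<^sup>2 + (norm q)\<^sup>2 * (l2 n z)\<^sup>2" for p q
      proof -
        have "ip n (\<lambda>i. q * z i) (\<lambda>i. p * v i) = 0" by (simp add: ip_scale_left ip_scale_right zv)
        from pythagoras[OF this] show ?thesis
          by (simp add: l2_scale v power_mult_distrib add.commute)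
      qed
      have "l2 n y = l2 n (\<lambda>i. s * v i + 1 * z i)" by (intro l2_cong) (simp add: z_def)
      then have Y: "(l2 n y)\<^sup>2 = (norm s)\<^sup>2 + (l2 n z)\<^sup>2" using pyth[of s 1] by simp
      obtain l where l: "0 \<le> l" "l \<le> l2 n y" "(\<alpha> * norm s - l * t)\<^sup>2 + \<beta>\<^sup>2 * (l2 n z)\<^sup>2 \<le> (l2 n y - l)\<^sup>2"
        by (rule john_plane[OF ab less_imp_le[OF \<beta>(1)] \<beta>(2) \<alpha>1 \<alpha>t t1 norm_ge_zero L2_set_nonneg L2_set_nonneg Y])
      \<comment> \<open>The phase of \<open>s\<close>, by which the real decomposition of
        \<open>john_plane\<close> is rotated: the part \<open>l t \<sigma> v\<close> has an image of
        norm at most \<open>l\<close>.\<close>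
      obtain \<sigma> where \<sigma>: "norm \<sigma> = 1" "s = \<sigma> * of_real (norm s)"
      proof (cases "s = 0")
        case True
        then show ?thesis using that[of 1] by simp
      next
        case False
        then show ?thesis using that[of "s / of_real (norm s)"] by (simp add: norm_divide)
      qed
      define p where "p = of_real \<alpha> * s - of_real (l * t) * \<sigma>"
      have "comb n (\<lambda>j. comb n x (\<lambda>i. A i j)) y = comb n x (\<lambda>i. \<Sum>j<n. y j * A i j)"
        by (rule comb_comb)
      also have "\<dots> = comb n x (\<lambda>i. (of_real (l * t) * \<sigma>) * v i + (p * v i + of_real \<beta> * z i))"
      proof (intro comb_cong refl)
        fix i assume i: "i < n"
        have "(\<Sum>j<n. y j * A i j) = of_real \<beta> * ((\<Sum>j<n. if i = j then y j else 0)
            + of_real (\<alpha> / \<beta> - 1) * v i * (\<Sum>j<n. y j * kcnj (v j)))"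
          unfolding sum_distrib_left sum.distrib[symmetric]
          by (intro sum.cong) (auto simp: A_def algebra_simps)
        also have "\<dots> = of_real \<beta> * (y i + of_real (\<alpha> / \<beta> - 1) * v i * s)"
          using i by (simp add: s_def ip_def)
        also have "\<dots> = of_real \<beta> * y i + of_real (\<beta> * (\<alpha> / \<beta> - 1)) * v i * s"
          by (simp add: algebra_simps)
        also have "\<beta> * (\<alpha> / \<beta> - 1) = \<alpha> - \<beta>" using \<beta> by (simp add: field_simps)
        finally show "(\<Sum>j<n. y j * A i j) = (of_real (l * t) * \<sigma>) * v i + (p * v i + of_real \<beta> * z i)"
          by (simp add: p_def z_def algebra_simps)
      qed
      finally have eq: "comb n (\<lambda>j. comb n x (\<lambda>i. A i j)) y
          = scl X (of_real (l * t) * \<sigma>) (comb n x v) + comb n x (\<lambda>i. p * v i + of_real \<beta> * z i)"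
        by (simp only: comb_add comb_scale)
      have "nrm X (comb n (\<lambda>j. comb n x (\<lambda>i. A i j)) y)
          \<le> nrm X (scl X (of_real (l * t) * \<sigma>) (comb n x v)) + nrm X (comb n x (\<lambda>i. p * v i + of_real \<beta> * z i))"
        unfolding eq by (intro nrm_add car_scl comb_in fx)
      also have "\<dots> \<le> l + (l2 n y - l)"
      proof (rule add_mono)
        have "nrm X (scl X (of_real (l * t) * \<sigma>) (comb n x v)) = l * (t * nrm X (comb n x v))"
          using l(1) t(1) \<sigma>(1) by (simp add: nrm_scl comb_in fx norm_mult)
        also have "\<dots> \<le> l" using l(1) vt mult_left_mono by fastforce
        finally show "nrm X (scl X (of_real (l * t) * \<sigma>) (comb n x v)) \<le> l" .
      next
        have "p = \<sigma> * of_real (\<alpha> * norm s - l * t)"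
          unfolding p_def by (subst \<sigma>(2)) (simp add: algebra_simps)
        then have np: "(norm p)\<^sup>2 = (\<alpha> * norm s - l * t)\<^sup>2"
          by (simp only: norm_mult \<sigma>(1) norm_of_real mult_1 power2_abs)
        have "(l2 n (\<lambda>i. p * v i + of_real \<beta> * z i))\<^sup>2 \<le> (l2 n y - l)\<^sup>2"
          using l(3) by (simp add: pyth np)
        then have "l2 n (\<lambda>i. p * v i + of_real \<beta> * z i) \<le> l2 n y - l"
          by (rule power2_le_imp_le) (use l(2) in simp)
        then show "nrm X (comb n x (\<lambda>i. p * v i + of_real \<beta> * z i)) \<le> l2 n y - l"
          using x(1) unfolding contr_def by (meson order_trans)
      qed
      finally show "nrm X (comb n (\<lambda>j. comb n x (\<lambda>i. A i j)) y) \<le> l2 n y" by simp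
    qed
    then have "norm (fdet n A) \<le> 1 + \<eta>" by (rule x(3))
    moreover have "osys n (Suc 0) (\<lambda>_. v)" using v by (simp add: osys_def)
    then have "fdet n A = of_real (\<beta> ^ n * (1 + (\<alpha> / \<beta> - 1)))"
      unfolding A_def fdet_scale using v by (subst fdet_proj) simp_all
    then have "fdet n A = of_real (\<alpha> * \<beta> ^ m)" using \<beta> by (simp add: m)
    then have "norm (fdet n A) = \<bar>\<alpha> * \<beta> ^ m\<bar>" by (simp only: norm_of_real)
    then have "norm (fdet n A) = \<alpha> * \<beta> ^ m" using \<alpha>1 \<beta> by simp
    ultimately have "\<alpha> * \<beta> ^ m \<le> 1 + \<eta>" by simp
    then have "(\<alpha> * \<beta> ^ m)\<^sup>2 \<le> (1 + \<eta>)\<^sup>2" using \<alpha>1 \<beta> by (intro power_mono) auto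
    also have "\<dots> = 1 + 2 * \<eta> + \<eta> * \<eta>" by (simp add: power2_eq_square algebra_simps)
    also have "\<eta> * \<eta> \<le> \<eta>" using \<eta> by (simp add: mult_left_le)
    finally show False using gain \<eta> by simp
  qed
  have "l2 n a \<le> t * nrm X (comb n x a)" for a
  proof (cases "l2 n a = 0")
    case True
    then show ?thesis using t(1) nrm_nonneg[OF comb_in[OF fx]] by simp
  next
    case False
    define r where "r = l2 n a"
    have r: "r > 0" using False L2_set_nonneg[of "\<lambda>i. norm (a i)" "{..<n}"] unfolding r_def by linarith
    have "l2 n (\<lambda>i. of_real (1 / r) * a i) = 1"
      unfolding l2_scale using r by (simp add: norm_divide flip: r_def)
    from unit[OF this] show ?thesis
      unfolding comb_scale using r fx t(1) by (simp add: nrm_scl comb_in norm_divide field_simps flip: r_def)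
  qed
  with x(1,2) show thesis by (rule that)
qed

end

section \<open>Finite designs in the plane over the scalar field\<close>

text \<open>Bilinear and not Hermitian: each \<open>w\<close> represents a linear functional of
  \<open>e\<close>, and field isomorphisms carry the form over without reference to
  conjugation.\<close>

definition bl :: "'k \<times> 'k \<Rightarrow> 'k \<times> 'k \<Rightarrow> 'k::real_normed_field" where
  "bl e w = fst e * fst w + snd e * snd w"

text \<open>The last condition says that no orbit is close to a great circle of the projective line: the
  absolute values of the \<open>bl (g j u) v\<close> have quadratic mean \<open>1 / sqrt 2\<close> in the examples below, and their
  arithmetic mean is smaller by a definite amount.\<close>

definition design :: "('k::real_normed_field \<times> 'k) set \<Rightarrow> 'j set \<Rightarrow> ('j \<Rightarrow> 'k \<times> 'k \<Rightarrow> 'k \<times> 'k) \<Rightarrow> bool" where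
  "design W J g \<longleftrightarrow> finite W \<and> (1, 0) \<in> W \<and> (\<forall>w\<in>W. - w \<in> W \<and> norm w \<le> 1) \<and> finite J \<and> J \<noteq> {} \<and>
    (\<forall>j\<in>J. (\<forall>e. norm (g j e) = norm e) \<and>
       (\<exists>\<tau>. bij_betw \<tau> W W \<and> (\<forall>e. \<forall>w\<in>W. bl (g j e) w = bl e (\<tau> w)))) \<and>
    (\<forall>u v. norm u = 1 \<and> norm v = 1 \<longrightarrow> (\<Sum>j\<in>J. norm (bl (g j u) v)) \<le> 137 / 200 * real (card J))"

lemma norm_bl_le: "norm (bl e w) \<le> norm e * norm w"
proof -
  have "norm (bl e w) \<le> norm (fst e) * norm (fst w) + norm (snd e) * norm (snd w)"
    unfolding bl_def using norm_triangle_ineq[of "fst e * fst w" "snd e * snd w"] by (simp add: norm_mult)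
  also have "\<dots> \<le> norm e * norm w"
    using Cauchy_Schwarz_ineq2[of "(norm (fst e), norm (snd e))" "(norm (fst w), norm (snd w))"]
    by (simp add: norm_prod_def inner_Pair)
  finally show ?thesis .
qed

text \<open>A design is described by field operations and norms alone, so one over the real or
  complex numbers passes, coordinate by coordinate, to any isometrically isomorphic scalar
  field.\<close>

lemma design_transport:
  fixes h :: "'f::real_normed_field \<Rightarrow> 'k::real_normed_field" and W :: "('f \<times> 'f) set"
  assumes d: "design W J g"
    and h: "bij h" "\<And>x y. h (x + y) = h x + h y" "\<And>x y. h (x * y) = h x * h y" "\<And>x. norm (h x) = norm x"
  shows "\<exists>W' g'. design (W' :: ('k \<times> 'k) set) J g'"
proof -
  define H where "H = map_prod h h"
  have H: "bij H" unfolding H_def using h(1) by (metis bij_def map_prod_inj_on map_prod_surj UNIV_Times_UNIV)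
  define H' where "H' = inv_into UNIV H"
  have HH': "H (H' x) = x" for x unfolding H'_def using H by (simp add: bij_is_surj surj_f_inv_f)
  have H'H: "H' (H x) = x" for x unfolding H'_def using H by (simp add: bij_is_inj)
  have nH: "norm (H e) = norm e" for e by (simp add: H_def norm_prod_def h(4))
  have nH': "norm (H' e) = norm e" for e using nH[of "H' e"] by (simp add: HH')
  have blH: "bl (H e) (H w) = h (bl e w)" for e w by (simp add: bl_def H_def h(2,3))
  have h0: "h 0 = 0" using h(2)[of 0 0] by simp
  have h1: "h 1 = 1"
  proof -
    have "h 1 \<noteq> 0" using h(4)[of 1] by auto
    then show ?thesis using h(3)[of 1 1] by simp
  qed
  have hm: "h (- x) = - h x" for x
    using h(2)[of x "- x"] h0 by (simp add: eq_neg_iff_add_eq_0 add.commute)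
  have Hm: "H (- w) = - H w" for w by (cases w) (simp add: H_def hm)
  have dn: "norm (g j e) = norm e" if "j \<in> J" for j e
    using d that unfolding design_def by blast
  have ds: "(\<Sum>j\<in>J. norm (bl (g j u) v)) \<le> 137 / 200 * real (card J)" if "norm u = 1" "norm v = 1" for u v
    using d that unfolding design_def by blast
  have "design (H ` W) J (\<lambda>j. H \<circ> g j \<circ> H')"
    unfolding design_def
  proof (intro conjI allI ballI impI)
    show "(1, 0) \<in> H ` W" using d by (auto simp: design_def H_def h0 h1 intro!: image_eqI[of _ _ "(1, 0)"])
    show "- w \<in> H ` W" "norm w \<le> 1" if "w \<in> H ` W" for w
      using that d by (auto simp: design_def nH simp flip: Hm)
    show "norm ((H \<circ> g j \<circ> H') e) = norm e" if "j \<in> J" for j e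
      using dn[OF that] by (simp add: nH nH')
    show "\<exists>\<tau>. bij_betw \<tau> (H ` W) (H ` W) \<and> (\<forall>e. \<forall>w\<in>H ` W. bl ((H \<circ> g j \<circ> H') e) w = bl e (\<tau> w))"
      if j: "j \<in> J" for j
    proof -
      obtain \<tau> where \<tau>: "bij_betw \<tau> W W" "\<And>e w. w \<in> W \<Longrightarrow> bl (g j e) w = bl e (\<tau> w)"
        using d j unfolding design_def by blast
      have b1: "bij_betw H' (H ` W) W"
        by (rule bij_betw_byWitness[of _ H]) (auto simp: HH' H'H)
      have b2: "bij_betw H W (H ` W)"
        by (rule bij_betw_byWitness[of _ H']) (auto simp: HH' H'H)
      have "bij_betw (H \<circ> (\<tau> \<circ> H')) (H ` W) (H ` W)"
        by (intro bij_betw_trans[OF _ b2] bij_betw_trans[OF b1 \<tau>(1)])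
      moreover have "bl ((H \<circ> g j \<circ> H') e) w = bl e ((H \<circ> (\<tau> \<circ> H')) w)" if w: "w \<in> H ` W" for e w
      proof -
        obtain w' where w': "w' \<in> W" "w = H w'" using w by blast
        have "bl ((H \<circ> g j \<circ> H') e) w = h (bl (g j (H' e)) w')" by (simp add: w' blH)
        also have "\<dots> = h (bl (H' e) (\<tau> w'))" using \<tau>(2) w' by simp
        also have "\<dots> = bl (H (H' e)) (H (\<tau> w'))" by (simp add: blH)
        finally show ?thesis by (simp add: HH' H'H w')
      qed
      ultimately show ?thesis by blast
    qed
    show "(\<Sum>j\<in>J. norm (bl ((H \<circ> g j \<circ> H') u) v)) \<le> 137 / 200 * real (card J)"
      if "norm u = 1 \<and> norm v = 1" for u v
    proof -
      have "norm (bl ((H \<circ> g j \<circ> H') u) v) = norm (bl (g j (H' u)) (H' v))" for j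
        using blH[of "g j (H' u)" "H' v"] by (simp add: HH' h(4))
      then show ?thesis using ds[of "H' u" "H' v"] that by (simp add: nH')
    qed
  qed (use d in \<open>auto simp: design_def\<close>)
  then show ?thesis by blast
qed

text \<open>Interpolates \<open>sqrt s\<close> (as a function of \<open>s = x\<^sup>2\<close>) at \<open>s = 1\<close> and doubly at \<open>s = 9/25\<close>.\<close>

lemma quartic_majorant:
  fixes x :: real
  assumes "0 \<le> x" "x \<le> 1"
  shows "x \<le> (99 + 410 * x\<^sup>2 - 125 * (x\<^sup>2)\<^sup>2) / 384"
proof -
  have "0 \<le> (x - 3/5)\<^sup>2 * (1 - x) * (x + 11/5)"
    using assms by simp
  also have "(x - 3/5)\<^sup>2 * (1 - x) * (x + 11/5) = (99 + 410 * x\<^sup>2 - 125 * (x\<^sup>2)\<^sup>2 - 384 * x) / 125"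
    by (simp add: power2_eq_square field_simps)
  finally show ?thesis by simp
qed

text \<open>Here \<open>t j\<close> will be the inner product of two unit vectors on the circle or
  the Bloch sphere. Mean 0 and second moment at least 1/3 turn the quartic bound into (1091 - 125/3)
  / 1536, about 0.6832; the value 137/200 = 0.685 above it is still below
  \<open>1 / sqrt 2\<close>.\<close>

lemma design_sum_le:
  fixes t :: "'j \<Rightarrow> real"
  assumes J: "finite J" and a: "\<And>j. j \<in> J \<Longrightarrow> 0 \<le> a j \<and> a j \<le> 1 \<and> (a j)\<^sup>2 = (1 + t j) / 2"
    and t: "(\<Sum>j\<in>J. t j) = 0" "(\<Sum>j\<in>J. (t j)\<^sup>2) \<ge> real (card J) / 3"
  shows "(\<Sum>j\<in>J. a j) \<le> 137 / 200 * real (card J)"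
proof -
  have "(\<Sum>j\<in>J. a j) \<le> (\<Sum>j\<in>J. (99 + 410 * (a j)\<^sup>2 - 125 * ((a j)\<^sup>2)\<^sup>2) / 384)"
    using a quartic_majorant by (intro sum_mono) auto
  also have "\<dots> = (\<Sum>j\<in>J. (1091 + 570 * t j - 125 * (t j)\<^sup>2) / 1536)"
  proof (intro sum.cong refl)
    fix j assume "j \<in> J"
    then have y: "(a j)\<^sup>2 = (1 + t j) / 2" using a by blast
    show "(99 + 410 * (a j)\<^sup>2 - 125 * ((a j)\<^sup>2)\<^sup>2) / 384 = (1091 + 570 * t j - 125 * (t j)\<^sup>2) / 1536"
      unfolding y by (simp add: power2_eq_square field_simps)
  qed
  also have "\<dots> = (1091 * real (card J) + 570 * (\<Sum>j\<in>J. t j) - 125 * (\<Sum>j\<in>J. (t j)\<^sup>2)) / 1536"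
    by (simp add: sum.distrib sum_subtractf sum_distrib_left flip: sum_divide_distrib)
  also have "\<dots> \<le> 137 / 200 * real (card J)"
    using t by simp
  finally show ?thesis .
qed

subsection \<open>The real case: rotations by multiples of \<open>\<pi>/3\<close>\<close>

definition rot :: "real \<Rightarrow> real \<times> real \<Rightarrow> real \<times> real" where
  "rot \<sigma> e = (fst e / 2 - \<sigma> * (sqrt 3 / 2) * snd e, \<sigma> * (sqrt 3 / 2) * fst e + snd e / 2)"

definition hexagon :: "(real \<times> real) set" where
  "hexagon = {(1, 0), (-1, 0), (1/2, sqrt 3 / 2), (1/2, - sqrt 3 / 2), (-1/2, sqrt 3 / 2), (-1/2, - sqrt 3 / 2)}"

lemma sqrt3: "sqrt 3 * (sqrt 3 * x) = 3 * x"
  by (simp flip: mult.assoc)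

lemma rot_inverse: "rot (-1) (rot 1 e) = e" "rot 1 (rot (-1) e) = e"
  by (cases e; simp add: rot_def field_simps sqrt3)+

lemma bij_betw_self_finite:
  assumes "finite A" "inj f" "\<And>x. x \<in> A \<Longrightarrow> f x \<in> A"
  shows "bij_betw f A A"
proof -
  have inj: "inj_on f A" using assms(2) by (rule inj_on_subset) simp
  moreover have "f ` A = A" using assms inj by (intro endo_inj_surj) auto
  ultimately show ?thesis by (simp add: bij_betw_def)
qed

lemma rot_hexagon: "w \<in> hexagon \<Longrightarrow> rot (-1) w \<in> hexagon"
  unfolding hexagon_def insert_iff empty_iff
  by (elim disjE) (simp_all add: rot_def)

lemma bij_rot_hexagon: "bij_betw (rot (-1)) hexagon hexagon"
  by (rule bij_betw_self_finite) (auto simp: rot_hexagon intro: inj_on_inverseI[of _ "rot 1"] rot_inverse, simp add: hexagon_def)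

lemma bl_rot: "bl (rot 1 e) w = bl e (rot (-1) w)"
  by (simp add: bl_def rot_def field_simps)

lemma norm_rot: "norm (rot 1 e) = norm e"
proof -
  have "(fst (rot 1 e))\<^sup>2 + (snd (rot 1 e))\<^sup>2 = (fst e)\<^sup>2 + (snd e)\<^sup>2"
    by (simp add: rot_def power2_eq_square field_simps sqrt3)
  then show ?thesis by (simp add: norm_prod_def)
qed

text \<open>Opposite vectors give the same absolute value, so three of the six rotations suffice. In
  the double angle coordinates \<open>X\<close>, \<open>Z\<close> they become rotations by multiples
  of 2\<pi>/3, whose orbits are balanced triangles with mean 0 and second moment 1/2. The dummy
  index gives the same index type as in the complex case.\<close>

lemma design_real: "design hexagon ({..<3} \<times> {..<1::nat}) (\<lambda>(k, l). rot 1 ^^ k)"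
  unfolding design_def
proof (intro conjI ballI allI impI)
  fix w assume w: "w \<in> hexagon"
  then show "- w \<in> hexagon" by (auto simp: hexagon_def)
  show "norm w \<le> 1"
    using w by (auto simp: hexagon_def norm_Pair power_divide)
next
  fix j :: "nat \<times> nat" assume j: "j \<in> {..<3} \<times> {..<1}"
  obtain k where k: "j = (k, 0)" using j by auto
  show "norm ((case j of (k, l) \<Rightarrow> rot 1 ^^ k) e) = norm e" for e
    unfolding k prod.case by (induction k) (simp_all add: norm_rot)
  have "bij_betw (rot (-1) ^^ k) hexagon hexagon \<and> (\<forall>e. \<forall>w\<in>hexagon. bl ((rot 1 ^^ k) e) w = bl e ((rot (-1) ^^ k) w))"
  proof (induction k)
    case (Suc k)
    have "bl ((rot 1 ^^ Suc k) e) w = bl e ((rot (-1) ^^ Suc k) w)" if "w \<in> hexagon" for e w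
    proof -
      have "bl ((rot 1 ^^ Suc k) e) w = bl ((rot 1 ^^ k) (rot 1 e)) w" by (simp add: funpow_swap1)
      also have "\<dots> = bl (rot 1 e) ((rot (-1) ^^ k) w)" using Suc that by blast
      finally show ?thesis by (simp add: bl_rot)
    qed
    moreover have "bij_betw (rot (-1) ^^ Suc k) hexagon hexagon"
    proof -
      from Suc have "bij_betw (rot (-1) ^^ k) hexagon hexagon" by blast
      from bij_betw_trans[OF this bij_rot_hexagon] show ?thesis by simp
    qed
    ultimately show ?case by blast
  qed (simp add: bij_betw_id[unfolded id_def])
  then show "\<exists>\<tau>. bij_betw \<tau> hexagon hexagon \<and>
      (\<forall>e. \<forall>w\<in>hexagon. bl ((case j of (k, l) \<Rightarrow> rot 1 ^^ k) e) w = bl e (\<tau> w))"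
    unfolding k prod.case by blast
next
  fix u v :: "real \<times> real" assume uv: "norm u = 1 \<and> norm v = 1"
  define X where "X u = 2 * fst u * snd u" for u :: "real \<times> real"
  define Z where "Z u = (fst u)\<^sup>2 - (snd u)\<^sup>2" for u :: "real \<times> real"
  have sq: "(fst w)\<^sup>2 + (snd w)\<^sup>2 = 1" if "norm w = 1" for w :: "real \<times> real"
    using that by (simp add: norm_prod_def)
  have X: "X (rot 1 e) = - X e / 2 + sqrt 3 / 2 * Z e" and Z: "Z (rot 1 e) = - Z e / 2 - sqrt 3 / 2 * X e" for e
    by (simp_all add: X_def Z_def rot_def power2_eq_square field_simps sqrt3)
  define t where "t j = (case j of (k, l) \<Rightarrow> X ((rot 1 ^^ k) u) * X v + Z ((rot 1 ^^ k) u) * Z v)" for j :: "nat \<times> nat"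
  have XZ: "(X e)\<^sup>2 + (Z e)\<^sup>2 = 1" if "norm e = 1" for e
  proof -
    have "(X e)\<^sup>2 + (Z e)\<^sup>2 = ((fst e)\<^sup>2 + (snd e)\<^sup>2)\<^sup>2"
      by (simp add: X_def Z_def power2_eq_square algebra_simps)
    then show ?thesis using sq[OF that] by simp
  qed
  have S: "(\<Sum>j\<in>{..<3} \<times> {..<1::nat}. f j) = f (0, 0) + f (1, 0) + f (2, 0)" for f :: "nat \<times> nat \<Rightarrow> real"
    by (simp add: sum.cartesian_product' numeral_3_eq_3 numeral_2_eq_2)
  have Xk: "X ((rot 1 ^^ 1) u) = - X u / 2 + sqrt 3 / 2 * Z u" "Z ((rot 1 ^^ 1) u) = - Z u / 2 - sqrt 3 / 2 * X u"
    "X ((rot 1 ^^ 2) u) = - X u / 2 - sqrt 3 / 2 * Z u" "Z ((rot 1 ^^ 2) u) = - Z u / 2 + sqrt 3 / 2 * X u"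
    by (simp_all add: X Z numeral_2_eq_2 field_simps sqrt3)
  have t: "t (0, 0) = X u * X v + Z u * Z v"
    "t (1, 0) = - (X u * X v + Z u * Z v) / 2 + sqrt 3 / 2 * (Z u * X v - X u * Z v)"
    "t (2, 0) = - (X u * X v + Z u * Z v) / 2 - sqrt 3 / 2 * (Z u * X v - X u * Z v)"
    unfolding t_def prod.case Xk by (simp_all add: field_simps)
  show "(\<Sum>j\<in>{..<3} \<times> {..<1::nat}. norm (bl ((case j of (k, l) \<Rightarrow> rot 1 ^^ k) u) v))
      \<le> 137 / 200 * real (card ({..<3::nat} \<times> {..<1::nat}))"
  proof (rule design_sum_le[of "{..<3} \<times> {..<1}" _ t])
    show "finite ({..<3::nat} \<times> {..<1::nat})" by simp
  next
    fix j :: "nat \<times> nat" assume j: "j \<in> {..<3} \<times> {..<1}"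
    obtain k where k: "j = (k, 0)" using j by auto
    define e where "e = (rot 1 ^^ k) u"
    have ne: "norm e = 1" unfolding e_def using uv by (induction k) (simp_all add: norm_rot)
    have "2 * (bl e v)\<^sup>2 = ((fst e)\<^sup>2 + (snd e)\<^sup>2) * ((fst v)\<^sup>2 + (snd v)\<^sup>2) + X e * X v + Z e * Z v"
      by (simp add: bl_def X_def Z_def power2_eq_square algebra_simps)
    then have "(bl e v)\<^sup>2 = (1 + t j) / 2"
      using sq ne uv by (simp add: t_def k flip: e_def)
    moreover have "norm (bl e v) \<le> 1" using norm_bl_le[of e v] ne uv by simp
    ultimately show "0 \<le> norm (bl ((case j of (k, l) \<Rightarrow> rot 1 ^^ k) u) v) \<and>
        norm (bl ((case j of (k, l) \<Rightarrow> rot 1 ^^ k) u) v) \<le> 1 \<and>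
        (norm (bl ((case j of (k, l) \<Rightarrow> rot 1 ^^ k) u) v))\<^sup>2 = (1 + t j) / 2"
      by (simp add: k flip: e_def)
  next
    show "(\<Sum>j\<in>{..<3} \<times> {..<1}. t j) = 0" unfolding S t by (simp add: field_simps)
    have *: "a\<^sup>2 + (- a / 2 + sqrt 3 / 2 * b)\<^sup>2 + (- a / 2 - sqrt 3 / 2 * b)\<^sup>2 = 3 / 2 * (a\<^sup>2 + b\<^sup>2)" for a b
      by (simp add: power2_eq_square field_simps sqrt3)
    have "(X u * X v + Z u * Z v)\<^sup>2 + (Z u * X v - X u * Z v)\<^sup>2 = ((X u)\<^sup>2 + (Z u)\<^sup>2) * ((X v)\<^sup>2 + (Z v)\<^sup>2)"
      by (simp add: power2_eq_square algebra_simps)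
    then show "real (card ({..<3::nat} \<times> {..<1::nat})) / 3 \<le> (\<Sum>j\<in>{..<3} \<times> {..<1}. (t j)\<^sup>2)"
      unfolding S t * using XZ uv by simp
  qed
qed (auto simp: hexagon_def lessThan_empty_iff)

subsection \<open>The complex case: the Hurwitz units\<close>

text \<open>Quaternions act on pairs of complex numbers. The binary tetrahedral group is generated by
  \<open>\<i>\<close>, \<open>\<j>\<close> and \<open>(-1 + \<i> + \<j> + \<k>)/2\<close>, which permutes the coordinate axes of the Bloch sphere
  cyclically.\<close>

definition qi :: "complex \<times> complex \<Rightarrow> complex \<times> complex" where
  "qi e = (\<i> * fst e, - \<i> * snd e)"

definition qj :: "complex \<times> complex \<Rightarrow> complex \<times> complex" where
  "qj e = (- snd e, fst e)"

definition qw :: "complex \<times> complex \<Rightarrow> complex \<times> complex" where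
  "qw e = (Complex (-1/2) (1/2) * fst e - Complex (1/2) (-1/2) * snd e,
           Complex (1/2) (1/2) * fst e + Complex (-1/2) (-1/2) * snd e)"

text \<open>The transpose of \<open>qj\<close> with respect to \<open>bl\<close>; \<open>qw'\<close>
  is that of \<open>qw\<close>, while the diagonal map \<open>qi\<close> is its own.\<close>

definition qj' :: "complex \<times> complex \<Rightarrow> complex \<times> complex" where
  "qj' e = (snd e, - fst e)"

definition qw' :: "complex \<times> complex \<Rightarrow> complex \<times> complex" where
  "qw' e = (Complex (-1/2) (1/2) * fst e + Complex (1/2) (1/2) * snd e,
            - Complex (1/2) (-1/2) * fst e + Complex (-1/2) (-1/2) * snd e)"

definition is_unit :: "real \<Rightarrow> bool" where "is_unit a \<longleftrightarrow> a = 1 \<or> a = - 1"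
definition is_half :: "real \<Rightarrow> bool" where "is_half a \<longleftrightarrow> a = 1 / 2 \<or> a = - 1 / 2"

lemma is_unit_minus: "is_unit (- a) \<longleftrightarrow> is_unit a" and is_half_minus: "is_half (- a) \<longleftrightarrow> is_half a"
  by (auto simp: is_unit_def is_half_def)

definition hurwitz_coords :: "(real \<times> real \<times> real \<times> real) set" where
  "hurwitz_coords = {(a, b, c, d).
     is_unit a \<and> b = 0 \<and> c = 0 \<and> d = 0 \<or> a = 0 \<and> is_unit b \<and> c = 0 \<and> d = 0 \<or>
     a = 0 \<and> b = 0 \<and> is_unit c \<and> d = 0 \<or> a = 0 \<and> b = 0 \<and> c = 0 \<and> is_unit d \<or>
     is_half a \<and> is_half b \<and> is_half c \<and> is_half d}"

lemma finite_hurwitz_coords: "finite hurwitz_coords"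
proof (rule finite_subset)
  let ?S = "{0, 1, -1, 1/2, -1/2} :: real set"
  show "hurwitz_coords \<subseteq> ?S \<times> ?S \<times> ?S \<times> ?S"
    unfolding hurwitz_coords_def is_unit_def is_half_def by blast
qed simp

definition hurwitz :: "(complex \<times> complex) set" where
  "hurwitz = (\<lambda>(a, b, c, d). (Complex a b, Complex c d)) ` hurwitz_coords"

lemma finite_hurwitz: "finite hurwitz"
  by (simp add: hurwitz_def finite_hurwitz_coords)

lemma hurwitz_closed:
  assumes w: "w \<in> hurwitz"
  shows "qi w \<in> hurwitz" "qj' w \<in> hurwitz" "qw' w \<in> hurwitz" "- w \<in> hurwitz" "norm w \<le> 1"
proof -
  note Q_def = hurwitz_coords_def
  have H: "(x, y) \<in> hurwitz" if "(a, b, c, d) \<in> hurwitz_coords" "x = Complex a b" "y = Complex c d" for x y a b c d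
    unfolding hurwitz_def using that by (intro image_eqI[of _ _ "(a, b, c, d)"]) simp_all
  obtain q where q: "w = (\<lambda>(a, b, c, d). (Complex a b, Complex c d)) q" "q \<in> hurwitz_coords"
    using w unfolding hurwitz_def by blast
  obtain a b c d where "q = (a, b, c, d)" by (cases q)
  with q have abcd: "w = (Complex a b, Complex c d)" "(a, b, c, d) \<in> hurwitz_coords" by simp_all
  have m: "(- b, a, d, - c) \<in> hurwitz_coords" "(c, d, - a, - b) \<in> hurwitz_coords" "(- a, - b, - c, - d) \<in> hurwitz_coords"
    using abcd(2) unfolding Q_def mem_Collect_eq prod.case is_unit_minus is_half_minus neg_equal_0_iff_equal by blast+
  show "qi w \<in> hurwitz" unfolding qi_def by (rule H[OF m(1)]) (simp_all add: abcd(1) complex_eq_iff)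
  show "qj' w \<in> hurwitz" unfolding qj'_def by (rule H[OF m(2)]) (simp_all add: abcd(1) complex_eq_iff)
  show "- w \<in> hurwitz" unfolding abcd(1) uminus_prod_def fst_conv snd_conv
    by (rule H[OF m(3)]) (simp_all add: complex_eq_iff)
  have "((- a - b + c - d) / 2, (a - b + c + d) / 2, (- a - b - c + d) / 2, (a - b - c - d) / 2) \<in> hurwitz_coords"
    using abcd(2) unfolding Q_def mem_Collect_eq prod.case is_unit_def is_half_def
    by (elim disjE conjE; hypsubst; simp)
  then show "qw' w \<in> hurwitz"
    unfolding qw'_def by (rule H) (simp_all add: abcd(1) complex_eq_iff field_simps)
  have sq: "is_unit x \<Longrightarrow> x * x = 1" "is_half x \<Longrightarrow> x * x = 1 / 4" for x
    unfolding is_unit_def is_half_def by (elim disjE; hypsubst; simp)+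
  have "a * a + b * b + (c * c + d * d) = 1"
    using abcd(2) unfolding Q_def mem_Collect_eq prod.case by (elim disjE conjE) (simp_all add: sq)
  then show "norm w \<le> 1" unfolding abcd(1) norm_Pair cmod_power2 by (simp add: power2_eq_square)
qed

lemma quaternion_bij:
  "bij_betw qi hurwitz hurwitz" "bij_betw qj' hurwitz hurwitz" "bij_betw qw' hurwitz hurwitz"
proof -
  have "inj qi" "inj qj'" by (auto intro!: injI simp: qi_def qj'_def prod_eq_iff)
  moreover have "inj qw'"
  proof (rule inj_on_inverseI)
    show "(\<lambda>e. (Complex (-1/2) (-1/2) * fst e - Complex (1/2) (1/2) * snd e,
        Complex (1/2) (-1/2) * fst e + Complex (-1/2) (1/2) * snd e)) (qw' e) = e" for e
      by (cases e) (simp add: qw'_def complex_eq_iff field_simps)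
  qed
  ultimately show "bij_betw qi hurwitz hurwitz" "bij_betw qj' hurwitz hurwitz" "bij_betw qw' hurwitz hurwitz"
    using bij_betw_self_finite[OF finite_hurwitz] hurwitz_closed by blast+
qed

lemma quaternion_transpose:
  "bl (qi e) w = bl e (qi w)" "bl (qj e) w = bl e (qj' w)" "bl (qw e) w = bl e (qw' w)"
  by (simp_all add: bl_def qi_def qj_def qj'_def qw_def qw'_def algebra_simps)

text \<open>With \<open>bY\<close> and \<open>bz\<close>, the Hopf map from the unit sphere onto the
  Bloch sphere in three real dimensions; it identifies vectors that differ by a phase.\<close>

definition bx :: "complex \<times> complex \<Rightarrow> real" where "bx e = 2 * Re (fst e * cnj (snd e))"
definition bY :: "complex \<times> complex \<Rightarrow> real" where "bY e = 2 * Im (fst e * cnj (snd e))"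
definition bz :: "complex \<times> complex \<Rightarrow> real" where "bz e = (cmod (fst e))\<^sup>2 - (cmod (snd e))\<^sup>2"

lemma quaternion_bloch:
  "bx (qi e) = - bx e" "bY (qi e) = - bY e" "bz (qi e) = bz e"
  "bx (qj e) = - bx e" "bY (qj e) = bY e" "bz (qj e) = - bz e"
  "bx (qw e) = bY e" "bY (qw e) = bz e" "bz (qw e) = bx e"
  unfolding bx_def bY_def bz_def qi_def qj_def qw_def fst_conv snd_conv cmod_power2
  by (simp_all add: power2_eq_square field_simps)

lemma norm_quaternion: "norm (qi e) = norm e" "norm (qj e) = norm e" "norm (qw e) = norm e"
proof -
  show "norm (qi e) = norm e" "norm (qj e) = norm e"
    by (simp_all add: norm_prod_def qi_def qj_def norm_mult add.commute)
  have "(cmod (fst (qw e)))\<^sup>2 + (cmod (snd (qw e)))\<^sup>2 = (cmod (fst e))\<^sup>2 + (cmod (snd e))\<^sup>2"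
    unfolding cmod_power2 qw_def fst_conv snd_conv by (simp add: power2_eq_square field_simps)
  then show "norm (qw e) = norm e" by (simp add: norm_prod_def)
qed

text \<open>Squared overlaps are affine in the Bloch coordinates. The minus sign stems from the
  missing conjugation in \<open>bl\<close>: conjugating \<open>v\<close> reflects the coordinate
  \<open>bY\<close>.\<close>

lemma bloch_bl:
  assumes "norm e = 1" "norm v = 1"
  shows "(cmod (bl e v))\<^sup>2 = (1 + (bx e * bx v - bY e * bY v + bz e * bz v)) / 2"
proof -
  have "2 * (cmod (bl e v))\<^sup>2 = ((cmod (fst e))\<^sup>2 + (cmod (snd e))\<^sup>2) * ((cmod (fst v))\<^sup>2 + (cmod (snd v))\<^sup>2)
      + (bx e * bx v - bY e * bY v + bz e * bz v)"
    unfolding bl_def bx_def bY_def bz_def cmod_power2 by (simp add: power2_eq_square algebra_simps)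
  then show ?thesis using assms by (simp add: norm_prod_def)
qed

lemma bloch_sphere: "norm e = 1 \<Longrightarrow> (bx e)\<^sup>2 + (bY e)\<^sup>2 + (bz e)\<^sup>2 = 1"
proof -
  assume "norm e = 1"
  moreover have "(bx e)\<^sup>2 + (bY e)\<^sup>2 + (bz e)\<^sup>2 = ((cmod (fst e))\<^sup>2 + (cmod (snd e))\<^sup>2)\<^sup>2"
    unfolding bx_def bY_def bz_def cmod_power2 by (simp add: power2_eq_square algebra_simps)
  ultimately show ?thesis by (simp add: norm_prod_def)
qed

text \<open>Twelve representatives of the binary tetrahedral group modulo sign: the four classes of
  the quaternion group times the three powers of \<open>qw\<close>.\<close>

definition qg :: "nat \<times> nat \<Rightarrow> complex \<times> complex \<Rightarrow> complex \<times> complex" where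
  "qg = (\<lambda>(k, l). [id, qi, qj, qi \<circ> qj] ! k \<circ> [id, qw, qw \<circ> qw] ! l)"

lemma less_4_cases: "(k::nat) < 4 \<longleftrightarrow> k = 0 \<or> k = 1 \<or> k = 2 \<or> k = 3"
  and less_3_cases: "k < 3 \<longleftrightarrow> k = 0 \<or> k = 1 \<or> k = 2"
  by auto

lemma design_complex: "design hurwitz ({..<4} \<times> {..<3}) qg"
proof -
  define ok where "ok g \<longleftrightarrow> (\<forall>e. norm (g e) = norm e) \<and>
       (\<exists>\<tau>. bij_betw \<tau> hurwitz hurwitz \<and> (\<forall>e. \<forall>w\<in>hurwitz. bl (g e) w = bl e (\<tau> w)))" for g
  have ok_comp: "ok (g \<circ> g')" if g: "ok g" "ok g'" for g g'
  proof -
    obtain \<tau> \<tau>' where t: "bij_betw \<tau> hurwitz hurwitz" "\<And>e w. w \<in> hurwitz \<Longrightarrow> bl (g e) w = bl e (\<tau> w)"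
        "bij_betw \<tau>' hurwitz hurwitz" "\<And>e w. w \<in> hurwitz \<Longrightarrow> bl (g' e) w = bl e (\<tau>' w)"
      using g unfolding ok_def by metis
    have "\<tau> w \<in> hurwitz" if "w \<in> hurwitz" for w using t(1) that by (auto simp: bij_betw_def)
    then have "bl ((g \<circ> g') e) w = bl e ((\<tau>' \<circ> \<tau>) w)" if "w \<in> hurwitz" for e w
      using t that by simp
    moreover have "bij_betw (\<tau>' \<circ> \<tau>) hurwitz hurwitz" using t(1,3) by (rule bij_betw_trans)
    ultimately have "\<exists>\<tau>. bij_betw \<tau> hurwitz hurwitz \<and> (\<forall>e. \<forall>w\<in>hurwitz. bl ((g \<circ> g') e) w = bl e (\<tau> w))"
      by blast
    moreover have "norm ((g \<circ> g') e) = norm e" for e using g unfolding ok_def by (metis comp_apply)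
    ultimately show ?thesis unfolding ok_def by blast
  qed
  have ok1: "ok id" unfolding ok_def by (auto intro!: exI[of _ id])
  have ok3: "ok qi" "ok qj" "ok qw"
    unfolding ok_def using quaternion_bij quaternion_transpose norm_quaternion by blast+
  have okg: "ok (qg j)" if "j \<in> {..<4} \<times> {..<3}" for j
    using that ok1 ok3 ok_comp by (auto simp: qg_def less_4_cases less_3_cases)
  have "(\<Sum>j\<in>{..<4} \<times> {..<3}. cmod (bl (qg j u) v)) \<le> 137 / 200 * real (card ({..<4::nat} \<times> {..<3::nat}))"
    if uv: "norm u = 1" "norm v = 1" for u v
  proof (rule design_sum_le)
    fix j assume j: "j \<in> {..<4::nat} \<times> {..<3::nat}"
    have "norm (qg j e) = norm e" for e using okg[OF j] unfolding ok_def by blast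
    then have "norm (qg j u) = 1" using uv by simp
    then show "0 \<le> cmod (bl (qg j u) v) \<and> cmod (bl (qg j u) v) \<le> 1 \<and>
        (cmod (bl (qg j u) v))\<^sup>2 = (1 + (bx (qg j u) * bx v - bY (qg j u) * bY v + bz (qg j u) * bz v)) / 2"
      using norm_bl_le[of "qg j u" v] uv by (simp add: bloch_bl)
  next
    have S: "(\<Sum>j\<in>{..<4::nat} \<times> {..<3::nat}. f j) = (\<Sum>k<4. \<Sum>l<3. f (k, l))" for f :: "nat \<times> nat \<Rightarrow> real"
      by (simp add: sum.cartesian_product)
    have S4: "(\<Sum>k<4. f k) = f 0 + f 1 + f 2 + f 3" and S3: "(\<Sum>k<3. f k) = f 0 + f 1 + f 2" for f :: "nat \<Rightarrow> real"
      by (simp_all add: numeral_3_eq_3 numeral_2_eq_2 eval_nat_numeral)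
    show "(\<Sum>j\<in>{..<4} \<times> {..<3}. bx (qg j u) * bx v - bY (qg j u) * bY v + bz (qg j u) * bz v) = 0"
      unfolding S S4 S3 by (simp add: qg_def quaternion_bloch)
    \<comment> \<open>The sign changes cancel all mixed products and the cyclic permutations spread
      the squares evenly, so the second moment is exactly 1/3.\<close>
    have "(\<Sum>j\<in>{..<4} \<times> {..<3}. (bx (qg j u) * bx v - bY (qg j u) * bY v + bz (qg j u) * bz v)\<^sup>2)
        = 4 * (((bx u)\<^sup>2 + (bY u)\<^sup>2 + (bz u)\<^sup>2) * ((bx v)\<^sup>2 + (bY v)\<^sup>2 + (bz v)\<^sup>2))"
      unfolding S S4 S3 by (simp add: qg_def quaternion_bloch power2_eq_square algebra_simps)
    then show "real (card ({..<4::nat} \<times> {..<3::nat})) / 3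
        \<le> (\<Sum>j\<in>{..<4} \<times> {..<3}. (bx (qg j u) * bx v - bY (qg j u) * bY v + bz (qg j u) * bz v)\<^sup>2)"
      using uv by (simp add: bloch_sphere)
  qed simp
  moreover have "(1, 0) \<in> hurwitz"
    unfolding hurwitz_def
    by (rule image_eqI[of _ _ "(1, 0, 0, 0)"]) (simp_all add: complex_eq_iff hurwitz_coords_def is_unit_def)
  moreover have "{..<4::nat} \<times> {..<3::nat} \<noteq> {}" by (auto simp: lessThan_empty_iff)
  ultimately show ?thesis
    unfolding design_def using finite_hurwitz hurwitz_closed(4,5) okg[unfolded ok_def]
    by (intro conjI ballI allI impI finite_cartesian_product finite_lessThan) blast+
qed

lemma design_exists:
  obtains W J g where "design (W :: ('k::real_or_complex \<times> 'k) set) (J :: (nat \<times> nat) set) g"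
proof (rule real_or_complex_cases[where 'k='k])
  assume r: "\<And>x::'k. \<exists>a. x = of_real a"
  have "bij (of_real :: real \<Rightarrow> 'k)"
    using r by (auto intro!: bijI injI simp: surj_def)
  from design_transport[OF design_real this] show thesis using that by auto
next
  fix i :: 'k
  assume i: "i * i = - 1" "\<And>x::'k. \<exists>a b. x = of_real a + of_real b * i"
      "\<And>a b. norm (of_real a + of_real b * i) = sqrt (a\<^sup>2 + b\<^sup>2)"
  define h where "h z = of_real (Re z) + of_real (Im z) * i" for z
  have nh: "norm (h z) = norm z" for z by (simp add: h_def i(3) cmod_def)
  have hadd: "h (x + y) = h x + h y" for x y by (simp add: h_def algebra_simps)
  have ii: "i * (i * z) = - z" for z by (simp add: i(1) flip: mult.assoc)
  have hmult: "h (x * y) = h x * h y" for x y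
    by (simp add: h_def algebra_simps ii)
  have "inj h"
  proof (rule injI)
    fix x y assume "h x = h y"
    moreover have "h (x - y) + h y = h x" by (simp flip: hadd)
    ultimately have "h (x - y) = 0" by simp
    then show "x = y" using nh[of "x - y"] by simp
  qed
  moreover have "surj h"
  proof (rule surjI)
    fix x :: 'k
    show "h (SOME z. h z = x) = x"
    proof (rule someI_ex)
      obtain a b where "x = of_real a + of_real b * i" using i(2) by blast
      then have "h (Complex a b) = x" by (simp add: h_def)
      then show "\<exists>z. h z = x" by blast
    qed
  qed
  ultimately have "bij h" by (simp add: bij_def)
  from design_transport[OF design_complex this hadd hmult nh] show thesis using that by blast
qed

section \<open>Random two-dimensional sections\<close>

context nspc
begin

lemma lin_add: "lin f \<Longrightarrow> x \<in> car X \<Longrightarrow> y \<in> car X \<Longrightarrow> f (x + y) = f x + f y"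
  and lin_scl: "lin f \<Longrightarrow> x \<in> car X \<Longrightarrow> f (scl X c x) = c * f x"
  by (auto simp: lin_def)

lemma lin_0: "lin f \<Longrightarrow> f 0 = 0"
  using lin_scl[of f 0 0] by simp

lemma lin_diff: "lin f \<Longrightarrow> x \<in> car X \<Longrightarrow> y \<in> car X \<Longrightarrow> f (x - y) = f x - f y"
  using lin_add[of f "x - y" y] by (simp add: car_diff)

lemma lin_sum: "lin f \<Longrightarrow> (\<And>i. i \<in> A \<Longrightarrow> x i \<in> car X) \<Longrightarrow> f (\<Sum>i\<in>A. x i) = (\<Sum>i\<in>A. f (x i))"
  by (induction A rule: infinite_finite_induct) (auto simp: lin_0 lin_add car_sum)

lemma lin_comb: "lin f \<Longrightarrow> fam n x \<Longrightarrow> f (comb n x a) = (\<Sum>i<n. a i * f (x i))"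
  unfolding comb_def by (subst lin_sum) (auto simp: fam_def lin_scl car_scl)

text \<open>Evaluating \<open>f\<close> at the combination with coefficients
  \<open>kcnj (f (y i))\<close> gives the sum of squares, which is therefore at most
  \<open>t\<close> times its own square root.\<close>

lemma contr_weak_l2:
  assumes y: "contr n y" and f: "lin f" "\<And>x. x \<in> car X \<Longrightarrow> norm (f x) \<le> t * nrm X x" and t: "0 \<le> t"
  shows "l2 n (\<lambda>i. f (y i)) \<le> t"
proof -
  have fy: "fam n y" using y by (rule contr_fam)
  define S where "S = l2 n (\<lambda>i. f (y i))"
  have S0: "S \<ge> 0" by (simp add: S_def)
  have "f (comb n y (\<lambda>i. kcnj (f (y i)))) = of_real (S\<^sup>2)"
    by (simp add: lin_comb f fy S_def l2_sq mult.commute[of "kcnj _"] mult_kcnj)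
  then have "norm (f (comb n y (\<lambda>i. kcnj (f (y i))))) = \<bar>S\<^sup>2\<bar>"
    by (simp only: norm_of_real)
  then have "S\<^sup>2 = norm (f (comb n y (\<lambda>i. kcnj (f (y i)))))"
    by simp
  also have "\<dots> \<le> t * nrm X (comb n y (\<lambda>i. kcnj (f (y i))))"
    by (intro f comb_in fy)
  also have "\<dots> \<le> t * l2 n (\<lambda>i. kcnj (f (y i)))"
    using y t unfolding contr_def by (intro mult_left_mono) blast+
  also have "\<dots> = t * S" by (simp add: S_def)
  finally have "S * S \<le> t * S" by (simp add: power2_eq_square)
  then show ?thesis
    using S0 t mult_le_cancel_right[of S S t] unfolding S_def[symmetric] by linarith
qed

end

locale random_section = nspc X for X :: "('k::real_or_complex, 'x::ab_group_add) nspace" +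
  fixes W :: "('k \<times> 'k) set" and y :: "nat \<Rightarrow> 'x" and N m :: nat
  assumes finW: "finite W" and unitW: "(1, 0) \<in> W" and symW: "\<And>w. w \<in> W \<Longrightarrow> - w \<in> W"
    and normW: "\<And>w. w \<in> W \<Longrightarrow> norm w \<le> 1" and y: "contr N y" and m: "0 < m"
begin

abbreviation I where "I \<equiv> {..<N} \<times> {..<m}"
abbreviation \<Omega> where "\<Omega> \<equiv> PiE I (\<lambda>_. W)"

text \<open>\<open>m\<close> copies of each \<open>y i\<close>, shrunk by \<open>1 / sqrt m\<close>.
  The sum of the squares of a functional is the same as for \<open>y\<close>, yet if the random
  functionals attached to all copies of \<open>y i\<close> agree, together they contribute
  \<open>sqrt m\<close> times \<open>y i\<close>.\<close>

definition z :: "nat \<times> nat \<Rightarrow> 'x" where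
  "z p = scl X (of_real (1 / sqrt (real m))) (y (fst p))"

definition Z :: "'k \<times> 'k \<Rightarrow> (nat \<times> nat \<Rightarrow> 'k \<times> 'k) \<Rightarrow> 'x" where
  "Z e w = (\<Sum>p\<in>I. scl X (bl e (w p)) (z p))"

definition F :: "'k \<times> 'k \<Rightarrow> (nat \<times> nat \<Rightarrow> 'k \<times> 'k) \<Rightarrow> real" where
  "F e w = nrm X (Z e w)"

definition M :: "'k \<times> 'k \<Rightarrow> real" where
  "M e = (\<Sum>w\<in>\<Omega>. F e w) / real (card \<Omega>)"

lemma z_in: "p \<in> I \<Longrightarrow> z p \<in> car X"
  using y by (auto simp: z_def contr_def fam_def intro!: car_scl)

lemma Z_in: "Z e w \<in> car X"
  unfolding Z_def by (intro car_sum car_scl z_in)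

lemma Z_add: "Z (e + e') w = Z e w + Z e' w"
  by (simp add: Z_def bl_def algebra_simps vs.scale_left_distrib sum.distrib)

lemma Z_scale: "Z (c * fst e, c * snd e) w = scl X c (Z e w)"
  by (simp add: Z_def bl_def vs.scale_sum_right distrib_left mult.assoc)

lemma finI: "finite I" and fin\<Omega>: "finite \<Omega>"
  using finW by (auto intro!: finite_PiE)

lemma card_\<Omega>: "card \<Omega> > 0"
proof -
  have "W \<noteq> {}" using unitW by auto
  then show ?thesis using fin\<Omega> by (simp add: card_gt_0_iff PiE_eq_empty_iff)
qed

lemma F_le: "w \<in> \<Omega> \<Longrightarrow> F e w \<le> norm e * (\<Sum>p\<in>I. nrm X (z p))"
proof -
  assume w: "w \<in> \<Omega>"
  have "F e w \<le> (\<Sum>p\<in>I. nrm X (scl X (bl e (w p)) (z p)))"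
    unfolding F_def Z_def by (intro nrm_sum car_scl z_in)
  also have "\<dots> \<le> (\<Sum>p\<in>I. norm e * nrm X (z p))"
  proof (rule sum_mono)
    fix p assume p: "p \<in> I"
    have "w p \<in> W" using w p by (auto simp: PiE_def Pi_def)
    then have wp: "norm (w p) \<le> 1" by (rule normW)
    have "norm (bl e (w p)) \<le> norm e * norm (w p)" by (rule norm_bl_le)
    also have "\<dots> \<le> norm e * 1"
      by (intro mult_left_mono wp norm_ge_zero)
    finally show "nrm X (scl X (bl e (w p)) (z p)) \<le> norm e * nrm X (z p)"
      using z_in[OF p] by (simp add: nrm_scl nrm_nonneg mult_right_mono)
  qed
  finally show ?thesis by (simp add: sum_distrib_left)
qed

lemma F_nonneg: "0 \<le> F e w"
  unfolding F_def by (rule nrm_nonneg[OF Z_in])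

lemma F_add: "F (e + e') w \<le> F e w + F e' w"
  unfolding F_def Z_add by (rule nrm_add[OF Z_in Z_in])

lemma F_scale: "F (c * fst e, c * snd e) w = norm c * F e w"
  unfolding F_def Z_scale by (rule nrm_scl[OF Z_in])

lemma weak_l2_z:
  assumes f: "lin f" "\<And>x. x \<in> car X \<Longrightarrow> norm (f x) \<le> nrm X x"
  shows "(\<Sum>p\<in>I. (norm (f (z p)))\<^sup>2) \<le> 1"
proof -
  have yi: "y i \<in> car X" if "i < N" for i using y that by (simp add: contr_def fam_def)
  have "(\<Sum>p\<in>I. (norm (f (z p)))\<^sup>2) = (\<Sum>i<N. \<Sum>j<m. (norm (f (z (i, j))))\<^sup>2)"
    by (simp add: sum.cartesian_product)
  also have "\<dots> = (\<Sum>i<N. \<Sum>j<m. (norm (f (y i)))\<^sup>2 / real m)"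
    using m by (intro sum.cong refl)
      (simp add: z_def lin_scl[OF f(1)] yi norm_mult norm_divide power_mult_distrib power_divide)
  also have "\<dots> = (l2 N (\<lambda>i. f (y i)))\<^sup>2"
    using m by (simp add: l2_sq)
  also have "\<dots> \<le> 1\<^sup>2"
    using contr_weak_l2[OF y f(1), of 1] f(2) by (intro power_mono) auto
  finally show ?thesis by simp
qed

text \<open>A functional \<open>f w\<close> that norms \<open>Z e w\<close> shows that altering the
  coordinate \<open>p\<close> lowers \<open>F e\<close> by at most twice the modulus of
  \<open>f w (z p)\<close>. The squares of these bounds add up to at most 4 by the weak l2 bound,
  whatever \<open>N\<close> and \<open>m\<close> are. The mean is the best constant, so it may
  replace \<open>c\<close>.\<close>

lemma variance:
  assumes e: "norm e \<le> 1"
  shows "(\<Sum>w\<in>\<Omega>. (F e w - M e)\<^sup>2) \<le> 4 * real (card \<Omega>)"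
proof -
  have "\<exists>f. lin f \<and> (\<forall>x\<in>car X. norm (f x) \<le> nrm X x) \<and> f (Z e w) = of_real (F e w)" for w
    using norming_functional[OF Z_in[of e w]] unfolding F_def by metis
  then obtain f where f: "\<And>w. lin (f w)" "\<And>w x. x \<in> car X \<Longrightarrow> norm (f w x) \<le> nrm X x"
      "\<And>w. f w (Z e w) = of_real (F e w)"
    by metis
  define D where "D p w = 2 * norm (f w (z p))" for p w
  have D: "F e w - F e (w(p := v)) \<le> D p w" if p: "p \<in> I" and w: "w \<in> \<Omega>" and v: "v \<in> W" for p w v
  proof -
    have "Z e w - Z e (w(p := v)) = (\<Sum>q\<in>I. scl X (bl e (w q)) (z q) - scl X (bl e ((w(p := v)) q)) (z q))"
      by (simp add: Z_def sum_subtractf)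
    also have "\<dots> = (\<Sum>q\<in>I. if q = p then scl X (bl e (w p) - bl e v) (z p) else 0)"
      by (intro sum.cong) (auto simp: vs.scale_left_diff_distrib)
    also have "\<dots> = scl X (bl e (w p) - bl e v) (z p)"
      using p finI by simp
    finally have diff: "Z e w - Z e (w(p := v)) = scl X (bl e (w p) - bl e v) (z p)" .
    have b: "norm (bl e x) \<le> 1" if "x \<in> W" for x
      using norm_bl_le[of e x] e normW[OF that] mult_mono[of "norm e" 1 "norm x" 1] by simp
    have wp: "w p \<in> W" using w p by (auto simp: PiE_def Pi_def)
    have "of_real (F e w) = f w (scl X (bl e (w p) - bl e v) (z p)) + f w (Z e (w(p := v)))"
      unfolding diff[symmetric] by (simp add: lin_diff[OF f(1) Z_in Z_in] f(3))
    then have "norm (of_real (F e w) :: 'k) \<le> norm (f w (scl X (bl e (w p) - bl e v) (z p))) + norm (f w (Z e (w(p := v))))"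
      by (metis norm_triangle_ineq)
    also have "norm (of_real (F e w) :: 'k) = F e w" using F_nonneg by simp
    also have "norm (f w (scl X (bl e (w p) - bl e v) (z p))) = norm (bl e (w p) - bl e v) * norm (f w (z p))"
      by (simp add: lin_scl[OF f(1) z_in[OF p]] norm_mult)
    also have "\<dots> \<le> 2 * norm (f w (z p))"
      using b[OF wp] b[OF v] norm_triangle_ineq4[of "bl e (w p)" "bl e v"] by (intro mult_right_mono) auto
    also have "norm (f w (Z e (w(p := v)))) \<le> F e (w(p := v))"
      unfolding F_def by (intro f(2) Z_in)
    finally show ?thesis by (simp add: D_def)
  qed
  have "W \<noteq> {}" using unitW by auto
  then obtain c where c: "(\<Sum>w\<in>\<Omega>. (F e w - c)\<^sup>2) \<le> (\<Sum>w\<in>\<Omega>. \<Sum>p\<in>I. (D p w)\<^sup>2)"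
    using efron_stein[of W I "F e" D, OF finW _ finI D] by blast
  have "(\<Sum>w\<in>\<Omega>. (F e w - M e)\<^sup>2) + (\<Sum>w\<in>\<Omega>. (M e - c)\<^sup>2) = (\<Sum>w\<in>\<Omega>. (F e w - c)\<^sup>2)"
  proof -
    have s: "(\<Sum>w\<in>\<Omega>. F e w) = real (card \<Omega>) * M e" using card_\<Omega> by (simp add: M_def)
    have "(F e w - c)\<^sup>2 = (F e w - M e)\<^sup>2 + (M e - c)\<^sup>2 + (2 * (M e - c) * F e w - 2 * (M e - c) * M e)" for w
      by (simp add: power2_eq_square algebra_simps)
    then have "(\<Sum>w\<in>\<Omega>. (F e w - c)\<^sup>2) = (\<Sum>w\<in>\<Omega>. (F e w - M e)\<^sup>2) + (\<Sum>w\<in>\<Omega>. (M e - c)\<^sup>2)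
        + (2 * (M e - c) * (\<Sum>w\<in>\<Omega>. F e w) - 2 * (M e - c) * (real (card \<Omega>) * M e))"
      by (simp only: sum.distrib sum_subtractf sum_distrib_left[symmetric] sum_constant)
    then show ?thesis unfolding s by simp
  qed
  moreover have "(\<Sum>w\<in>\<Omega>. (M e - c)\<^sup>2) \<ge> 0" by (simp add: sum_nonneg)
  ultimately have "(\<Sum>w\<in>\<Omega>. (F e w - M e)\<^sup>2) \<le> (\<Sum>w\<in>\<Omega>. \<Sum>p\<in>I. (D p w)\<^sup>2)"
    using c by linarith
  also have "\<dots> \<le> (\<Sum>w\<in>\<Omega>. 4)"
  proof (rule sum_mono)
    fix w
    have "(\<Sum>p\<in>I. (D p w)\<^sup>2) = 4 * (\<Sum>p\<in>I. (norm (f w (z p)))\<^sup>2)"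
      by (simp add: D_def power_mult_distrib sum_distrib_left)
    also have "\<dots> \<le> 4 * 1" by (intro mult_left_mono weak_l2_z f) auto
    finally show "(\<Sum>p\<in>I. (D p w)\<^sup>2) \<le> 4" by simp
  qed
  finally show ?thesis by simp
qed

text \<open>Some sample has a total squared deviation over \<open>E\<close> no larger than the
  average, which is at most \<open>4 card E\<close>; this bounds every single deviation.\<close>

lemma concentration:
  assumes E: "finite E" "\<And>e. e \<in> E \<Longrightarrow> norm e \<le> 1"
  obtains w where "w \<in> \<Omega>" "\<And>e. e \<in> E \<Longrightarrow> \<bar>F e w - M e\<bar> \<le> 2 * sqrt (real (card E))"
proof -
  have "\<exists>w\<in>\<Omega>. (\<Sum>e\<in>E. (F e w - M e)\<^sup>2) \<le> 4 * real (card E)"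
  proof (rule ccontr)
    assume "\<not> ?thesis"
    then have "(\<Sum>w\<in>\<Omega>. 4 * real (card E)) < (\<Sum>w\<in>\<Omega>. \<Sum>e\<in>E. (F e w - M e)\<^sup>2)"
      using fin\<Omega> card_\<Omega> by (intro sum_strict_mono) (auto simp: not_le)
    also have "\<dots> = (\<Sum>e\<in>E. \<Sum>w\<in>\<Omega>. (F e w - M e)\<^sup>2)" by (rule sum.swap)
    also have "\<dots> \<le> (\<Sum>e\<in>E. 4 * real (card \<Omega>))" using variance E(2) by (intro sum_mono) auto
    finally show False by simp
  qed
  then obtain w where w: "w \<in> \<Omega>" "(\<Sum>e\<in>E. (F e w - M e)\<^sup>2) \<le> 4 * real (card E)" by blast
  have "\<bar>F e w - M e\<bar> \<le> 2 * sqrt (real (card E))" if e: "e \<in> E" for e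
  proof -
    have "(F e w - M e)\<^sup>2 \<le> (\<Sum>e\<in>E. (F e w - M e)\<^sup>2)"
      using e E by (intro member_le_sum) auto
    also have "\<dots> \<le> (2 * sqrt (real (card E)))\<^sup>2" using w(2) by (simp add: power_mult_distrib)
    finally have "\<bar>F e w - M e\<bar> \<le> \<bar>2 * sqrt (real (card E))\<bar>" by (simp only: abs_le_square_iff)
    then show ?thesis by simp
  qed
  with w(1) show thesis by (rule that)
qed

text \<open>Applying \<tau> to every coordinate permutes the sample space and carries
  \<open>F e'\<close> to \<open>F e\<close>.\<close>

lemma M_invariant:
  assumes \<tau>: "bij_betw \<tau> W W" "\<And>w. w \<in> W \<Longrightarrow> bl e' w = bl e (\<tau> w)"
  shows "M e' = M e"
proof -
  define T where "T w = (\<lambda>p\<in>I. \<tau> (w p))" for w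
  define \<tau>' where "\<tau>' = inv_into W \<tau>"
  have t': "\<tau>' (\<tau> x) = x" "\<tau> (\<tau>' x) = x" "\<tau> x \<in> W" "\<tau>' x \<in> W" if "x \<in> W" for x
    using \<tau>(1) that bij_betw_inv_into[OF \<tau>(1)]
    by (auto simp: \<tau>'_def bij_betw_def inv_into_f_f f_inv_into_f)
  have "(\<Sum>w\<in>\<Omega>. F e' w) = (\<Sum>w\<in>\<Omega>. F e w)"
  proof (rule sum.reindex_bij_witness[of _ "\<lambda>w. \<lambda>p\<in>I. \<tau>' (w p)" T])
    fix w assume w: "w \<in> \<Omega>"
    then have wp: "w p \<in> W" if "p \<in> I" for p using that by (auto simp: PiE_def Pi_def)
    show "(\<lambda>p\<in>I. \<tau>' (T w p)) = w" "T (\<lambda>p\<in>I. \<tau>' (w p)) = w"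
      using w wp t' by (auto simp: T_def fun_eq_iff restrict_def PiE_def extensional_def)
    show "T w \<in> \<Omega>" "(\<lambda>p\<in>I. \<tau>' (w p)) \<in> \<Omega>"
      using wp t' by (auto simp: T_def)
    have "Z e (T w) = Z e' w"
      unfolding Z_def using \<tau>(2) wp by (intro sum.cong) (auto simp: T_def)
    then show "F e (T w) = F e' w" by (simp add: F_def)
  qed
  then show ?thesis by (simp add: M_def)
qed

definition cb :: "(nat \<times> nat \<Rightarrow> 'k \<times> 'k) \<Rightarrow> nat \<Rightarrow> bool" where
  "cb w i \<longleftrightarrow> (\<forall>j<m. w (i, j) = (1, 0)) \<or> (\<forall>j<m. w (i, j) = - (1, 0))"

text \<open>It is enough to exclude the pattern with all entries \<open>(1, 0)\<close>, which leaves
  \<open>card W ^ m - 1\<close> patterns for each of the \<open>N\<close> blocks.\<close>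

lemma card_no_cb:
  "card {w \<in> \<Omega>. \<forall>i<N. \<not> cb w i} \<le> (card W ^ m - 1) ^ N"
proof -
  define B where "B = PiE {..<m} (\<lambda>_. W) - {\<lambda>j\<in>{..<m}. (1, 0)}"
  define C where "C w = (\<lambda>i\<in>{..<N}. \<lambda>j\<in>{..<m}. w (i, j))" for w :: "nat \<times> nat \<Rightarrow> 'k \<times> 'k"
  have "(\<lambda>j\<in>{..<m}. (1, 0)) \<in> PiE {..<m} (\<lambda>_. W)" using unitW by auto
  then have cB: "card B = card W ^ m - 1"
    unfolding B_def using finW by (subst card_Diff_singleton) (simp_all add: card_PiE)
  have "inj_on C \<Omega>"
  proof (rule inj_onI)
    fix w w' assume w: "w \<in> \<Omega>" "w' \<in> \<Omega>" "C w = C w'"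
    have "w (i, j) = w' (i, j)" if "i < N" "j < m" for i j
    proof -
      have "C w i j = C w' i j" using w(3) by simp
      then show ?thesis using that by (simp add: C_def)
    qed
    then show "w = w'" using w(1,2) by (intro PiE_ext[of w I "\<lambda>_. W"]) auto
  qed
  then have "inj_on C {w \<in> \<Omega>. \<forall>i<N. \<not> cb w i}" by (rule inj_on_subset) auto
  moreover have "C ` {w \<in> \<Omega>. \<forall>i<N. \<not> cb w i} \<subseteq> PiE {..<N} (\<lambda>_. B)"
  proof (rule image_subsetI)
    fix w assume w: "w \<in> {w \<in> \<Omega>. \<forall>i<N. \<not> cb w i}"
    have "(\<lambda>j\<in>{..<m}. w (i, j)) \<in> B" if i: "i < N" for i
    proof -
      have "(\<lambda>j\<in>{..<m}. w (i, j)) \<noteq> (\<lambda>j\<in>{..<m}. (1, 0))"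
      proof
        assume eq: "(\<lambda>j\<in>{..<m}. w (i, j)) = (\<lambda>j\<in>{..<m}. (1, 0))"
        have "w (i, j) = (1, 0)" if "j < m" for j
          using fun_cong[OF eq, of j] that by simp
        then show False using w i by (auto simp: cb_def)
      qed
      moreover have "(\<lambda>j\<in>{..<m}. w (i, j)) \<in> PiE {..<m} (\<lambda>_. W)"
        using w i by (auto simp: PiE_def Pi_def)
      ultimately show ?thesis by (simp add: B_def)
    qed
    then show "C w \<in> PiE {..<N} (\<lambda>_. B)" by (auto simp: C_def)
  qed
  moreover have "finite (PiE {..<N} (\<lambda>_. B))"
    using finW by (intro finite_PiE) (auto simp: B_def intro!: finite_PiE)
  ultimately have "card {w \<in> \<Omega>. \<forall>i<N. \<not> cb w i} \<le> card (PiE {..<N} (\<lambda>_. B))"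
    by (rule card_inj_on_le)
  then show ?thesis by (simp add: card_PiE cB)
qed

text \<open>With probability at least one half some block of the sample is constant. Flipping the signs
  in all other blocks shows that this block alone bounds the mean from below.\<close>

lemma M_lower:
  assumes lower: "\<And>i. i < N \<Longrightarrow> r \<le> nrm X (y i)" and r: "0 \<le> r"
    and N: "2 * (card W ^ m - 1) ^ N \<le> (card W ^ m) ^ N"
  shows "r * sqrt (real m) / 2 \<le> M (1, 0)"
proof -
  define A where "A = {w \<in> \<Omega>. \<exists>i<N. cb w i}"
  \<comment> \<open>The first constant block. Since \<open>cb\<close> is unaffected by a sign change
    of a block, \<sigma> keeps \<open>i0\<close>, which makes \<sigma> an involution on
    \<open>A\<close>.\<close>
  define i0 where "i0 w = (LEAST i. i < N \<and> cb w i)" for w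
  define \<sigma> where "\<sigma> w = (\<lambda>p\<in>I. if fst p = i0 w then w p else - w p)" for w :: "nat \<times> nat \<Rightarrow> 'k \<times> 'k"
  have finA: "finite A" using fin\<Omega> by (simp add: A_def)
  have "card \<Omega> = card A + card {w \<in> \<Omega>. \<forall>i<N. \<not> cb w i}"
    using fin\<Omega> by (subst card_Un_disjoint[symmetric]) (auto simp: A_def intro!: arg_cong[where f = card])
  moreover have "card \<Omega> = (card W ^ m) ^ N"
    by (simp add: card_PiE mult.commute flip: power_mult)
  ultimately have cA: "card \<Omega> \<le> 2 * card A" using card_no_cb N by linarith
  have i0: "i0 w < N" "cb w (i0 w)" if "w \<in> A" for w
    using LeastI_ex[of "\<lambda>i. i < N \<and> cb w i"] that by (auto simp: A_def i0_def)
  have cb\<sigma>: "cb (\<sigma> w) i \<longleftrightarrow> cb w i" if "i < N" for w i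
  proof (cases "i = i0 w")
    case True
    then show ?thesis using that by (simp add: cb_def \<sigma>_def)
  next
    case False
    have n: "- v = (1, 0) \<longleftrightarrow> v = - (1, 0)" "- v = - (1, 0) \<longleftrightarrow> v = (1, 0)" for v :: "'k \<times> 'k"
      by (metis minus_minus)+
    have "\<sigma> w (i, j) = - w (i, j)" if "j < m" for j
      using False \<open>i < N\<close> that by (simp add: \<sigma>_def)
    then have "cb (\<sigma> w) i \<longleftrightarrow> (\<forall>j<m. - w (i, j) = (1, 0)) \<or> (\<forall>j<m. - w (i, j) = - (1, 0))"
      unfolding cb_def by metis
    then show ?thesis unfolding n cb_def by blast
  qed
  then have i0\<sigma>: "i0 (\<sigma> w) = i0 w" for w
    unfolding i0_def by (intro arg_cong[where f = Least]) auto
  have \<sigma>\<Omega>: "\<sigma> w \<in> \<Omega>" if "w \<in> \<Omega>" for w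
    using that symW by (auto simp: \<sigma>_def PiE_def Pi_def)
  have \<sigma>A: "\<sigma> w \<in> A" if "w \<in> A" for w
    using that \<sigma>\<Omega> cb\<sigma> by (auto simp: A_def)
  have \<sigma>\<sigma>: "\<sigma> (\<sigma> w) = w" if "w \<in> A" for w
  proof
    fix p
    show "\<sigma> (\<sigma> w) p = w p"
    proof (cases "p \<in> I")
      case True
      then show ?thesis unfolding \<sigma>_def[of "\<sigma> w"] i0\<sigma> by (simp add: \<sigma>_def)
    next
      case False
      have "w \<in> extensional I" using that by (simp add: A_def PiE_def)
      then have "w p = undefined" using False by (rule extensional_arb)
      then show ?thesis using False by (simp add: \<sigma>_def[of "\<sigma> w"] restrict_def)
    qed
  qed
  have pair: "2 * (r * sqrt (real m)) \<le> F (1, 0) w + F (1, 0) (\<sigma> w)" if w: "w \<in> A" for w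
  proof -
    define i where "i = i0 w"
    have i: "i < N" using i0[OF w] by (simp add: i_def)
    obtain s :: 'k where s: "norm s = 1" "\<And>j. j < m \<Longrightarrow> bl (1, 0) (w (i, j)) = s"
    proof -
      have "cb w i" using i0[OF w] by (simp add: i_def)
      then show thesis
        using that[of 1] that[of "-1"] unfolding cb_def by (auto simp: bl_def)
    qed
    have yi: "y i \<in> car X" using y i by (simp add: contr_def fam_def)
    have neg: "bl e (- v) = - bl e v" for e v :: "'k \<times> 'k" by (simp add: bl_def)
    have "Z (1, 0) w + Z (1, 0) (\<sigma> w) = (\<Sum>p\<in>I. scl X (bl (1, 0) (w p) + bl (1, 0) (\<sigma> w p)) (z p))"
      by (simp add: Z_def vs.scale_left_distrib sum.distrib)
    also have "\<dots> = (\<Sum>k<N. \<Sum>j<m. scl X (bl (1, 0) (w (k, j)) + bl (1, 0) (\<sigma> w (k, j))) (z (k, j)))"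
      by (simp add: sum.cartesian_product)
    also have "\<dots> = (\<Sum>k<N. if k = i then \<Sum>j<m. scl X (2 * s) (z (i, j)) else 0)"
    proof (intro sum.cong refl)
      fix k assume k: "k \<in> {..<N}"
      show "(\<Sum>j<m. scl X (bl (1, 0) (w (k, j)) + bl (1, 0) (\<sigma> w (k, j))) (z (k, j)))
          = (if k = i then \<Sum>j<m. scl X (2 * s) (z (i, j)) else 0)"
      proof (cases "k = i")
        case True
        have "bl (1, 0) (w (k, j)) + bl (1, 0) (\<sigma> w (k, j)) = 2 * s" if "j < m" for j
        proof -
          have "\<sigma> w (k, j) = w (k, j)" using True k that by (simp add: \<sigma>_def i_def)
          then show ?thesis using s(2)[OF that] True by simp
        qed
        then have "(\<Sum>j<m. scl X (bl (1, 0) (w (k, j)) + bl (1, 0) (\<sigma> w (k, j))) (z (k, j)))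
            = (\<Sum>j<m. scl X (2 * s) (z (k, j)))" by (intro sum.cong) auto
        then show ?thesis using True by simp
      next
        case False
        have "bl (1, 0) (w (k, j)) + bl (1, 0) (\<sigma> w (k, j)) = 0" if "j < m" for j
        proof -
          have "\<sigma> w (k, j) = - w (k, j)" using False k that by (simp add: \<sigma>_def i_def)
          then show ?thesis by (simp add: neg)
        qed
        then show ?thesis using False by (intro trans[OF sum.neutral]) auto
      qed
    qed
    also have "\<dots> = (\<Sum>j<m. scl X (2 * s) (z (i, j)))" using i by simp
    also have "\<dots> = scl X (of_real (real m / sqrt (real m)) * (2 * s)) (y i)"
      by (simp add: z_def vs.scale_sum_left[symmetric] mult.commute)
    finally have "Z (1, 0) w + Z (1, 0) (\<sigma> w) = scl X (of_real (real m / sqrt (real m)) * (2 * s)) (y i)" .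
    then have "nrm X (Z (1, 0) w + Z (1, 0) (\<sigma> w)) = norm (of_real (real m / sqrt (real m)) * (2 * s)) * nrm X (y i)"
      by (simp only: nrm_scl[OF yi])
    also have "norm (of_real (real m / sqrt (real m)) * (2 * s)) = 2 * sqrt (real m)"
      unfolding norm_mult s(1) norm_of_real by (simp add: real_div_sqrt)
    finally have "2 * sqrt (real m) * nrm X (y i) \<le> F (1, 0) w + F (1, 0) (\<sigma> w)"
      using nrm_add[OF Z_in Z_in, of "(1, 0)" w "(1, 0)" "\<sigma> w"] by (simp add: F_def)
    moreover have "2 * sqrt (real m) * r \<le> 2 * sqrt (real m) * nrm X (y i)"
      using lower[OF i] by (intro mult_left_mono) auto
    ultimately show ?thesis by (simp add: mult_ac)
  qed
  have "real (card A) * (2 * (r * sqrt (real m))) \<le> (\<Sum>w\<in>A. F (1, 0) w + F (1, 0) (\<sigma> w))"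
    using sum_bounded_below[of A "2 * (r * sqrt (real m))" "\<lambda>w. F (1, 0) w + F (1, 0) (\<sigma> w)"] pair by simp
  also have "\<dots> = (\<Sum>w\<in>A. F (1, 0) w) + (\<Sum>w\<in>A. F (1, 0) (\<sigma> w))" by (rule sum.distrib)
  also have "(\<Sum>w\<in>A. F (1, 0) (\<sigma> w)) = (\<Sum>w\<in>A. F (1, 0) w)"
    by (rule sum.reindex_bij_witness[of _ \<sigma> \<sigma>]) (use \<sigma>A \<sigma>\<sigma> in auto)
  finally have "real (card A) * (r * sqrt (real m)) \<le> (\<Sum>w\<in>A. F (1, 0) w)" by simp
  also have "\<dots> \<le> (\<Sum>w\<in>\<Omega>. F (1, 0) w)"
    using fin\<Omega> F_nonneg by (intro sum_mono2) (auto simp: A_def)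
  finally have *: "real (card A) * (r * sqrt (real m)) \<le> (\<Sum>w\<in>\<Omega>. F (1, 0) w)" .
  have "real (card \<Omega>) \<le> 2 * real (card A)" using cA by linarith
  then have "real (card \<Omega>) * (r * sqrt (real m)) \<le> 2 * real (card A) * (r * sqrt (real m))"
    using r by (intro mult_right_mono) auto
  then have "real (card \<Omega>) * (r * sqrt (real m) / 2) \<le> (\<Sum>w\<in>\<Omega>. F (1, 0) w)"
    using * by simp
  then show ?thesis using card_\<Omega> by (simp add: M_def field_simps)
qed

end

section \<open>The Hilbert--Schmidt form of the summing property\<close>

context nspc
begin

text \<open>The \<open>m\<close>-dimensional property for the operators with components \<open>\<phi> j\<close> and the contractions
  \<open>\<ell>\<^sub>2\<^sup>n \<rightarrow> X\<close> that map the unit vectors to the \<open>x i\<close>.\<close>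

definition hs_prop :: "nat \<Rightarrow> bool" where
  "hs_prop m \<longleftrightarrow> (\<forall>\<phi> t n x. (\<forall>j<m. lin (\<phi> j)) \<and> 0 \<le> t \<and>
     (\<forall>x\<in>car X. l2 m (\<lambda>j. \<phi> j x) \<le> t * nrm X x) \<and> contr n x \<longrightarrow>
     (\<Sum>i<n. (l2 m (\<lambda>j. \<phi> j (x i)))\<^sup>2) \<le> t\<^sup>2)"

lemma hs_propD:
  assumes "hs_prop m" "\<And>j. j < m \<Longrightarrow> lin (\<phi> j)" "0 \<le> t"
    "\<And>x. x \<in> car X \<Longrightarrow> l2 m (\<lambda>j. \<phi> j x) \<le> t * nrm X x" "contr n x"
  shows "(\<Sum>i<n. (l2 m (\<lambda>j. \<phi> j (x i)))\<^sup>2) \<le> t\<^sup>2"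
  using assms unfolding hs_prop_def by blast

lemma hs_prop_mono:
  assumes hs: "hs_prop k" and mk: "m \<le> k"
  shows "hs_prop m"
  unfolding hs_prop_def
proof (intro allI impI, elim conjE)
  fix \<phi> t n x
  assume \<phi>: "\<forall>j<m. lin (\<phi> j)" and t: "0 \<le> t" and b: "\<forall>x\<in>car X. l2 m (\<lambda>j. \<phi> j x) \<le> t * nrm X x" and x: "contr n x"
  define \<psi> where "\<psi> j x = (if j < m then \<phi> j x else 0)" for j x
  have e: "l2 k (\<lambda>j. \<psi> j x) = l2 m (\<lambda>j. \<phi> j x)" for x
  proof -
    have "(\<Sum>j<k. (norm (\<psi> j x))\<^sup>2) = (\<Sum>j<m. (norm (\<phi> j x))\<^sup>2)"
      using mk by (intro sum.mono_neutral_cong_right) (auto simp: \<psi>_def)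
    then show ?thesis by (simp add: L2_set_def)
  qed
  have \<psi>: "lin (\<psi> j)" for j
    using \<phi> by (cases "j < m") (auto simp: \<psi>_def lin_def)
  have "(\<Sum>i<n. (l2 k (\<lambda>j. \<psi> j (x i)))\<^sup>2) \<le> t\<^sup>2"
    by (rule hs_propD[OF hs \<psi> t _ x]) (use b in \<open>simp add: e\<close>)
  then show "(\<Sum>i<n. (l2 m (\<lambda>j. \<phi> j (x i)))\<^sup>2) \<le> t\<^sup>2"
    unfolding e .
qed

lemma infinite_dim_indep:
  assumes "\<not> finite_dimensional X"
  shows "\<exists>b. indep n b"
proof (induction n)
  case 0
  then show ?case by (auto simp: indep_def fam_def)
next
  case (Suc n)
  then obtain b where b: "indep n b" by blast
  have fb: "b ` {..<n} \<subseteq> car X" using indep_fam[OF b] by (auto simp: fam_def)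
  have "vs.span (b ` {..<n}) \<subseteq> car X" by (rule vs.span_minimal[OF fb subspace_car])
  moreover have "vs.span (b ` {..<n}) \<noteq> car X" using assms by (auto simp: finite_dimensional_def)
  ultimately obtain z where z: "z \<in> car X" "z \<notin> vs.span (b ` {..<n})" by blast
  have "indep (Suc n) (b(n := z))"
    unfolding indep_def
  proof (intro conjI allI impI)
    show "fam (Suc n) (b(n := z))" using indep_fam[OF b] z by (auto simp: fam_def less_Suc_eq)
    fix a i assume c: "comb (Suc n) (b(n := z)) a = 0" and i: "i < Suc n"
    have e: "comb (Suc n) (b(n := z)) a = comb n b a + scl X (a n) z"
      by (simp add: comb_def)
    have "a n = 0"
    proof (rule ccontr)
      assume an: "a n \<noteq> 0"
      have "scl X (a n) z = - comb n b a" using c unfolding e by (simp add: eq_neg_iff_add_eq_0 add.commute)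
      moreover have "comb n b a \<in> vs.span (b ` {..<n})"
        unfolding comb_def by (intro vs.span_sum vs.span_scale vs.span_base) auto
      ultimately have "scl X (1 / a n) (scl X (a n) z) \<in> vs.span (b ` {..<n})"
        by (auto intro: vs.span_scale vs.span_neg)
      then show False using z(2) an by simp
    qed
    moreover from this have "\<forall>i<n. a i = 0" using c b unfolding e indep_def by simp
    ultimately show "a i = 0" using i by (auto simp: less_Suc_eq)
  qed
  then show ?case by blast
qed

end

lemma finite_net_sphere:
  assumes "0 < (\<epsilon>::real)"
  obtains A where "finite A" "\<And>e. e \<in> A \<Longrightarrow> norm e = 1"
    "\<And>e :: 'k::real_or_complex \<times> 'k. norm e = 1 \<Longrightarrow> \<exists>e'\<in>A. norm (e - e') < \<epsilon>"
proof -
  let ?S = "{e :: 'k \<times> 'k. norm e = 1}"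
  have "closed ?S" by (intro closed_Collect_eq continuous_intros)
  moreover have "compact (cball (0::'k) 1 \<times> cball (0::'k) 1)"
    by (intro compact_Times compact_cball_real_or_complex)
  ultimately have "compact ((cball 0 1 \<times> cball 0 1) \<inter> ?S)" by (intro compact_Int_closed)
  also have "(cball 0 1 \<times> cball 0 1) \<inter> ?S = ?S"
  proof -
    have "norm a \<le> 1 \<and> norm b \<le> 1" if "norm (a, b) = 1" for a b :: 'k
      using norm_fst_le[of a b] norm_snd_le[of b a] that by simp
    then show ?thesis by auto
  qed
  finally have "seq_compact ?S" by (simp add: compact_imp_seq_compact)
  then obtain A where A: "finite A" "A \<subseteq> ?S" "?S \<subseteq> (\<Union>x\<in>A. ball x \<epsilon>)"
    using seq_compact_imp_totally_bounded assms by metis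
  show thesis
  proof (rule that[OF A(1)])
    fix e :: "'k \<times> 'k" assume "norm e = 1"
    then obtain e' where "e' \<in> A" "dist e' e < \<epsilon>" using A(3) by auto
    then show "\<exists>e'\<in>A. norm (e - e') < \<epsilon>" by (auto simp: dist_norm norm_minus_commute)
  qed (use A(2) in auto)
qed

text \<open>With \<open>q = card W ^ m\<close> this gives the length at which a constant block
  occurs with probability at least one half.\<close>

lemma power_pred_small:
  fixes q :: nat
  assumes "1 \<le> q"
  obtains N where "2 * (q - 1) ^ N \<le> q ^ N"
proof -
  obtain N where N: "((real q - 1) / real q) ^ N < 1 / 2"
    using real_arch_pow_inv[of "1 / 2" "(real q - 1) / real q"] assms by auto
  have "2 * (real q - 1) ^ N \<le> real q ^ N"
    using N assms by (simp add: power_divide field_simps)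
  then have "real (2 * (q - 1) ^ N) \<le> real (q ^ N)" using assms by (simp add: of_nat_diff)
  then show thesis using that by (simp only: of_nat_le_iff)
qed

section \<open>The two-dimensional property forces finite dimension\<close>

context nspc
begin

text \<open>In the proof \<open>x\<close> represents \<open>U\<close> divided by its norm
  \<open>s0\<close>, and \<open>\<psi>\<close> represents \<open>T\<close> as a sum over
  \<open>J\<close> instead of an average, so that its norm bound \<open>t\<close> carries the factor
  \<open>card J\<close>.\<close>

lemma hs_finite_dimensional:
  assumes hs: "hs_prop 2"
  shows "finite_dimensional X"
proof (rule ccontr)
  assume inf: "\<not> finite_dimensional X"
  obtain W J g where des: "design (W :: ('k \<times> 'k) set) (J :: (nat \<times> nat) set) g"
    by (rule design_exists)
  have W: "finite W" "(1, 0) \<in> W" "\<And>w. w \<in> W \<Longrightarrow> - w \<in> W" "\<And>w. w \<in> W \<Longrightarrow> norm w \<le> 1"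
    and J: "finite J" "J \<noteq> {}" and gn: "\<And>j e. j \<in> J \<Longrightarrow> norm (g j e) = norm e"
    and gt: "\<And>j. j \<in> J \<Longrightarrow> \<exists>\<tau>. bij_betw \<tau> W W \<and> (\<forall>e. \<forall>w\<in>W. bl (g j e) w = bl e (\<tau> w))"
    and gs: "\<And>u v. norm u = 1 \<Longrightarrow> norm v = 1 \<Longrightarrow> (\<Sum>j\<in>J. norm (bl (g j u) v)) \<le> 137 / 200 * real (card J)"
    using des unfolding design_def by blast+
  define cJ where "cJ = real (card J)"
  have cJ: "cJ > 0" using J by (simp add: cJ_def card_gt_0_iff)
  obtain A where A: "finite A" "\<And>e. e \<in> A \<Longrightarrow> norm e = 1"
    "\<And>e :: 'k \<times> 'k. norm e = 1 \<Longrightarrow> \<exists>e'\<in>A. norm (e - e') < 1/100"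
    using finite_net_sphere[of "1/100"] by (metis zero_less_divide_1_iff zero_less_numeral)
  \<comment> \<open>Bound for the deviations at all points of \<open>E\<close> below. It depends on
    the net and the design only, so \<open>m\<close> can be chosen after it.\<close>
  define D where "D = 2 * sqrt (real (card A + card J))"
  have D: "D > 0" using cJ by (simp add: D_def cJ_def add_nonneg_pos)
  \<comment> \<open>The mean will be at least \<open>sqrt m / 6\<close>, hence at least 1000 times
    the deviation.\<close>
  obtain m where m: "(6000 * D)\<^sup>2 < real m" using reals_Archimedean2 by blast
  then have m0: "0 < m" by (cases m) auto
  have sm: "6000 * D \<le> sqrt (real m)" using m D by (intro real_le_rsqrt) auto
  have "1 \<le> card W ^ m" using W(1,2) by (intro one_le_power) (simp add: Suc_le_eq card_gt_0_iff, blast)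
  then obtain N where N: "2 * (card W ^ m - 1) ^ N \<le> (card W ^ m) ^ N"
    by (rule power_pred_small)
  obtain b where "indep (2 * N) b" using infinite_dim_indep[OF inf] by blast
  then obtain y where dr: "contr N y" "\<And>i. i < N \<Longrightarrow> 1 / 3 \<le> nrm X (y i)"
  proof (rule dvoretzky_rogers)
    fix y assume y: "contr N y" "\<And>i. i < N \<Longrightarrow> 1 / 3 \<le> nrm X (y i)"
    show thesis by (rule that[OF y])
  qed
  interpret random_section X W y N m
    by unfold_locales (use W dr m0 in auto)
  define L where "L = (\<Sum>p\<in>I. nrm X (z p))"
  have M_le: "M e \<le> L" if "norm e = 1" for e
  proof -
    have "(\<Sum>w\<in>\<Omega>. F e w) \<le> (\<Sum>w\<in>\<Omega>. L)"
      using F_le[of _ e] that by (intro sum_mono) (simp add: L_def)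
    then show ?thesis using card_\<Omega> by (simp add: M_def field_simps)
  qed
  define S where "S = M ` {e. norm e = 1}"
  define Ms where "Ms = Sup S"
  have bddS: "bdd_above S" using M_le by (auto simp: S_def intro!: bdd_aboveI[of _ L])
  have MMs: "M e \<le> Ms" if "norm e = 1" for e
    unfolding Ms_def using that bddS by (intro cSup_upper) (auto simp: S_def)
  have "1/3 * sqrt (real m) / 2 \<le> M (1, 0)"
    by (rule M_lower[OF dr(2) _ N]) auto
  also have "M (1, 0) \<le> Ms" by (rule MMs) (simp add: norm_Pair)
  finally have MsD: "1000 * D \<le> Ms" using sm by simp
  then have Ms: "Ms > 0" using D by linarith
  have "99/100 * Ms < Sup S" using Ms by (simp add: Ms_def)
  moreover have "M (1, 0) \<in> S" unfolding S_def by (rule imageI) (simp add: norm_Pair)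
  then have "S \<noteq> {}" by blast
  ultimately obtain e0 where e0: "norm e0 = 1" "99/100 * Ms < M e0"
    using less_cSup_iff[OF _ bddS] unfolding S_def by blast
  \<comment> \<open>The net serves the upper bound for the norm of \<open>U\<close>, the orbit of
    \<open>e0\<close> the lower bound for the norms along the orbit.\<close>
  define E where "E = A \<union> (\<lambda>j. g j e0) ` J"
  have finE: "finite E" using A J by (simp add: E_def)
  have nE: "norm e = 1" if "e \<in> E" for e
    using that unfolding E_def by (elim UnE imageE) (simp_all add: A(2) gn e0(1))
  have nE1: "norm e \<le> 1" if "e \<in> E" for e by (simp add: nE[OF that])
  obtain w where w: "w \<in> \<Omega>" "\<And>e. e \<in> E \<Longrightarrow> \<bar>F e w - M e\<bar> \<le> 2 * sqrt (real (card E))"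
  proof (rule concentration[OF finE nE1])
    fix w assume w: "w \<in> \<Omega>" "\<And>e. e \<in> E \<Longrightarrow> \<bar>F e w - M e\<bar> \<le> 2 * sqrt (real (card E))"
    show thesis by (rule that[OF w])
  qed
  have "card E \<le> card A + card J"
    unfolding E_def using card_Un_le[of A] card_image_le[OF J(1)] by (meson add_left_mono order_trans)
  then have cE: "2 * sqrt (real (card E)) \<le> D" unfolding D_def by (intro mult_left_mono) simp_all
  have FM: "\<bar>F e w - M e\<bar> \<le> D" if "e \<in> E" for e using w(2)[OF that] cE by linarith
  define s0 where "s0 = Sup ((\<lambda>e. F e w) ` {e. norm e = 1})"
  have bddF: "bdd_above ((\<lambda>e. F e w) ` {e. norm e = 1})"
  proof (rule bdd_aboveI2)
    show "F e w \<le> L" if "e \<in> {e. norm e = 1}" for e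
      using F_le[OF w(1), of e] that by (simp add: L_def)
  qed
  have Fs0: "F e w \<le> s0" if "norm e = 1" for e
    unfolding s0_def using that by (intro cSUP_upper bddF) simp
  have Fs0': "F e w \<le> norm e * s0" for e
  proof (cases "e = 0")
    case True
    then show ?thesis using F_le[OF w(1), of e] by simp
  next
    case False
    define r where "r = norm e"
    have r: "r > 0" using False by (simp add: r_def)
    define e1 where "e1 = (of_real (1 / r) * fst e, of_real (1 / r) * snd e)"
    have ee: "e = (of_real r * fst e1, of_real r * snd e1)" using r by (simp add: e1_def)
    have "norm e1 = 1"
    proof -
      have "(norm (fst e1))\<^sup>2 + (norm (snd e1))\<^sup>2 = ((norm (fst e))\<^sup>2 + (norm (snd e))\<^sup>2) / r\<^sup>2"
        using r by (simp add: e1_def norm_mult norm_divide power_divide add_divide_distrib)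
      also have "(norm (fst e))\<^sup>2 + (norm (snd e))\<^sup>2 = r\<^sup>2" by (simp add: r_def norm_prod_def)
      finally show ?thesis using r by (simp add: norm_prod_def)
    qed
    have "F e w = r * F e1 w" using F_scale[of "of_real r" e1 w] r by (simp flip: ee)
    also have "\<dots> \<le> r * s0" using Fs0[OF \<open>norm e1 = 1\<close>] r by simp
    finally show ?thesis by (simp add: r_def)
  qed
  have s0: "0 \<le> s0" using Fs0[OF e0(1)] F_nonneg[of e0 w] by linarith
  \<comment> \<open>A unit vector differs from a point of the net by a vector of norm below 1/100,
    whose image under \<open>U\<close> has norm at most \<open>s0 / 100\<close>.\<close>
  have "s0 \<le> Ms + D + s0 / 100"
    unfolding s0_def[symmetric]
  proof (subst s0_def, rule cSUP_least)
    show "{e :: 'k \<times> 'k. norm e = 1} \<noteq> {}" using e0(1) by blast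
    fix e :: "'k \<times> 'k" assume "e \<in> {e. norm e = 1}"
    then have "norm e = 1" by simp
    from A(3)[OF this] obtain e' where e': "e' \<in> A" "norm (e - e') < 1/100" by blast
    have e'E: "e' \<in> E" using e'(1) by (simp add: E_def)
    have "F e w \<le> F e' w + F (e - e') w" using F_add[of e' "e - e'" w] by simp
    moreover have "F e' w \<le> Ms + D" using FM[OF e'E] MMs[OF A(2)[OF e'(1)]] by linarith
    moreover have "F (e - e') w \<le> 1/100 * s0"
      using Fs0'[of "e - e'"] mult_right_mono[OF less_imp_le[OF e'(2)] s0] by linarith
    ultimately show "F e w \<le> Ms + D + s0 / 100" by simp
  qed
  then have s0_le: "99 * s0 \<le> 100 * (Ms + D)" by simp
  have MgE: "99/100 * Ms - D \<le> F (g j e0) w" if j: "j \<in> J" for j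
  proof -
    obtain \<tau> where "bij_betw \<tau> W W" "\<And>w. w \<in> W \<Longrightarrow> bl (g j e0) w = bl e0 (\<tau> w)" using gt[OF j] by blast
    then have "M (g j e0) = M e0" by (rule M_invariant)
    moreover have "g j e0 \<in> E" unfolding E_def using j by blast
    from FM[OF this] have "M (g j e0) - D \<le> F (g j e0) w" by linarith
    ultimately show ?thesis using e0(2) by linarith
  qed
  have s0_pos: "s0 > 0"
  proof -
    obtain j where j: "j \<in> J" using J by blast
    have "0 < 99/100 * Ms - D" using MsD Ms by simp
    also have "\<dots> \<le> F (g j e0) w" by (rule MgE[OF j])
    also have "\<dots> \<le> s0" using Fs0 gn[OF j] e0 by simp
    finally show ?thesis .
  qed
  define x where "x i = scl X (of_real (1 / s0)) (Z (if i = 0 then (1, 0) else (0, 1)) w)" for i :: nat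
  have fx: "fam 2 x" by (auto simp: fam_def x_def intro!: car_scl Z_in)
  have comb2: "comb 2 x a = scl X (of_real (1 / s0)) (Z (a 0, a 1) w)" for a
  proof -
    let ?u = "(1, 0) :: 'k \<times> 'k" and ?v = "(0, 1) :: 'k \<times> 'k"
    have "Z (a 0, a 1) w = Z (a 0 * fst ?u, a 0 * snd ?u) w + Z (a 1 * fst ?v, a 1 * snd ?v) w"
      by (simp flip: Z_add)
    also have "\<dots> = scl X (a 0) (Z ?u w) + scl X (a 1) (Z ?v w)"
      by (simp only: Z_scale)
    finally show ?thesis
      by (simp add: comb_def numeral_2_eq_2 x_def vs.scale_right_distrib mult.commute)
  qed
  have l22: "l2 2 a = norm (a 0, a 1)" for a :: "nat \<Rightarrow> 'k"
    by (simp add: L2_set_def numeral_2_eq_2 norm_Pair)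
  have x: "contr 2 x"
    unfolding contr_def
  proof (intro conjI allI fx)
    fix a
    have "nrm X (comb 2 x a) = F (a 0, a 1) w / s0"
      unfolding comb2 nrm_scl[OF Z_in] F_def using s0_pos by (simp add: norm_divide)
    also have "\<dots> \<le> l2 2 a" using Fs0'[of "(a 0, a 1)"] s0_pos by (simp add: l22 field_simps)
    finally show "nrm X (comb 2 x a) \<le> l2 2 a" .
  qed
  have "\<exists>f. lin f \<and> (\<forall>x\<in>car X. norm (f x) \<le> nrm X x) \<and> f (Z (g j e0) w) = of_real (F (g j e0) w)" for j
    using norming_functional[OF Z_in[of "g j e0" w]] unfolding F_def by metis
  then obtain f where f: "\<And>j. lin (f j)" "\<And>j x. x \<in> car X \<Longrightarrow> norm (f j x) \<le> nrm X x"
      "\<And>j. f j (Z (g j e0) w) = of_real (F (g j e0) w)"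
    by metis
  define \<psi> where "\<psi> i x = (\<Sum>j\<in>J. f j x * (if i = 0 then fst (g j e0) else snd (g j e0)))" for i :: nat and x
  define t where "t = 137/200 * cJ"
  have t: "0 \<le> t" using cJ by (simp add: t_def)
  have \<psi>lin: "lin (\<psi> i)" for i
    using f(1) by (auto simp: lin_def \<psi>_def sum.distrib distrib_right sum_distrib_left mult.assoc)
  have \<psi>le: "l2 2 (\<lambda>i. \<psi> i x) \<le> t * nrm X x" if xX: "x \<in> car X" for x
  proof (cases "(\<psi> 0 x, \<psi> (Suc 0) x) = 0")
    case True
    then show ?thesis using t nrm_nonneg[OF xX] unfolding l22 by simp
  next
    case False
    define r where "r = norm (\<psi> 0 x, \<psi> (Suc 0) x)"
    have r: "r > 0" using False unfolding r_def by (simp only: zero_less_norm_iff not_False_eq_True)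
    \<comment> \<open>Conjugate of the direction of the pair of the \<open>\<psi> i x\<close>:
      pairing with \<open>v\<close> gives the length, and the overlaps that appear are those bounded
      by the design.\<close>
    define v where "v = (kcnj (\<psi> 0 x) / of_real r, kcnj (\<psi> (Suc 0) x) / of_real r)"
    have r2: "(norm (\<psi> 0 x))\<^sup>2 + (norm (\<psi> (Suc 0) x))\<^sup>2 = r\<^sup>2" by (simp add: r_def norm_Pair)
    have nv: "norm v = 1"
    proof -
      have "(norm (fst v))\<^sup>2 + (norm (snd v))\<^sup>2 = ((norm (\<psi> 0 x))\<^sup>2 + (norm (\<psi> (Suc 0) x))\<^sup>2) / r\<^sup>2"
        using r by (simp add: v_def norm_divide power_divide add_divide_distrib)
      then show ?thesis using r by (simp add: r2 norm_prod_def)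
    qed
    have "bl (\<psi> 0 x, \<psi> (Suc 0) x) v = of_real ((norm (\<psi> 0 x))\<^sup>2 + (norm (\<psi> (Suc 0) x))\<^sup>2) / of_real r"
      by (simp add: bl_def v_def mult_kcnj add_divide_distrib)
    also have "\<dots> = of_real r" unfolding r2 using r by (simp add: power2_eq_square)
    finally have "r = norm (bl (\<psi> 0 x, \<psi> (Suc 0) x) v)" using r by simp
    also have "bl (\<psi> 0 x, \<psi> (Suc 0) x) v = (\<Sum>j\<in>J. f j x * bl (g j e0) v)"
      by (simp add: bl_def \<psi>_def sum_distrib_right sum.distrib distrib_left mult.assoc)
    also have "norm \<dots> \<le> (\<Sum>j\<in>J. nrm X x * norm (bl (g j e0) v))"
      using f(2)[OF xX] by (intro sum_norm_le) (simp add: norm_mult mult_right_mono)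
    also have "\<dots> = nrm X x * (\<Sum>j\<in>J. norm (bl (g j e0) v))" by (simp add: sum_distrib_left)
    also have "\<dots> \<le> nrm X x * t"
      unfolding t_def cJ_def by (intro mult_left_mono gs e0 nv nrm_nonneg xX)
    finally show ?thesis by (simp add: l22 r_def mult.commute)
  qed
  have "(\<Sum>i<2. (l2 2 (\<lambda>j. \<psi> j (x i)))\<^sup>2) \<le> t\<^sup>2"
    by (rule hs_propD[OF hs \<psi>lin t \<psi>le x])
  then have hs2: "(norm (\<psi> 0 (x 0)))\<^sup>2 + (norm (\<psi> (Suc 0) (x (Suc 0))))\<^sup>2 \<le> t\<^sup>2"
  proof -
    have s2: "(\<Sum>i<2. h i) = h 0 + h (Suc 0)" for h :: "nat \<Rightarrow> real" by (simp add: numeral_2_eq_2)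
    have "(\<Sum>i<2. (l2 2 (\<lambda>j. \<psi> j (x i)))\<^sup>2)
        = (norm (\<psi> 0 (x 0)))\<^sup>2 + (norm (\<psi> (Suc 0) (x 0)))\<^sup>2 + ((norm (\<psi> 0 (x (Suc 0))))\<^sup>2 + (norm (\<psi> (Suc 0) (x (Suc 0))))\<^sup>2)"
      unfolding l2_sq s2 ..
    moreover have "0 \<le> (norm (\<psi> (Suc 0) (x 0)))\<^sup>2" "0 \<le> (norm (\<psi> 0 (x (Suc 0))))\<^sup>2" by simp_all
    ultimately show ?thesis using \<open>(\<Sum>i<2. (l2 2 (\<lambda>j. \<psi> j (x i)))\<^sup>2) \<le> t\<^sup>2\<close> by linarith
  qed
  \<comment> \<open>The trace of the composition: each \<open>f j\<close> norms the image of
    \<open>g j e0\<close>, so every term is a full norm.\<close>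
  have tr: "\<psi> 0 (x 0) + \<psi> (Suc 0) (x (Suc 0)) = of_real ((\<Sum>j\<in>J. F (g j e0) w) / s0)"
  proof -
    have "f j (x 0) * fst (g j e0) + f j (x (Suc 0)) * snd (g j e0) = of_real (F (g j e0) w / s0)" for j
    proof -
      define a where "a = (\<lambda>i::nat. if i = 0 then fst (g j e0) else snd (g j e0))"
      have "f j (x 0) * fst (g j e0) + f j (x (Suc 0)) * snd (g j e0) = (\<Sum>i<2. a i * f j (x i))"
        by (simp add: numeral_2_eq_2 a_def mult.commute)
      also have "\<dots> = f j (comb 2 x a)" by (rule lin_comb[OF f(1) fx, symmetric])
      also have "\<dots> = of_real (1 / s0) * f j (Z (g j e0) w)"
        unfolding comb2 lin_scl[OF f(1) Z_in] by (simp add: a_def)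
      finally show ?thesis by (simp add: f(3))
    qed
    then have "(\<Sum>j\<in>J. f j (x 0) * fst (g j e0) + f j (x (Suc 0)) * snd (g j e0)) = (\<Sum>j\<in>J. of_real (F (g j e0) w / s0))"
      by simp
    then show ?thesis by (simp add: \<psi>_def sum.distrib sum_divide_distrib)
  qed
  define q where "q = (\<Sum>j\<in>J. F (g j e0) w) / s0"
  have "cJ * (99/100 * Ms - D) \<le> (\<Sum>j\<in>J. F (g j e0) w)"
    unfolding cJ_def using sum_bounded_below[of J "99/100 * Ms - D"] MgE by simp
  then have q: "cJ * (99/100 * Ms - D) \<le> q * s0" using s0_pos by (simp add: q_def)
  have "q\<^sup>2 \<le> 2 * t\<^sup>2"
  proof -
    have "q\<^sup>2 = (norm (\<psi> 0 (x 0) + \<psi> (Suc 0) (x (Suc 0))))\<^sup>2" unfolding tr norm_of_real q_def by (simp only: power2_abs)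
    also have "\<dots> \<le> (norm (\<psi> 0 (x 0)) + norm (\<psi> (Suc 0) (x (Suc 0))))\<^sup>2"
      by (intro power_mono norm_triangle_ineq norm_ge_zero)
    also have "\<dots> \<le> 2 * ((norm (\<psi> 0 (x 0)))\<^sup>2 + (norm (\<psi> (Suc 0) (x (Suc 0))))\<^sup>2)"
      using sum_squares_bound[of "norm (\<psi> 0 (x 0))" "norm (\<psi> (Suc 0) (x (Suc 0)))"] by (simp add: power2_sum)
    also have "\<dots> \<le> 2 * t\<^sup>2" by (intro mult_left_mono hs2) simp
    finally show ?thesis .
  qed
  moreover have "(97/100 * cJ)\<^sup>2 \<le> q\<^sup>2"
  proof (rule power_mono)
    have "s0 \<le> 100/99 * (1001/1000 * Ms)" using s0_le MsD by simp
    then have "97/100 * s0 \<le> 989/1000 * Ms" using Ms by simp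
    also have "\<dots> \<le> 99/100 * Ms - D" using MsD by simp
    finally have "cJ * (97/100 * s0) \<le> cJ * (99/100 * Ms - D)" using cJ by (intro mult_left_mono) auto
    also note q
    finally have "(97/100 * cJ) * s0 \<le> q * s0" by simp
    then show "97/100 * cJ \<le> q" using s0_pos by simp
  qed (use cJ in simp)
  \<comment> \<open>The square of 0.97 is 0.9409, while twice the square of 0.685 is 0.93845: the
    losses from the net, the deviation and the choice of \<open>e0\<close> fit into the gap left by
    the design.\<close>
  ultimately have "(97/100 * cJ)\<^sup>2 \<le> 2 * (137/200 * cJ)\<^sup>2" unfolding t_def by linarith
  then have "cJ\<^sup>2 \<le> 0" by (simp add: power_mult_distrib power_divide)
  then show False using cJ by simp
qed

end

section \<open>Operators and families of vectors\<close>

lemma fun_sum_apply: "(\<Sum>i\<in>A. f i) x = (\<Sum>i\<in>A. f i x)"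
  by (induction A rule: infinite_finite_induct) auto

lemma normed_space_ell2_fin: "normed_space (ell2_fin n :: ('k::real_or_complex, nat \<Rightarrow> 'k) nspace)"
proof -
  let ?s = "\<lambda>(c::'k) a (i::nat). c * a i"
  have vs: "vector_space ?s"
    by unfold_locales (auto simp: fun_eq_iff algebra_simps)
  interpret vector_space ?s by (rule vs)
  show ?thesis
    unfolding normed_space_def ell2_fin_def nspace.simps
  proof (intro conjI ballI allI vs)
    show "subspace {a :: nat \<Rightarrow> 'k. \<forall>i\<ge>n. a i = 0}"
      by (auto simp: subspace_def)
    fix x :: "nat \<Rightarrow> 'k" assume x: "x \<in> {a. \<forall>i\<ge>n. a i = 0}"
    show "(l2 n x = 0) = (x = 0)"
    proof
      assume l: "l2 n x = 0"
      show "x = 0"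
      proof
        fix i show "x i = 0 i" using l x by (cases "i < n") (auto simp: l2_eq_0)
      qed
    qed (simp add: L2_set_def)
    show "l2 n (\<lambda>i. c * x i) = norm c * l2 n x" for c by (rule l2_scale)
  next
    fix x y :: "nat \<Rightarrow> 'k"
    show "l2 n (x + y) \<le> l2 n x + l2 n y" using l2_triangle[of x y n] by simp
  qed
qed

lemma normed_space_scalars: "normed_space (scalars :: ('k::real_or_complex, 'k) nspace)"
proof -
  have vs: "vector_space ((*) :: 'k \<Rightarrow> 'k \<Rightarrow> 'k)"
    by unfold_locales (auto simp: algebra_simps)
  interpret vector_space "(*) :: 'k \<Rightarrow> 'k \<Rightarrow> 'k" by (rule vs)
  show ?thesis
    unfolding normed_space_def scalars_def nspace.simps
    by (auto simp: vs norm_mult norm_triangle_ineq subspace_UNIV)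
qed

lemma ell2_fin_simps [simp]:
  "a \<in> car (ell2_fin n) \<longleftrightarrow> (\<forall>i\<ge>n. a i = 0)" "scl (ell2_fin n) c a = (\<lambda>i. c * a i)" "nrm (ell2_fin n) a = l2 n a"
  by (simp_all add: ell2_fin_def)

lemma scalars_simps [simp]: "c \<in> car scalars" "scl scalars c d = c * d" "nrm scalars c = norm c"
  by (simp_all add: scalars_def)

context nspc
begin

lemma bounded_op_0:
  assumes "bounded_op X Y T" "normed_space Y"
  shows "T 0 = 0"
proof -
  interpret Y: nspc Y using assms(2) by unfold_locales
  have "T (scl X 0 0) = scl Y 0 (T 0)" using assms(1) car_0 unfolding bounded_op_def by blast
  then show ?thesis by simp
qed

lemma bounded_op_sum:
  assumes "bounded_op X Y T" "normed_space Y" "\<And>i. i \<in> A \<Longrightarrow> x i \<in> car X"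
  shows "T (\<Sum>i\<in>A. x i) = (\<Sum>i\<in>A. T (x i))"
  using assms(3)
proof (induction A rule: infinite_finite_induct)
  case (insert a A)
  have "T (x a + (\<Sum>i\<in>A. x i)) = T (x a) + T (\<Sum>i\<in>A. x i)"
    using assms(1) insert.prems car_sum[of A x] unfolding bounded_op_def by blast
  then show ?case using insert by simp
qed (auto simp: bounded_op_0[OF assms(1,2)])

lemma op_norm_le:
  assumes "\<And>x. x \<in> car X \<Longrightarrow> nrm Y (T x) \<le> t * nrm X x" "0 \<le> t"
  shows "op_norm X Y T \<le> t"
  unfolding op_norm_def
proof (rule cSUP_least)
  show "{x \<in> car X. nrm X x \<le> 1} \<noteq> {}" using car_0 by (auto intro!: exI[of _ 0])
  fix x assume x: "x \<in> {x \<in> car X. nrm X x \<le> 1}"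
  then have "t * nrm X x \<le> t * 1" using assms(2) by (intro mult_left_mono) auto
  then show "nrm Y (T x) \<le> t" using assms(1)[of x] x by auto
qed

lemma op_norm_bdd:
  assumes "bounded_op X Y T"
  shows "bdd_above ((\<lambda>x. nrm Y (T x)) ` {x \<in> car X. nrm X x \<le> 1})"
proof -
  obtain C where C: "\<And>x. x \<in> car X \<Longrightarrow> nrm Y (T x) \<le> C * nrm X x"
    using assms unfolding bounded_op_def by blast
  show ?thesis
  proof (intro bdd_aboveI2)
    fix x assume x: "x \<in> {x \<in> car X. nrm X x \<le> 1}"
    have "C * nrm X x \<le> \<bar>C\<bar> * 1"
      using x nrm_nonneg by (intro mult_mono) auto
    then show "nrm Y (T x) \<le> \<bar>C\<bar>" using C[of x] x by auto
  qed
qed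

lemma op_norm_nonneg:
  assumes "bounded_op X Y T" "normed_space Y"
  shows "0 \<le> op_norm X Y T"
proof -
  interpret Y: nspc Y using assms(2) by unfold_locales
  have "nrm Y (T 0) \<le> op_norm X Y T"
    unfolding op_norm_def by (intro cSUP_upper op_norm_bdd assms) simp
  then show ?thesis by (simp add: bounded_op_0[OF assms])
qed

lemma op_norm_bound:
  assumes T: "bounded_op X Y T" "normed_space Y" and x: "x \<in> car X"
  shows "nrm Y (T x) \<le> op_norm X Y T * nrm X x"
proof (cases "nrm X x = 0")
  case True
  interpret Y: nspc Y using assms(2) by unfold_locales
  have "x = 0" using True x by (simp add: nrm_eq_0)
  then show ?thesis by (simp add: bounded_op_0[OF T])
next
  case False
  interpret Y: nspc Y using assms(2) by unfold_locales
  define r where "r = nrm X x"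
  have r: "r > 0" using False nrm_nonneg[OF x] by (simp add: r_def)
  define x' where "x' = scl X (of_real (1 / r)) x"
  have x': "x' \<in> car X" "nrm X x' = 1"
    using x r by (simp_all add: x'_def car_scl nrm_scl norm_divide flip: r_def)
  have Tx: "T x \<in> car Y" using T(1) x unfolding bounded_op_def by blast
  have "nrm Y (T x') \<le> op_norm X Y T"
    unfolding op_norm_def using x' by (intro cSUP_upper op_norm_bdd T) simp
  also have "T x' = scl Y (of_real (1 / r)) (T x)"
    using T(1) x unfolding bounded_op_def x'_def by blast
  then have "nrm Y (T x') = nrm Y (T x) / r"
    using r by (simp add: Y.nrm_scl[OF Tx] norm_divide)
  finally show ?thesis using r by (simp add: field_simps flip: r_def)
qed

lemma l2_truncate: "l2 n (\<lambda>i. if i < n then a i else 0) = l2 n a"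
  by (intro l2_cong) simp

lemma ell2_fin_op_comb:
  assumes "bounded_op (ell2_fin n) X U" "a \<in> car (ell2_fin n)"
  shows "U a = comb n (\<lambda>i. U (Defs.unit_vec i)) a"
proof -
  interpret E: nspc "ell2_fin n" using normed_space_ell2_fin by unfold_locales
  have u: "(Defs.unit_vec i :: nat \<Rightarrow> 'k) \<in> car (ell2_fin n)" if "i < n" for i
    using that by (simp add: Defs.unit_vec_def)
  have "a = (\<Sum>i<n. scl (ell2_fin n) (a i) (Defs.unit_vec i))"
  proof
    fix j
    have "(\<Sum>i<n. scl (ell2_fin n) (a i) (Defs.unit_vec i)) j = (\<Sum>i<n. if i = j then a i else 0)"
      unfolding fun_sum_apply by (intro sum.cong) (auto simp: Defs.unit_vec_def)
    then show "a j = (\<Sum>i<n. scl (ell2_fin n) (a i) (Defs.unit_vec i)) j"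
      using assms(2) by simp
  qed
  then have "U a = U (\<Sum>i<n. scl (ell2_fin n) (a i) (Defs.unit_vec i))" by simp
  also have "\<dots> = (\<Sum>i<n. U (scl (ell2_fin n) (a i) (Defs.unit_vec i)))"
    by (rule E.bounded_op_sum[OF assms(1) ns]) (use u E.car_scl in auto)
  also have "\<dots> = comb n (\<lambda>i. U (Defs.unit_vec i)) a"
    unfolding comb_def using assms(1) u by (intro sum.cong) (auto simp: bounded_op_def)
  finally show ?thesis .
qed

lemma ell2_fin_op_contr:
  assumes U: "bounded_op (ell2_fin n) X U" "op_norm (ell2_fin n) X U \<le> 1"
  shows "contr n (\<lambda>i. U (Defs.unit_vec i))"
  unfolding contr_def
proof (intro conjI allI)
  interpret E: nspc "ell2_fin n" using normed_space_ell2_fin by unfold_locales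
  have u: "(Defs.unit_vec i :: nat \<Rightarrow> 'k) \<in> car (ell2_fin n)" if "i < n" for i
    using that by (simp add: Defs.unit_vec_def)
  show "fam n (\<lambda>i. U (Defs.unit_vec i))"
    using U(1) u unfolding fam_def bounded_op_def by blast
  fix a :: "nat \<Rightarrow> 'k"
  define a' where "a' i = (if i < n then a i else 0)" for i
  have a': "a' \<in> car (ell2_fin n)" by (simp add: a'_def)
  have "comb n (\<lambda>i. U (Defs.unit_vec i)) a = comb n (\<lambda>i. U (Defs.unit_vec i)) a'"
    by (intro comb_cong) (simp_all add: a'_def)
  also have "\<dots> = U a'" by (rule ell2_fin_op_comb[OF U(1) a', symmetric])
  finally have "nrm X (comb n (\<lambda>i. U (Defs.unit_vec i)) a) = nrm X (U a')" by simp
  also have "\<dots> \<le> op_norm (ell2_fin n) X U * l2 n a'"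
    using E.op_norm_bound[OF U(1) ns a'] by simp
  also have "\<dots> \<le> 1 * l2 n a'" by (intro mult_right_mono U(2) L2_set_nonneg)
  also have "l2 n a' = l2 n a" unfolding a'_def by (rule l2_truncate)
  finally show "nrm X (comb n (\<lambda>i. U (Defs.unit_vec i)) a) \<le> l2 n a" by simp
qed

lemma contr_op:
  assumes x: "contr n x"
  shows "bounded_op (ell2_fin n) X (comb n x)" "op_norm (ell2_fin n) X (comb n x) \<le> 1"
proof -
  interpret E: nspc "ell2_fin n" using normed_space_ell2_fin by unfold_locales
  have le: "nrm X (comb n x a) \<le> 1 * l2 n a" for a using x by (simp add: contr_def)
  show "bounded_op (ell2_fin n) X (comb n x)"
    unfolding bounded_op_def
  proof (intro conjI ballI allI)
    show "comb n x ` car (ell2_fin n) \<subseteq> car X" using contr_fam[OF x] by auto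
    show "comb n x (a + b) = comb n x a + comb n x b" for a b
      using comb_add[of n x a b] by (simp add: plus_fun_def)
    show "comb n x (scl (ell2_fin n) c a) = scl X c (comb n x a)" for c a by (simp add: comb_scale)
    show "\<exists>C. \<forall>a\<in>car (ell2_fin n). nrm X (comb n x a) \<le> C * nrm (ell2_fin n) a"
      using le by (intro exI[of _ 1]) simp
  qed
  show "op_norm (ell2_fin n) X (comb n x) \<le> 1"
    by (rule E.op_norm_le) (use le in auto)
qed

text \<open>\<open>comb n x\<close> is one of the operators in the supremum \<open>pi2\<close>; the
  empty family is treated apart because that supremum starts at \<open>n = 1\<close>.\<close>

lemma contr_pi2_lower:
  assumes x: "contr n x" and pi: "pi2 X Y T \<le> ennreal t" and t: "0 \<le> t"
  shows "(\<Sum>i<n. (nrm Y (T (x i)))\<^sup>2) \<le> t\<^sup>2"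
proof (cases "n = 0")
  case False
  have "ennreal (sqrt (\<Sum>i<n. (nrm Y (T (comb n x (Defs.unit_vec i))))\<^sup>2)) \<le> pi2 X Y T"
    unfolding pi2_def by (rule SUP_upper2[of "(n, comb n x)"]) (use False contr_op[OF x] in auto)
  also have "(\<Sum>i<n. (nrm Y (T (comb n x (Defs.unit_vec i))))\<^sup>2) = (\<Sum>i<n. (nrm Y (T (x i)))\<^sup>2)"
    by (intro sum.cong refl) (simp add: comb_unit)
  also note pi
  finally have "sqrt (\<Sum>i<n. (nrm Y (T (x i)))\<^sup>2) \<le> t" using t by (simp add: ennreal_le_iff)
  then show ?thesis using sqrt_le_D by blast
qed simp

lemma components_op:
  assumes \<phi>: "\<And>j. j < m \<Longrightarrow> lin (\<phi> j)" and t: "0 \<le> t" "\<And>x. x \<in> car X \<Longrightarrow> l2 m (\<lambda>j. \<phi> j x) \<le> t * nrm X x"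
  defines "T \<equiv> \<lambda>x j. if j < m then \<phi> j x else 0"
  shows "bounded_op X (ell2_fin m) T" "op_norm X (ell2_fin m) T \<le> t" "l2 m (T x) = l2 m (\<lambda>j. \<phi> j x)"
proof -
  show e: "l2 m (T x) = l2 m (\<lambda>j. \<phi> j x)" for x unfolding T_def by (rule l2_truncate)
  show "bounded_op X (ell2_fin m) T"
    unfolding bounded_op_def
    using \<phi> t e by (auto simp: T_def fun_eq_iff lin_def intro!: exI[of _ t])
  show "op_norm X (ell2_fin m) T \<le> t"
    by (rule op_norm_le) (use t e in auto)
qed

lemma hs_from_dim:
  assumes "summing_property_dim k X"
  shows "hs_prop k"
  unfolding hs_prop_def
proof (intro allI impI, elim conjE)
  fix \<phi> t n x
  assume \<phi>: "\<forall>j<k. lin (\<phi> j)" and t: "0 \<le> t" and b: "\<forall>x\<in>car X. l2 k (\<lambda>j. \<phi> j x) \<le> t * nrm X x" and x: "contr n x"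
  define T where "T x j = (if j < k then \<phi> j x else 0)" for x j
  have T: "bounded_op X (ell2_fin k) T" "op_norm X (ell2_fin k) T \<le> t" "\<And>x. l2 k (T x) = l2 k (\<lambda>j. \<phi> j x)"
    unfolding T_def using components_op[of k \<phi> t] \<phi> t b by auto
  have "pi2 X (ell2_fin k) T = ennreal (op_norm X (ell2_fin k) T)"
    using assms T(1) unfolding summing_property_dim_def by blast
  then have "pi2 X (ell2_fin k) T \<le> ennreal t" using T(2) by (simp add: ennreal_leI)
  from contr_pi2_lower[OF x this t] show "(\<Sum>i<n. (l2 k (\<lambda>j. \<phi> j (x i)))\<^sup>2) \<le> t\<^sup>2"
    by (simp add: T(3))
qed

text \<open>Operators into \<open>\<ell>\<^sub>2\<^sup>k\<close> become operators into
  \<open>\<ell>\<^sub>2\<close> with the same norms after padding by zeros.\<close>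

lemma hs_from_summing:
  assumes "summing_property X"
  shows "hs_prop k"
  unfolding hs_prop_def
proof (intro allI impI, elim conjE)
  fix \<phi> t n x
  assume \<phi>: "\<forall>j<k. lin (\<phi> j)" and t: "0 \<le> t" and b: "\<forall>x\<in>car X. l2 k (\<lambda>j. \<phi> j x) \<le> t * nrm X x" and x: "contr n x"
  define T where "T x j = (if j < k then \<phi> j x else 0)" for x j
  have T: "bounded_op X (ell2_fin k) T" "op_norm X (ell2_fin k) T \<le> t" "\<And>x. l2 k (T x) = l2 k (\<lambda>j. \<phi> j x)"
    unfolding T_def using components_op[of k \<phi> t] \<phi> t b by auto
  have zero: "(norm (T x i))\<^sup>2 = 0" if "i \<notin> {..<k}" for x i using that by (simp add: T_def)
  have in2: "T x \<in> car ell2" for x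
    unfolding ell2_def by (simp, rule summable_finite[of "{..<k}"]) (use zero in auto)
  have n2: "nrm ell2 (T x) = l2 k (T x)" for x
    unfolding ell2_def by (simp add: L2_set_def) (subst suminf_finite[of "{..<k}"], use zero in auto)
  have "bounded_op X ell2 T"
    using T(1) in2 unfolding bounded_op_def by (auto simp: n2) (simp add: ell2_def)
  then have "pi2 X ell2 T = ennreal (op_norm X ell2 T)"
    using assms unfolding summing_property_def by blast
  moreover have "op_norm X ell2 T \<le> t"
    by (rule op_norm_le) (use b t in \<open>auto simp: n2 T(3)\<close>)
  ultimately have "pi2 X ell2 T \<le> ennreal t" by (simp add: ennreal_leI)
  from contr_pi2_lower[OF x this t] show "(\<Sum>i<n. (l2 k (\<lambda>j. \<phi> j (x i)))\<^sup>2) \<le> t\<^sup>2"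
    by (simp add: n2 T(3))
qed

text \<open>The upper bound is the Hilbert--Schmidt condition; the lower bound, valid for every
  operator, comes from families with a single vector of norm at most 1.\<close>

lemma dim_from_hs:
  assumes hs: "hs_prop k"
  shows "summing_property_dim k X"
  unfolding summing_property_dim_def
proof (intro allI impI)
  fix T assume T: "bounded_op X (ell2_fin k) T"
  define t where "t = op_norm X (ell2_fin k) T"
  have t: "0 \<le> t" unfolding t_def by (rule op_norm_nonneg[OF T normed_space_ell2_fin])
  have Tlin: "lin (\<lambda>x. T x j)" for j
    using T unfolding bounded_op_def lin_def by simp
  have Tle: "l2 k (T x) \<le> t * nrm X x" if "x \<in> car X" for x
    using op_norm_bound[OF T normed_space_ell2_fin that] by (simp add: t_def)
  have upper: "pi2 X (ell2_fin k) T \<le> ennreal t"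
    unfolding pi2_def
  proof (rule SUP_least)
    fix p assume "p \<in> {(n, U). 1 \<le> n \<and> bounded_op (ell2_fin n) X U \<and> op_norm (ell2_fin n) X U \<le> 1}"
    then obtain n U where p: "p = (n, U)" and U: "bounded_op (ell2_fin n) X U" "op_norm (ell2_fin n) X U \<le> 1"
      by auto
    have "(\<Sum>i<n. (l2 k (\<lambda>j. T (U (Defs.unit_vec i)) j))\<^sup>2) \<le> t\<^sup>2"
      by (rule hs_propD[OF hs Tlin t Tle ell2_fin_op_contr[OF U]])
    then have "sqrt (\<Sum>i<n. (l2 k (T (U (Defs.unit_vec i))))\<^sup>2) \<le> t"
      using t by (simp add: real_le_lsqrt sum_nonneg)
    then show "(case p of (n, U) \<Rightarrow> ennreal (sqrt (\<Sum>i<n. (nrm (ell2_fin k) (T (U (Defs.unit_vec i))))\<^sup>2))) \<le> ennreal t"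
      unfolding p by (simp add: ennreal_leI)
  qed
  then obtain r where r: "pi2 X (ell2_fin k) T = ennreal r" "0 \<le> r"
    by (cases "pi2 X (ell2_fin k) T") (auto simp: top_unique)
  have "nrm (ell2_fin k) (T x) \<le> r" if x: "x \<in> car X" "nrm X x \<le> 1" for x
  proof -
    have "contr 1 (\<lambda>_. x)"
      unfolding contr_def
    proof (intro conjI allI)
      show "fam 1 (\<lambda>_. x)" using x by (simp add: fam_def)
      fix a :: "nat \<Rightarrow> 'k"
      have "norm (a 0) * nrm X x \<le> norm (a 0) * 1" using x by (intro mult_left_mono) auto
      then show "nrm X (comb 1 (\<lambda>_. x) a) \<le> l2 1 a"
        using x by (simp add: comb_def nrm_scl L2_set_def)
    qed
    from contr_pi2_lower[OF this _ r(2), of "ell2_fin k" T] have "(nrm (ell2_fin k) (T x))\<^sup>2 \<le> r\<^sup>2"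
      using r(1) by simp
    then show ?thesis using r(2) by (rule power2_le_imp_le)
  qed
  then have "t \<le> r"
    unfolding t_def op_norm_def using car_0 by (intro cSUP_least) (auto intro!: exI[of _ 0])
  then have "ennreal t \<le> pi2 X (ell2_fin k) T" using r by (simp add: ennreal_leI)
  with upper show "pi2 X (ell2_fin k) T = ennreal (op_norm X (ell2_fin k) T)"
    unfolding t_def by (rule antisym)
qed

text \<open>For a single functional the condition is its weak l2 estimate. This covers the dual of a
  space of arbitrary dimension, where reflexivity is out of reach.\<close>

lemma hs_prop_one: "hs_prop 1"
  unfolding hs_prop_def
proof (intro allI impI, elim conjE)
  fix \<phi> :: "nat \<Rightarrow> 'x \<Rightarrow> 'k" and t n x
  assume \<phi>: "\<forall>j<1. lin (\<phi> j)" and t: "0 \<le> t" and b: "\<forall>x\<in>car X. l2 1 (\<lambda>j. \<phi> j x) \<le> t * nrm X x" and x: "contr n x"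
  have l1: "l2 1 a = norm (a 0)" for a :: "nat \<Rightarrow> 'k" by (simp add: L2_set_def)
  have \<phi>0: "lin (\<phi> 0)" using \<phi> by simp
  have "norm (\<phi> 0 x) \<le> t * nrm X x" if "x \<in> car X" for x
    using b that unfolding l1 by blast
  from contr_weak_l2[OF x \<phi>0 this t] have "l2 n (\<lambda>i. \<phi> 0 (x i)) \<le> t" .
  then have "(l2 n (\<lambda>i. \<phi> 0 (x i)))\<^sup>2 \<le> t\<^sup>2" by (intro power_mono L2_set_nonneg)
  then show "(\<Sum>i<n. (l2 1 (\<lambda>j. \<phi> j (x i)))\<^sup>2) \<le> t\<^sup>2" unfolding l1 l2_sq .
qed

end

section \<open>Duality in finite dimensions\<close>

context nspc
begin

lemma dual_simps:
  "f \<in> car (dual X) \<longleftrightarrow> bounded_op X scalars f \<and> (\<forall>x. x \<notin> car X \<longrightarrow> f x = 0)"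
  "scl (dual X) c f = (\<lambda>x. c * f x)" "nrm (dual X) f = op_norm X scalars f"
  by (simp_all add: dual_def)

lemma dual_lin: "f \<in> car (dual X) \<Longrightarrow> lin f"
  by (auto simp: dual_simps bounded_op_def lin_def)

lemma dual_bound: "f \<in> car (dual X) \<Longrightarrow> x \<in> car X \<Longrightarrow> norm (f x) \<le> nrm (dual X) f * nrm X x"
  using op_norm_bound[of scalars f x] by (simp add: dual_simps normed_space_scalars)

lemma dual_nrm_nonneg: "f \<in> car (dual X) \<Longrightarrow> 0 \<le> nrm (dual X) f"
  using op_norm_nonneg[of scalars f] by (simp add: dual_simps normed_space_scalars)

lemma dual_nrm_le:
  "(\<And>x. x \<in> car X \<Longrightarrow> norm (f x) \<le> t * nrm X x) \<Longrightarrow> 0 \<le> t \<Longrightarrow> nrm (dual X) f \<le> t"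
  unfolding dual_simps by (rule op_norm_le) simp_all

lemma dual_memI:
  assumes "lin f" "\<And>x. x \<in> car X \<Longrightarrow> norm (f x) \<le> t * nrm X x" "\<And>x. x \<notin> car X \<Longrightarrow> f x = 0"
  shows "f \<in> car (dual X)"
  using assms unfolding dual_simps bounded_op_def lin_def by auto

lemma normed_space_dual: "normed_space (dual X)"
proof -
  let ?s = "\<lambda>(c::'k) (f :: 'x \<Rightarrow> 'k) x. c * f x"
  have vs: "vector_space ?s"
    by unfold_locales (auto simp: fun_eq_iff algebra_simps)
  interpret d: vector_space ?s by (rule vs)
  have add: "f + g \<in> car (dual X) \<and> nrm (dual X) (f + g) \<le> nrm (dual X) f + nrm (dual X) g"
    if fg: "f \<in> car (dual X)" "g \<in> car (dual X)" for f g
  proof -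
    have le: "norm ((f + g) x) \<le> (nrm (dual X) f + nrm (dual X) g) * nrm X x" if x: "x \<in> car X" for x
      using dual_bound[OF fg(1) x] dual_bound[OF fg(2) x] norm_triangle_ineq[of "f x" "g x"]
      by (simp add: distrib_right)
    moreover have "lin (f + g)"
      using dual_lin[OF fg(1)] dual_lin[OF fg(2)] by (simp add: lin_def algebra_simps)
    moreover have "(f + g) x = 0" if "x \<notin> car X" for x using fg that by (simp add: dual_simps)
    ultimately show ?thesis
      using dual_memI[of "f + g"] dual_nrm_le[of "f + g"] dual_nrm_nonneg fg by (metis add_nonneg_nonneg)
  qed
  have scale: "?s c f \<in> car (dual X) \<and> nrm (dual X) (?s c f) \<le> norm c * nrm (dual X) f"
    if f: "f \<in> car (dual X)" for c f
  proof -
    have le: "norm (?s c f x) \<le> (norm c * nrm (dual X) f) * nrm X x" if x: "x \<in> car X" for x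
      using mult_left_mono[OF dual_bound[OF f x] norm_ge_zero[of c]] by (simp add: norm_mult mult.assoc)
    moreover have "lin (?s c f)"
      using dual_lin[OF f] by (simp add: lin_def algebra_simps)
    moreover have "?s c f x = 0" if "x \<notin> car X" for x using f that by (simp add: dual_simps)
    ultimately show ?thesis
      using dual_memI[of "?s c f"] dual_nrm_le[of "?s c f"] dual_nrm_nonneg[OF f]
      by (metis mult_nonneg_nonneg norm_ge_zero)
  qed
  have zero: "0 \<in> car (dual X)"
    by (rule dual_memI[of _ 0]) (simp_all add: lin_def)
  have s: "scl (dual X) = ?s" by (simp add: dual_def)
  show ?thesis
    unfolding normed_space_def s
  proof (intro conjI ballI allI vs)
    show "d.subspace (car (dual X))"
      unfolding d.subspace_def using zero add scale by blast
    show "nrm (dual X) f = 0 \<longleftrightarrow> f = 0" if f: "f \<in> car (dual X)" for f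
    proof
      assume n: "nrm (dual X) f = 0"
      show "f = 0"
      proof
        fix x show "f x = 0 x"
          using dual_bound[OF f, of x] f n by (cases "x \<in> car X") (auto simp: dual_simps(1))
      qed
    next
      assume "f = 0"
      then have "nrm (dual X) f \<le> 0" by (intro dual_nrm_le) auto
      then show "nrm (dual X) f = 0" using dual_nrm_nonneg[OF f] by simp
    qed
    show "nrm (dual X) (f + g) \<le> nrm (dual X) f + nrm (dual X) g"
      if "f \<in> car (dual X)" "g \<in> car (dual X)" for f g using add that by blast
    show "nrm (dual X) (?s c f) = norm c * nrm (dual X) f" if f: "f \<in> car (dual X)" for c f
    proof (cases "c = 0")
      case True
      have "nrm (dual X) (?s c f) \<le> 0" using scale[OF f, of c] True by simp
      moreover have "0 \<le> nrm (dual X) (?s c f)" using scale[OF f, of c] dual_nrm_nonneg by blast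
      ultimately show ?thesis using True by simp
    next
      case False
      have "nrm (dual X) (?s (1 / c) (?s c f)) \<le> norm (1 / c) * nrm (dual X) (?s c f)"
        using scale[OF conjunct1[OF scale[OF f, of c]], of "1 / c"] by blast
      moreover have "?s (1 / c) (?s c f) = f" using False by simp
      ultimately have "norm c * nrm (dual X) f \<le> nrm (dual X) (?s c f)"
        using False by (simp add: norm_divide field_simps)
      then show ?thesis using scale[OF f, of c] by (intro antisym) blast+
    qed
  qed
qed

lemma finite_dim_basis:
  assumes "finite_dimensional X"
  obtains b where "indep (dimension X) b" "\<And>x. x \<in> car X \<Longrightarrow> \<exists>a. x = comb (dimension X) b a"
proof -
  obtain B0 where B0: "finite B0" "vs.span B0 = car X" using assms by (auto simp: finite_dimensional_def)
  obtain B where B: "B \<subseteq> car X" "vs.independent B" "car X \<subseteq> vs.span B" "card B = vs.dim (car X)"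
    using vs.basis_exists[of "car X"] by blast
  have finB: "finite B" using vs.independent_span_bound[OF B0(1) B(2)] B(1) B0(2) by blast
  define n where "n = dimension X"
  have cB: "card B = n" using B(4) by (simp add: n_def dimension_def)
  obtain b where "bij_betw b {0..<n} B" using ex_bij_betw_nat_finite[OF finB] cB by blast
  then have b: "bij_betw b {..<n} B" by (simp add: atLeast0LessThan)
  then have bB: "b ` {..<n} = B" and binj: "inj_on b {..<n}" by (simp_all add: bij_betw_def)
  have cb: "comb n b (\<lambda>i. u (b i)) = (\<Sum>v\<in>B. scl X (u v) v)" for u
    unfolding comb_def by (rule sum.reindex_bij_betw[OF b])
  show thesis
  proof (rule that)
    show "indep (dimension X) b"
      unfolding indep_def n_def[symmetric]
    proof (intro conjI allI impI)
      show "fam n b" using bB B(1) by (auto simp: fam_def)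
      fix a i assume a: "comb n b a = 0" and i: "i < n"
      define u where "u v = a (inv_into {..<n} b v)" for v
      have ub: "u (b i) = a i" if "i < n" for i using binj that by (simp add: u_def inv_into_f_f)
      have "comb n b a = comb n b (\<lambda>i. u (b i))" by (intro comb_cong) (simp_all add: ub)
      then have "(\<Sum>v\<in>B. scl X (u v) v) = 0" using a by (simp add: cb)
      then have "u (b i) = 0" using vs.independentD[OF B(2) finB subset_refl] bB i by blast
      then show "a i = 0" using ub[OF i] by simp
    qed
    fix x assume "x \<in> car X"
    then have "x \<in> vs.span B" using B(3) by blast
    then obtain u where "x = (\<Sum>v\<in>B. scl X (u v) v)" using vs.span_finite[OF finB] by auto
    then have "x = comb n b (\<lambda>i. u (b i))" by (simp add: cb)
    then show "\<exists>a. x = comb (dimension X) b a" by (auto simp: n_def)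
  qed
qed

text \<open>Independence makes the chosen coefficients unique, and uniqueness makes them linear on
  the carrier.\<close>

lemma coordinates:
  assumes x: "indep n x" "\<And>v. v \<in> car X \<Longrightarrow> \<exists>a. v = comb n x a"
  obtains \<kappa> where "\<And>v. v \<in> car X \<Longrightarrow> comb n x (\<kappa> v) = v" "\<And>v i. n \<le> i \<Longrightarrow> \<kappa> v i = 0"
    "\<And>a i. i < n \<Longrightarrow> \<kappa> (comb n x a) i = a i" "\<And>i. lin (\<lambda>v. \<kappa> v i)"
proof -
  define \<kappa> where "\<kappa> v i = (if i < n then (SOME a. v = comb n x a) i else 0)" for v i
  have fx: "fam n x" using x(1) by (rule indep_fam)
  have k1: "comb n x (\<kappa> v) = v" if v: "v \<in> car X" for v
  proof -
    have "comb n x (\<kappa> v) = comb n x (SOME a. v = comb n x a)" by (intro comb_cong) (simp_all add: \<kappa>_def)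
    also have "\<dots> = v" using someI_ex[OF x(2)[OF v]] by simp
    finally show ?thesis .
  qed
  have uniq: "a i = a' i" if "comb n x a = comb n x a'" "i < n" for a a' i
  proof -
    have "comb n x (\<lambda>i. a i - a' i) = 0" using that(1) by (simp add: comb_diff)
    then have "a i - a' i = 0" using x(1) that(2) unfolding indep_def by blast
    then show ?thesis by simp
  qed
  have k2: "\<kappa> (comb n x a) i = a i" if "i < n" for a i
    by (rule uniq[OF k1[OF comb_in[OF fx]] that])
  have "lin (\<lambda>v. \<kappa> v i)" for i
  proof (cases "i < n")
    case True
    have "\<kappa> (u + v) i = \<kappa> u i + \<kappa> v i" if "u \<in> car X" "v \<in> car X" for u v
    proof (rule uniq[OF _ True])
      show "comb n x (\<kappa> (u + v)) = comb n x (\<lambda>i. \<kappa> u i + \<kappa> v i)"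
        using that by (simp add: comb_add k1 car_add)
    qed
    moreover have "\<kappa> (scl X c v) i = c * \<kappa> v i" if "v \<in> car X" for c v
    proof (rule uniq[OF _ True])
      show "comb n x (\<kappa> (scl X c v)) = comb n x (\<lambda>i. c * \<kappa> v i)"
        using that by (simp add: comb_scale k1 car_scl)
    qed
    ultimately show ?thesis by (simp add: lin_def)
  next
    case False
    then show ?thesis by (simp add: lin_def \<kappa>_def)
  qed
  moreover have "\<kappa> v i = 0" if "n \<le> i" for v i using that by (simp add: \<kappa>_def)
  ultimately show thesis using that k1 k2 by blast
qed

text \<open>With the dual basis \<open>e\<close>, every functional is the sum of the
  \<open>f (b i)\<close> times \<open>e i\<close>, so the vector with coordinates
  \<open>\<Phi> (e i)\<close> represents \<Phi>. The \<open>e i\<close> are bounded by the lower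
  estimate for combinations of a basis.\<close>

lemma reflexive:
  assumes fd: "finite_dimensional X" and \<Phi>: "nspc.lin (dual X) \<Phi>"
  shows "\<exists>x\<in>car X. \<forall>f\<in>car (dual X). \<Phi> f = f x"
proof -
  interpret D: nspc "dual X" using normed_space_dual by unfold_locales
  define n where "n = dimension X"
  obtain b where b: "indep n b" "\<And>x. x \<in> car X \<Longrightarrow> \<exists>a. x = comb n b a"
    using finite_dim_basis[OF fd] unfolding n_def by metis
  have fb: "fam n b" using b(1) by (rule indep_fam)
  obtain \<kappa> where \<kappa>: "\<And>v. v \<in> car X \<Longrightarrow> comb n b (\<kappa> v) = v" "\<And>i. lin (\<lambda>v. \<kappa> v i)"
    using coordinates[OF b] by metis
  obtain c where c: "c > 0" "\<And>a. c * l2 n a \<le> nrm X (comb n b a)"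
    using indep_norm_lower[OF b(1)] by blast
  define e where "e i v = (if v \<in> car X then \<kappa> v i else 0)" for i v
  have e: "e i \<in> car (dual X)" if i: "i < n" for i
  proof (rule dual_memI[of _ "1 / c"])
    show "lin (e i)" using \<kappa>(2)[of i] by (simp add: lin_def e_def car_add car_scl)
    fix v assume v: "v \<in> car X"
    have "norm (\<kappa> v i) \<le> l2 n (\<kappa> v)" using i by (intro member_le_L2_set) auto
    then have "c * norm (\<kappa> v i) \<le> c * l2 n (\<kappa> v)" using c(1) by (intro mult_left_mono) auto
    also have "\<dots> \<le> nrm X v" using c(2)[of "\<kappa> v"] by (simp add: \<kappa>(1)[OF v])
    finally show "norm (e i v) \<le> 1 / c * nrm X v" using v c(1) by (simp add: e_def field_simps)
  qed (simp add: e_def)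
  have fe: "D.fam n e" using e by (simp add: D.fam_def)
  define x where "x = comb n b (\<lambda>i. \<Phi> (e i))"
  have "\<Phi> f = f x" if f: "f \<in> car (dual X)" for f
  proof -
    have "f = D.comb n e (\<lambda>i. f (b i))"
    proof
      fix v
      have "D.comb n e (\<lambda>i. f (b i)) v = (\<Sum>i<n. f (b i) * e i v)"
        by (simp add: D.comb_def fun_sum_apply dual_simps)
      also have "\<dots> = f v"
      proof (cases "v \<in> car X")
        case True
        have "(\<Sum>i<n. f (b i) * e i v) = (\<Sum>i<n. \<kappa> v i * f (b i))"
          using True by (simp add: e_def mult.commute)
        also have "\<dots> = f (comb n b (\<kappa> v))" by (rule lin_comb[OF dual_lin[OF f] fb, symmetric])
        finally show ?thesis by (simp add: \<kappa>(1)[OF True])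
      next
        case False
        then show ?thesis using f by (simp add: e_def dual_simps)
      qed
      finally show "f v = D.comb n e (\<lambda>i. f (b i)) v" by simp
    qed
    then have "\<Phi> f = \<Phi> (D.comb n e (\<lambda>i. f (b i)))" by simp
    also have "\<dots> = (\<Sum>i<n. f (b i) * \<Phi> (e i))" by (rule D.lin_comb[OF \<Phi> fe])
    also have "\<dots> = (\<Sum>i<n. \<Phi> (e i) * f (b i))" by (simp add: mult.commute)
    also have "\<dots> = f x" unfolding x_def by (rule lin_comb[OF dual_lin[OF f] fb, symmetric])
    finally show ?thesis .
  qed
  moreover have "x \<in> car X" unfolding x_def using fb by (rule comb_in)
  ultimately show ?thesis by blast
qed

text \<open>Transposing both operators turns a product \<open>T U\<close> on the dual into one on \<open>X\<close>. By Gram--Schmidt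
  the range of the latter lies in a \<open>k\<close>-dimensional Hilbert space even if the domain of \<open>U\<close> is larger.\<close>

lemma hs_prop_dual:
  assumes hs: "hs_prop k" and fd: "finite_dimensional X"
  shows "nspc.hs_prop (dual X) k"
proof -
  interpret D: nspc "dual X" using normed_space_dual by unfold_locales
  show ?thesis
    unfolding D.hs_prop_def
  proof (intro allI impI, elim conjE)
    fix \<Phi> t n f
    assume \<Phi>: "\<forall>j<k. D.lin (\<Phi> j)" and t: "0 \<le> t"
      and bound: "\<forall>f\<in>car (dual X). l2 k (\<lambda>j. \<Phi> j f) \<le> t * nrm (dual X) f" and f: "D.contr n f"
    have "\<exists>x\<in>car X. j < k \<longrightarrow> (\<forall>g\<in>car (dual X). \<Phi> j g = g x)" for j
      using reflexive[OF fd] \<Phi> car_0 by (cases "j < k") blast+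
    \<comment> \<open>Vectors representing the \<open>\<Phi> j\<close>. As a family in
      \<open>X\<close> they form the transpose of the operator with components \<Phi>, and the
      \<open>f i\<close> become the components of an operator on \<open>X\<close>.\<close>
    then obtain x where x: "\<And>j. x j \<in> car X" "\<And>j g. j < k \<Longrightarrow> g \<in> car (dual X) \<Longrightarrow> \<Phi> j g = g (x j)"
      by metis
    have fx: "fam k x" using x(1) by (simp add: fam_def)
    have fi: "f i \<in> car (dual X)" if "i < n" for i using f that by (simp add: D.contr_def D.fam_def)
    have xle: "nrm X (comb k x a) \<le> t * l2 k a" for a
    proof -
      have c: "comb k x a \<in> car X" using fx by (rule comb_in)
      obtain g where g: "lin g" "\<And>v. v \<in> car X \<Longrightarrow> norm (g v) \<le> nrm X v" "g (comb k x a) = of_real (nrm X (comb k x a))"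
        using norming_functional[OF c] by blast
      define h where "h v = (if v \<in> car X then g v else 0)" for v
      have h: "h \<in> car (dual X)"
        by (rule dual_memI[of _ 1]) (use g in \<open>auto simp: h_def lin_def car_add car_scl\<close>)
      have nh: "nrm (dual X) h \<le> 1" by (rule dual_nrm_le) (use g in \<open>auto simp: h_def\<close>)
      have "of_real (nrm X (comb k x a)) = h (comb k x a)" using g(3) c by (simp add: h_def)
      also have "\<dots> = (\<Sum>j<k. a j * h (x j))" by (rule lin_comb[OF dual_lin[OF h] fx])
      also have "\<dots> = ip k a (\<lambda>j. kcnj (\<Phi> j h))" by (simp add: ip_def x(2)[OF _ h])
      finally have "norm (of_real (nrm X (comb k x a)) :: 'k) \<le> l2 k a * l2 k (\<lambda>j. kcnj (\<Phi> j h))"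
        using ip_le[of k a "\<lambda>j. kcnj (\<Phi> j h)"] by simp
      then have "nrm X (comb k x a) \<le> l2 k a * l2 k (\<lambda>j. \<Phi> j h)"
        using nrm_nonneg[OF c] by simp
      also have "\<dots> \<le> l2 k a * (t * 1)"
        using bound h nh t by (intro mult_left_mono order_trans[OF bound[rule_format, OF h]]) auto
      finally show ?thesis by (simp add: mult.commute)
    qed
    have fle: "l2 n (\<lambda>i. f i v) \<le> nrm X v" if v: "v \<in> car X" for v
    proof (rule D.contr_weak_l2[OF f])
      show "D.lin (\<lambda>f. f v)" by (simp add: D.lin_def dual_simps(2))
      show "norm (g v) \<le> nrm X v * nrm (dual X) g" if "g \<in> car (dual X)" for g
        using dual_bound[OF that v] by (simp add: mult.commute)
    qed (rule nrm_nonneg[OF v])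
    \<comment> \<open>The columns of the matrix \<open>f i (x j)\<close>, for \<open>j < k\<close>,
      span at most \<open>k\<close> dimensions. Projection onto the system \<open>q\<close>
      preserves them and lengthens no other image, so \<psi> can do with \<open>k\<close>
      components, as \<open>hs\<close> requires.\<close>
    obtain q where q: "osys n k q" "\<And>j i. j < k \<Longrightarrow> i < n \<Longrightarrow> f i (x j) = proj n k q (\<lambda>i. f i (x j)) i"
      using gram_schmidt[of n k "\<lambda>j i. f i (x j)"] by blast
    define \<psi> where "\<psi> l v = ip n (\<lambda>i. f i v) (q l)" for l v
    have \<psi>lin: "lin (\<psi> l)" for l
      unfolding lin_def
    proof (intro conjI ballI allI)
      fix u v assume uv: "u \<in> car X" "v \<in> car X"
      have "\<psi> l (u + v) = ip n (\<lambda>i. f i u + f i v) (q l)"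
        unfolding \<psi>_def using uv by (intro ip_cong) (simp_all add: lin_add[OF dual_lin[OF fi]])
      then show "\<psi> l (u + v) = \<psi> l u + \<psi> l v" by (simp add: \<psi>_def ip_add_left)
    next
      fix c v assume v: "v \<in> car X"
      have "\<psi> l (scl X c v) = ip n (\<lambda>i. c * f i v) (q l)"
        unfolding \<psi>_def using v by (intro ip_cong) (simp_all add: lin_scl[OF dual_lin[OF fi]])
      then show "\<psi> l (scl X c v) = c * \<psi> l v" by (simp add: \<psi>_def ip_scale_left)
    qed
    have \<psi>le: "l2 k (\<lambda>l. \<psi> l v) \<le> 1 * nrm X v" if v: "v \<in> car X" for v
    proof -
      have "(l2 k (\<lambda>l. \<psi> l v))\<^sup>2 \<le> (l2 n (\<lambda>i. f i v))\<^sup>2"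
        using bessel[OF q(1), of "\<lambda>i. f i v"] by (simp add: l2_sq[of _ k] \<psi>_def)
      then have "l2 k (\<lambda>l. \<psi> l v) \<le> l2 n (\<lambda>i. f i v)" by (rule power2_le_imp_le) (rule L2_set_nonneg)
      then show ?thesis using fle[OF v] by simp
    qed
    have \<psi>x: "(l2 k (\<lambda>l. \<psi> l (x j)))\<^sup>2 = (l2 n (\<lambda>i. f i (x j)))\<^sup>2" if j: "j < k" for j
    proof -
      have "l2 n (\<lambda>i. f i (x j)) = l2 n (proj n k q (\<lambda>i. f i (x j)))"
        by (rule l2_cong) (rule q(2)[OF j])
      then show ?thesis by (simp add: l2_sq[of _ k] \<psi>_def l2_proj[OF q(1)])
    qed
    have "(\<Sum>j<k. (l2 k (\<lambda>l. \<psi> l (x j)))\<^sup>2) \<le> t\<^sup>2"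
    proof (cases "t = 0")
      case True
      have "\<psi> l (x j) = 0" if j: "j < k" for l j
      proof -
        have "nrm X (comb k x (Defs.unit_vec j)) \<le> 0" using xle[of "Defs.unit_vec j"] True by simp
        then have "nrm X (x j) = 0" using nrm_nonneg[OF x(1)] comb_unit[OF j, of x] by (simp add: antisym)
        then have "x j = 0" using nrm_eq_0[OF x(1)] by simp
        then show ?thesis using lin_0[OF \<psi>lin] by simp
      qed
      then have "(\<Sum>j<k. (l2 k (\<lambda>l. \<psi> l (x j)))\<^sup>2) = 0" by (simp add: L2_set_def)
      then show ?thesis by simp
    next
      case False
      with t have t: "t > 0" by simp
      define x' where "x' j = scl X (of_real (1 / t)) (x j)" for j
      have x': "contr k x'"
        unfolding contr_def
      proof (intro conjI allI)
        show "fam k x'" using x(1) by (simp add: fam_def x'_def car_scl)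
        fix a
        have "comb k x' a = scl X (of_real (1 / t)) (comb k x a)"
          unfolding comb_scale[symmetric] by (simp add: comb_def x'_def mult.commute)
        then have e: "nrm X (comb k x' a) = nrm X (comb k x a) / t"
          using t by (simp add: nrm_scl comb_in fx norm_divide)
        show "nrm X (comb k x' a) \<le> l2 k a"
          unfolding e using xle[of a] t by (simp add: pos_divide_le_eq mult.commute)
      qed
      have "(\<Sum>j<k. (l2 k (\<lambda>l. \<psi> l (x' j)))\<^sup>2) \<le> 1\<^sup>2"
        by (rule hs_propD[OF hs \<psi>lin zero_le_one \<psi>le x'])
      moreover have "(l2 k (\<lambda>l. \<psi> l (x' j)))\<^sup>2 = (l2 k (\<lambda>l. \<psi> l (x j)))\<^sup>2 / t\<^sup>2" for j
      proof -
        have "l2 k (\<lambda>l. \<psi> l (x' j)) = l2 k (\<lambda>l. of_real (1 / t) * \<psi> l (x j))"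
          by (simp add: x'_def lin_scl[OF \<psi>lin x(1)])
        also have "\<dots> = l2 k (\<lambda>l. \<psi> l (x j)) / t" unfolding l2_scale using t by (simp add: norm_divide)
        finally show ?thesis by (simp add: power_divide)
      qed
      ultimately have "(\<Sum>j<k. (l2 k (\<lambda>l. \<psi> l (x j)))\<^sup>2) / t\<^sup>2 \<le> 1"
        by (simp add: sum_divide_distrib)
      then show ?thesis using t by (simp add: field_simps)
    qed
    \<comment> \<open>The squares of the entries \<open>f i (x j)\<close> are summed by rows or by
      columns: a matrix and its transpose have the same Hilbert--Schmidt norm.\<close>
    moreover have "(\<Sum>i<n. (l2 k (\<lambda>j. \<Phi> j (f i)))\<^sup>2) = (\<Sum>j<k. (l2 k (\<lambda>l. \<psi> l (x j)))\<^sup>2)"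
    proof -
      have "(\<Sum>i<n. (l2 k (\<lambda>j. \<Phi> j (f i)))\<^sup>2) = (\<Sum>i<n. \<Sum>j<k. (norm (f i (x j)))\<^sup>2)"
        unfolding l2_sq using x(2) fi by (intro sum.cong refl) simp
      also have "\<dots> = (\<Sum>j<k. \<Sum>i<n. (norm (f i (x j)))\<^sup>2)" by (rule sum.swap)
      also have "\<dots> = (\<Sum>j<k. (l2 k (\<lambda>l. \<psi> l (x j)))\<^sup>2)"
        using \<psi>x by (intro sum.cong refl) (simp add: l2_sq[of _ n])
      finally show ?thesis .
    qed
    ultimately show "(\<Sum>i<n. (l2 k (\<lambda>j. \<Phi> j (f i)))\<^sup>2) \<le> t\<^sup>2" by simp
  qed
qed

section \<open>Maximal distance\<close>

text \<open>If \<open>S\<close> inverts \<open>T\<close>, the contraction \<open>S / s\<close>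
  followed by \<open>T\<close> is \<open>1 / s\<close> times the identity, whose squared
  Hilbert--Schmidt norm \<open>n / s^2\<close> is bounded by \<open>t^2\<close>.\<close>

lemma banach_mazur_lower:
  assumes hs: "hs_prop n"
  shows "ennreal (sqrt (real n)) \<le> banach_mazur X (ell2_fin n)"
  unfolding banach_mazur_def
proof (rule INF_greatest, clarify)
  interpret E: nspc "ell2_fin n" using normed_space_ell2_fin by unfold_locales
  fix T S
  assume T: "bounded_op X (ell2_fin n) T" and S: "bounded_op (ell2_fin n) X S"
    and TS: "\<forall>y\<in>car (ell2_fin n). T (S y) = y"
  define t where "t = op_norm X (ell2_fin n) T"
  define s where "s = op_norm (ell2_fin n) X S"
  have t: "0 \<le> t" unfolding t_def by (rule op_norm_nonneg[OF T normed_space_ell2_fin])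
  have s: "0 \<le> s" unfolding s_def by (rule E.op_norm_nonneg[OF S ns])
  have Tle: "l2 n (T x) \<le> t * nrm X x" if "x \<in> car X" for x
    using op_norm_bound[OF T normed_space_ell2_fin that] by (simp add: t_def)
  have Sle: "nrm X (S a) \<le> s * l2 n a" if "a \<in> car (ell2_fin n)" for a
    using E.op_norm_bound[OF S ns that] by (simp add: s_def)
  have u: "(Defs.unit_vec i :: nat \<Rightarrow> 'k) \<in> car (ell2_fin n)" if "i < n" for i
    using that by (simp add: Defs.unit_vec_def)
  have Su: "S (Defs.unit_vec i) \<in> car X" if "i < n" for i
    using S u[OF that] unfolding bounded_op_def by blast
  have "sqrt (real n) \<le> t * s"
  proof (cases "n = 0")
    case False
    have "s \<noteq> 0"
    proof
      assume "s = 0"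
      then have "nrm X (S (Defs.unit_vec 0)) = 0"
        using Sle[OF u, of 0] nrm_nonneg[OF Su, of 0] False by simp
      then have "S (Defs.unit_vec 0) = 0" using nrm_eq_0[OF Su, of 0] False by simp
      then have "T 0 = Defs.unit_vec 0" using TS u[of 0] False by fastforce
      then have "Defs.unit_vec 0 0 = (0 :: nat \<Rightarrow> 'k) 0"
        using bounded_op_0[OF T normed_space_ell2_fin] by simp
      then show False by (simp add: Defs.unit_vec_def)
    qed
    with s have s: "s > 0" by simp
    define x where "x i = scl X (of_real (1 / s)) (S (Defs.unit_vec i))" for i
    have x: "contr n x"
      unfolding contr_def
    proof (intro conjI allI)
      show "fam n x" using Su by (simp add: fam_def x_def car_scl)
      fix a :: "nat \<Rightarrow> 'k"
      define a' where "a' i = (if i < n then a i else 0)" for i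
      have a': "a' \<in> car (ell2_fin n)" by (simp add: a'_def)
      have Sa': "S a' \<in> car X" using S a' unfolding bounded_op_def by blast
      have "comb n x a = scl X (of_real (1 / s)) (comb n (\<lambda>i. S (Defs.unit_vec i)) a')"
        unfolding comb_scale[symmetric] by (simp add: comb_def x_def a'_def mult.commute)
      also have "comb n (\<lambda>i. S (Defs.unit_vec i)) a' = S a'"
        by (rule ell2_fin_op_comb[OF S a', symmetric])
      finally have "nrm X (comb n x a) = nrm X (S a') / s"
        using s by (simp add: nrm_scl[OF Sa'] norm_divide)
      also have "\<dots> \<le> l2 n a'" using Sle[OF a'] s by (simp add: pos_divide_le_eq mult.commute)
      also have "l2 n a' = l2 n a" unfolding a'_def by (rule l2_truncate)
      finally show "nrm X (comb n x a) \<le> l2 n a" .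
    qed
    have Tlin: "lin (\<lambda>x. T x j)" for j
      using T unfolding bounded_op_def lin_def by simp
    have "(\<Sum>i<n. (l2 n (T (x i)))\<^sup>2) \<le> t\<^sup>2"
      by (rule hs_propD[OF hs Tlin t Tle x])
    moreover have "l2 n (T (x i)) = 1 / s" if i: "i < n" for i
    proof -
      have "T (x i) = scl (ell2_fin n) (of_real (1 / s)) (T (S (Defs.unit_vec i)))"
        using T Su[OF i] unfolding x_def bounded_op_def by blast
      also have "T (S (Defs.unit_vec i)) = Defs.unit_vec i" using TS u[OF i] by blast
      finally have "l2 n (T (x i)) = norm (of_real (1 / s) :: 'k) * l2 n (Defs.unit_vec i :: nat \<Rightarrow> 'k)"
        by (simp only: ell2_fin_simps l2_scale)
      then show ?thesis using s by (simp add: l2_unit_vec[OF i] norm_divide)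
    qed
    ultimately have "real n * (1 / s)\<^sup>2 \<le> t\<^sup>2" by simp
    then have "real n \<le> (t * s)\<^sup>2" using s by (simp add: power_divide power_mult_distrib field_simps)
    then show ?thesis using t s by (intro real_le_lsqrt) auto
  qed (use t s in simp)
  then show "ennreal (sqrt (real n)) \<le> ennreal (op_norm X (ell2_fin n) T * op_norm (ell2_fin n) X S)"
    by (simp add: ennreal_leI t_def s_def)
qed

text \<open>As the distance is an infimum, John's theorem with a constant \<open>t\<close> slightly
  above \<open>sqrt n\<close> is enough; the isomorphism is the coordinate map with respect to
  John's family, with inverse \<open>comb n x\<close>.\<close>

lemma banach_mazur_upper:
  assumes fd: "finite_dimensional X"
  shows "banach_mazur X (ell2_fin (dimension X)) \<le> ennreal (sqrt (real (dimension X)))"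
proof (rule ennreal_le_epsilon)
  fix \<epsilon> :: real assume \<epsilon>: "0 < \<epsilon>"
  define n where "n = dimension X"
  define t where "t = sqrt (real n) + \<epsilon>"
  have t: "0 < t" using \<epsilon> by (simp add: t_def add_nonneg_pos)
  have "(sqrt (real n))\<^sup>2 < t\<^sup>2" using \<epsilon> by (intro power_strict_mono) (auto simp: t_def)
  then have nt: "real n < t\<^sup>2" by simp
  obtain b where b: "indep n b" "\<And>x. x \<in> car X \<Longrightarrow> \<exists>a. x = comb n b a"
    using finite_dim_basis[OF fd] unfolding n_def by metis
  obtain x where x: "contr n x" "\<And>k. k < n \<Longrightarrow> \<exists>a. b k = comb n x a" "\<And>a. l2 n a \<le> t * nrm X (comb n x a)"
  proof (rule john[OF b(1) t nt])
    fix x assume x: "contr n x" "\<And>k. k < n \<Longrightarrow> \<exists>a. b k = comb n x a" "\<And>a. l2 n a \<le> t * nrm X (comb n x a)"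
    show thesis by (rule that[OF x])
  qed
  have ix: "indep n x"
    unfolding indep_def
  proof (intro conjI allI impI)
    show "fam n x" using x(1) by (rule contr_fam)
    fix a i assume "comb n x a = 0" "i < n"
    then have "l2 n a \<le> 0" using x(3)[of a] by simp
    then have "l2 n a = 0" using L2_set_nonneg[of "\<lambda>i. norm (a i)" "{..<n}"] by linarith
    then show "a i = 0" using \<open>i < n\<close> by (simp add: l2_eq_0)
  qed
  have span: "\<exists>a. v = comb n x a" if v: "v \<in> car X" for v
  proof -
    obtain c where c: "\<And>k. k < n \<Longrightarrow> b k = comb n x (c k)" using x(2) by metis
    obtain a where "v = comb n b a" using b(2)[OF v] by blast
    also have "\<dots> = comb n (\<lambda>k. comb n x (c k)) a" using c by (intro comb_cong) auto
    also have "\<dots> = comb n x (\<lambda>i. \<Sum>k<n. a k * c k i)" by (rule comb_comb)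
    finally show ?thesis by blast
  qed
  obtain \<kappa> where \<kappa>: "\<And>v. v \<in> car X \<Longrightarrow> comb n x (\<kappa> v) = v" "\<And>v i. n \<le> i \<Longrightarrow> \<kappa> v i = 0"
    "\<And>a i. i < n \<Longrightarrow> \<kappa> (comb n x a) i = a i" "\<And>i. lin (\<lambda>v. \<kappa> v i)"
    by (rule coordinates[OF ix span]) blast+
  interpret E: nspc "ell2_fin n" using normed_space_ell2_fin by unfold_locales
  have \<kappa>le: "nrm (ell2_fin n) (\<kappa> v) \<le> t * nrm X v" if "v \<in> car X" for v
    using x(3)[of "\<kappa> v"] \<kappa>(1)[OF that] by simp
  have "bounded_op X (ell2_fin n) \<kappa>"
    unfolding bounded_op_def
  proof (intro conjI ballI allI)
    show "\<kappa> ` car X \<subseteq> car (ell2_fin n)" using \<kappa>(2) by auto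
    show "\<kappa> (u + v) = \<kappa> u + \<kappa> v" if "u \<in> car X" "v \<in> car X" for u v
      using \<kappa>(4) that by (auto simp: lin_def fun_eq_iff)
    show "\<kappa> (scl X c v) = scl (ell2_fin n) c (\<kappa> v)" if "v \<in> car X" for c v
      using \<kappa>(4) that by (auto simp: lin_def fun_eq_iff)
    show "\<exists>C. \<forall>v\<in>car X. nrm (ell2_fin n) (\<kappa> v) \<le> C * nrm X v" using \<kappa>le by blast
  qed
  moreover have "\<kappa> (comb n x a) = a" if "a \<in> car (ell2_fin n)" for a
  proof
    fix i show "\<kappa> (comb n x a) i = a i" using \<kappa>(2,3) that by (cases "i < n") auto
  qed
  ultimately have "banach_mazur X (ell2_fin n) \<le> ennreal (op_norm X (ell2_fin n) \<kappa> * op_norm (ell2_fin n) X (comb n x))"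
    unfolding banach_mazur_def using contr_op[OF x(1)] \<kappa>(1)
    by (intro INF_lower2[of "(\<kappa>, comb n x)"]) auto
  also have "\<dots> \<le> ennreal (t * 1)"
  proof (intro ennreal_leI mult_mono)
    show "op_norm X (ell2_fin n) \<kappa> \<le> t" using \<kappa>le t by (intro op_norm_le) auto
    show "0 \<le> op_norm (ell2_fin n) X (comb n x)" by (rule E.op_norm_nonneg[OF contr_op(1)[OF x(1)] ns])
  qed (use contr_op(2)[OF x(1)] t in auto)
  also have "ennreal (t * 1) = ennreal (sqrt (real n)) + ennreal \<epsilon>"
    using \<epsilon> by (simp add: t_def ennreal_plus)
  finally show "banach_mazur X (ell2_fin (dimension X)) \<le> ennreal (sqrt (real (dimension X))) + ennreal \<epsilon>"
    by (simp add: n_def)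
qed

end

theorem proposition2p1:
  fixes X :: "('k::real_or_complex, 'x::ab_group_add) nspace"
  assumes "banach_space X"
  shows "(summing_property_dim 2 X \<longrightarrow> finite_dimensional X) \<and>
         (\<forall>k\<ge>1. summing_property_dim k X \<longrightarrow> summing_property_dim k (dual X)) \<and>
         (summing_property X \<longrightarrow> maximal_distance_space X)"
proof -
  interpret nspc X using assms by unfold_locales (simp add: banach_space_def)
  interpret D: nspc "dual X" using normed_space_dual by unfold_locales
  have "summing_property_dim k (dual X)" if k: "k \<ge> 1" "summing_property_dim k X" for k
  proof (cases "k = 1")
    \<comment> \<open>Here \<open>X\<close> may be infinite dimensional; its dual has the
      one-dimensional property as every normed space does.\<close>
    case True
    then show ?thesis using D.dim_from_hs D.hs_prop_one by blast
  next
    case False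
    have hs: "hs_prop k" by (rule hs_from_dim[OF k(2)])
    have "hs_prop 2" by (rule hs_prop_mono[OF hs]) (use False k in simp)
    then show ?thesis by (intro D.dim_from_hs hs_prop_dual hs hs_finite_dimensional)
  qed
  moreover have "maximal_distance_space X" if "summing_property X"
  proof -
    have hs: "hs_prop k" for k by (rule hs_from_summing[OF that])
    have fd: "finite_dimensional X" by (rule hs_finite_dimensional[OF hs])
    then show ?thesis
      unfolding maximal_distance_space_def using banach_mazur_lower[OF hs] banach_mazur_upper by (simp add: antisym)
  qed
  ultimately show ?thesis using hs_finite_dimensional hs_from_dim by blast
qed

end
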